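(* Let $(M_1^{n_1},F_1)$ and $(M_2^{n_2},F_2)$ be Berwald (respectively, weakly Berwald) Finsler manifolds, both of finite Holmes-Thompson volume (or both of finite maximum volume, or both of finite minimum volume), and let $f$ be a positive smooth function on $M_1$. If $f$ is constant, then the Finsler warped product $(M,F)=M_1\times_f M_2$, with base $M_1$ and fiber $M_2$, is a Berwald (respectively, weakly Berwald) Finsler manifold, of finite volume with respect to the same volume measure.
   Context: A Finsler metric on a smooth manifold $M$ is a continuous $F:TM\to[0,\infty)$, smooth on $TM^0=TM\setminus\{0\}$, positively 1-homogeneous on fibers, with $g_{ij}=\frac12\frac{\partial^2F^2}{\partial y^i\partial y^j}$ positive definite on $TM^0$. Spray coefficients: $G^i=\frac14 g^{i\ell}\{[F^2]_{x^ky^\ell}y^k-[F^2]_{x^\ell}\}$. $F$ is Berwald if $B^i_{jk\ell}=\partial^3G^i/\partial y^j\partial y^k\partial y^\ell\equiv0$, and weakly Berwald if $E_{ij}=\frac12\frac{\partial^2}{\partial y^i\partial y^j}\big(\frac{\partial G^s}{\partial y^s}\big)\equiv0$. Volume forms of an $n$-dimensional $(M,F)$: Holmes-Thompson $\sigma_{HT}(x)\,dx$ with $\sigma_{HT}(x)=\frac{1}{\operatorname{Vol}(\mathbb B^n(1))}\int_{F(x,y)<1}\det(g_{ij}(x,y))\,dy$, where $\mathbb B^n(1)$ is the Euclidean unit ball; maximum $\sigma_{\max}(x)\,dx$ and minimum $\sigma_{\min}(x)\,dx$, where $\sigma_{\max}(x)$ and $\sigma_{\min}(x)$ are the maximum and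 minimum of $\sqrt{\det(g_{ij}(x,y))}$ over the indicatrix $\{y\in T_xM:F(x,y)=1\}$. The Finsler warped product $M=M_1\times_f M_2$ of a base $(M_1,F_1)$ and fiber $(M_2,F_2)$ with warping function $f>0$ smooth on $M_1$ is $M_1\times M_2$ with $F^2(x_1,y_1,x_2,y_2)=F_1^2(x_1,y_1)+f^2(x_1)F_2^2(x_2,y_2)$ on $TM_1^0\times TM_2^0$; its spray coefficients, curvatures and volume forms are computed from $F$ there (maximum and minimum over indicatrix vectors with $y_1\neq0$, $y_2\ne0$). *)

theory Defs
  imports "HOL-Analysis.Analysis"
begin

section \<open>Smooth functions on open subsets of normed spaces\<close>

fun higher_differentiable_on ::
  "'a::real_normed_vector set \<Rightarrow> ('a \<Rightarrow> 'b::real_normed_vector) \<Rightarrow> nat \<Rightarrow> bool" where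
  "higher_differentiable_on S h 0 \<longleftrightarrow> continuous_on S h"
| "higher_differentiable_on S h (Suc k) \<longleftrightarrow>
     (\<forall>x\<in>S. h differentiable (at x)) \<and>
     (\<forall>v. higher_differentiable_on S (\<lambda>x. frechet_derivative h (at x) v) k)"

text \<open>Only meaningful for open \<open>S\<close>, since the derivatives are taken in the whole space.\<close>

definition smooth_on :: "'a::real_normed_vector set \<Rightarrow> ('a \<Rightarrow> 'b::real_normed_vector) \<Rightarrow> bool" where
  "smooth_on S h \<longleftrightarrow> (\<forall>k. higher_differentiable_on S h k)"


section \<open>Smooth manifolds and tangent vectors\<close>

text \<open>
  A chart is an open set together with a coordinate map, and an atlas is a family of charts
  indexed by a type \<open>'c\<close>. The underlying topological space is the whole type \<open>'m\<close>.
  The atlas need not be maximal; all notions below are invariant under changes of coordinates.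
\<close>

type_synonym ('m, 'n) chart = "'m set \<times> ('m \<Rightarrow> real^'n)"
type_synonym ('c, 'm, 'n) atlas = "'c \<Rightarrow> ('m, 'n) chart"

definition cdom :: "('c, 'm, 'n::finite) atlas \<Rightarrow> 'c \<Rightarrow> 'm set" where
  "cdom A c = fst (A c)"

definition coord :: "('c, 'm, 'n::finite) atlas \<Rightarrow> 'c \<Rightarrow> 'm \<Rightarrow> real^'n" where
  "coord A c = snd (A c)"

definition cimage :: "('c, 'm, 'n::finite) atlas \<Rightarrow> 'c \<Rightarrow> (real^'n) set" where
  "cimage A c = coord A c ` cdom A c"

definition cinv :: "('c, 'm, 'n::finite) atlas \<Rightarrow> 'c \<Rightarrow> real^'n \<Rightarrow> 'm" where
  "cinv A c = inv_into (cdom A c) (coord A c)"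

definition smooth_manifold ::
  "('c, 'm::{second_countable_topology, t2_space}, 'n::finite) atlas \<Rightarrow> bool" where
  "smooth_manifold A \<longleftrightarrow>
     (\<Union>c. cdom A c) = UNIV \<and>
     (\<forall>c. open (cdom A c) \<and> open (cimage A c) \<and>
          homeomorphism (cdom A c) (cimage A c) (coord A c) (cinv A c)) \<and>
     (\<forall>c d. smooth_on (coord A c ` (cdom A c \<inter> cdom A d)) (coord A d \<circ> cinv A c))"

definition smooth_function :: "('c, 'm, 'n::finite) atlas \<Rightarrow> ('m \<Rightarrow> real) \<Rightarrow> bool" where
  "smooth_function A f \<longleftrightarrow> (\<forall>c. smooth_on (cimage A c) (f \<circ> cinv A c))"

text \<open>
  A tangent vector at \<open>p\<close> is given by its components \<open>v c\<close> in all charts \<open>c\<close> around \<open>p\<close>, subject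
  to the transformation law; for the other charts the entry is fixed to be \<open>0\<close>.
\<close>

definition tangent_space :: "('c, 'm, 'n::finite) atlas \<Rightarrow> 'm \<Rightarrow> ('c \<Rightarrow> real^'n) set" where
  "tangent_space A p =
     {v. (\<forall>c. p \<notin> cdom A c \<longrightarrow> v c = 0) \<and>
         (\<forall>c d. p \<in> cdom A c \<longrightarrow> p \<in> cdom A d \<longrightarrow>
            v d = frechet_derivative (coord A d \<circ> cinv A c) (at (coord A c p)) (v c))}"

text \<open>The tangent vector at \<open>p\<close> whose components in the chart \<open>c\<close> are \<open>y\<close>.\<close>

definition tangent_vector :: "('c, 'm, 'n::finite) atlas \<Rightarrow> 'c \<Rightarrow> 'm \<Rightarrow> real^'n \<Rightarrow> ('c \<Rightarrow> real^'n)" where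
  "tangent_vector A c p y =
     (\<lambda>d. if p \<in> cdom A d
          then frechet_derivative (coord A d \<circ> cinv A c) (at (coord A c p)) y else 0)"

text \<open>The differential of \<open>h\<close> at \<open>p\<close>; for smooth \<open>h\<close> the choice of the chart \<open>c\<close> is immaterial.\<close>

definition tangent_map ::
  "('c, 'm, 'n::finite) atlas \<Rightarrow> ('d, 'k, 'l::finite) atlas \<Rightarrow> ('m \<Rightarrow> 'k) \<Rightarrow>
   'm \<Rightarrow> ('c \<Rightarrow> real^'n) \<Rightarrow> ('d \<Rightarrow> real^'l)" where
  "tangent_map A B h p v =
     (let c = (SOME c. p \<in> cdom A c) in
      (\<lambda>d. if h p \<in> cdom B d
           then frechet_derivative (coord B d \<circ> h \<circ> cinv A c) (at (coord A c p)) (v c) else 0))"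

definition slit_tangent_bundle :: "('c, 'm, 'n::finite) atlas \<Rightarrow> ('m \<times> ('c \<Rightarrow> real^'n)) set" where
  "slit_tangent_bundle A = {(p, v). v \<in> tangent_space A p \<and> v \<noteq> (\<lambda>_. 0)}"

definition join_vec :: "real^'a \<Rightarrow> real^'b \<Rightarrow> real^('a::finite + 'b::finite)" where
  "join_vec x y = (\<chi> k. case k of Inl i \<Rightarrow> x $ i | Inr j \<Rightarrow> y $ j)"

definition product_atlas ::
  "('c1, 'm1, 'n1::finite) atlas \<Rightarrow> ('c2, 'm2, 'n2::finite) atlas \<Rightarrow>
   ('c1 \<times> 'c2, 'm1 \<times> 'm2, 'n1 + 'n2) atlas" where
  "product_atlas A1 A2 =
     (\<lambda>(c1, c2). (cdom A1 c1 \<times> cdom A2 c2,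
                  \<lambda>(p1, p2). join_vec (coord A1 c1 p1) (coord A2 c2 p2)))"


section \<open>Finsler metrics\<close>

text \<open>A function on the tangent bundle; its values are only relevant for \<open>v \<in> tangent_space A p\<close>.\<close>

type_synonym ('c, 'm, 'n) tangent_fun = "'m \<Rightarrow> ('c \<Rightarrow> real^'n) \<Rightarrow> real"

definition local_rep ::
  "('c, 'm, 'n::finite) atlas \<Rightarrow> ('c, 'm, 'n) tangent_fun \<Rightarrow> 'c \<Rightarrow> real^'n \<Rightarrow> real^'n \<Rightarrow> real" where
  "local_rep A F c x y = F (cinv A c x) (tangent_vector A c (cinv A c x) y)"

text \<open>The pairs of coordinates \<open>(x, y)\<close> of the points of a subset \<open>D\<close> of the tangent bundle.\<close>

definition local_set ::
  "('c, 'm, 'n::finite) atlas \<Rightarrow> ('m \<times> ('c \<Rightarrow> real^'n)) set \<Rightarrow> 'c \<Rightarrow> ((real^'n) \<times> (real^'n)) set" where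
  "local_set A D c =
     {(x, y). x \<in> cimage A c \<and> (cinv A c x, tangent_vector A c (cinv A c x) y) \<in> D}"

definition partial :: "'n \<Rightarrow> (real^'n \<Rightarrow> real) \<Rightarrow> real^'n::finite \<Rightarrow> real" where
  "partial i h z = deriv (\<lambda>t. h (z + t *\<^sub>R axis i 1)) 0"

definition fundamental_tensor ::
  "('c, 'm, 'n::finite) atlas \<Rightarrow> ('c, 'm, 'n) tangent_fun \<Rightarrow> 'c \<Rightarrow> real^'n \<Rightarrow> real^'n \<Rightarrow> real^'n^'n" where
  "fundamental_tensor A F c x y =
     (\<chi> i j. (1/2) * partial i (\<lambda>z. partial j (\<lambda>w. (local_rep A F c x w)\<^sup>2) z) y)"

text \<open>
  In all that follows, \<open>D\<close> is the part of the slit tangent bundle on which \<open>F\<close> is required to be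
  regular and on which its derivatives are taken. For an ordinary Finsler metric \<open>D\<close> is
  \<^term>\<open>slit_tangent_bundle A\<close>; for a warped product it is the product of the two slit tangent
  bundles, because there \<open>F\<close> is in general not smooth at vectors tangent to one of the factors.
\<close>

definition finsler_manifold ::
  "('c, 'm::{second_countable_topology, t2_space}, 'n::finite) atlas \<Rightarrow>
   ('m \<times> ('c \<Rightarrow> real^'n)) set \<Rightarrow> ('c, 'm, 'n) tangent_fun \<Rightarrow> bool" where
  "finsler_manifold A D F \<longleftrightarrow>
     smooth_manifold A \<and>
     (\<forall>p. \<forall>v\<in>tangent_space A p. F p v \<ge> 0) \<and>
     (\<forall>c. continuous_on (cimage A c \<times> UNIV) (\<lambda>(x, y). local_rep A F c x y)) \<and>
     (\<forall>c. smooth_on (local_set A D c) (\<lambda>(x, y). local_rep A F c x y)) \<and>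
     (\<forall>p. \<forall>v\<in>tangent_space A p. \<forall>r>0. F p (\<lambda>c. r *\<^sub>R v c) = r * F p v) \<and>
     (\<forall>c. \<forall>(x, y)\<in>local_set A D c. \<forall>u. u \<noteq> 0 \<longrightarrow> u \<bullet> (fundamental_tensor A F c x y *v u) > 0)"

definition spray_coeff ::
  "('c, 'm, 'n::finite) atlas \<Rightarrow> ('c, 'm, 'n) tangent_fun \<Rightarrow> 'c \<Rightarrow> 'n \<Rightarrow> real^'n \<Rightarrow> real^'n \<Rightarrow> real" where
  "spray_coeff A F c i x y =
     (1/4) * (\<Sum>l\<in>UNIV. matrix_inv (fundamental_tensor A F c x y) $ i $ l *
       ((\<Sum>k\<in>UNIV. partial l (\<lambda>w. partial k (\<lambda>z. (local_rep A F c z w)\<^sup>2) x) y * y $ k)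
        - partial l (\<lambda>z. (local_rep A F c z y)\<^sup>2) x))"

definition berwald_curvature ::
  "('c, 'm, 'n::finite) atlas \<Rightarrow> ('c, 'm, 'n) tangent_fun \<Rightarrow> 'c \<Rightarrow> 'n \<Rightarrow> 'n \<Rightarrow> 'n \<Rightarrow> 'n \<Rightarrow>
   real^'n \<Rightarrow> real^'n \<Rightarrow> real" where
  "berwald_curvature A F c i j k l x y =
     partial j (\<lambda>y. partial k (\<lambda>y. partial l (\<lambda>y. spray_coeff A F c i x y) y) y) y"

definition mean_berwald_curvature ::
  "('c, 'm, 'n::finite) atlas \<Rightarrow> ('c, 'm, 'n) tangent_fun \<Rightarrow> 'c \<Rightarrow> 'n \<Rightarrow> 'n \<Rightarrow>
   real^'n \<Rightarrow> real^'n \<Rightarrow> real" where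
  "mean_berwald_curvature A F c i j x y =
     (1/2) * partial i (\<lambda>y. partial j (\<lambda>y. \<Sum>s\<in>UNIV. partial s (\<lambda>y. spray_coeff A F c s x y) y) y) y"

definition berwald_manifold ::
  "('c, 'm::{second_countable_topology, t2_space}, 'n::finite) atlas \<Rightarrow>
   ('m \<times> ('c \<Rightarrow> real^'n)) set \<Rightarrow> ('c, 'm, 'n) tangent_fun \<Rightarrow> bool" where
  "berwald_manifold A D F \<longleftrightarrow> finsler_manifold A D F \<and>
     (\<forall>c. \<forall>(x, y)\<in>local_set A D c. \<forall>i j k l. berwald_curvature A F c i j k l x y = 0)"

definition weakly_berwald_manifold ::
  "('c, 'm::{second_countable_topology, t2_space}, 'n::finite) atlas \<Rightarrow>
   ('m \<times> ('c \<Rightarrow> real^'n)) set \<Rightarrow> ('c, 'm, 'n) tangent_fun \<Rightarrow> bool" where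
  "weakly_berwald_manifold A D F \<longleftrightarrow> finsler_manifold A D F \<and>
     (\<forall>c. \<forall>(x, y)\<in>local_set A D c. \<forall>i j. mean_berwald_curvature A F c i j x y = 0)"


section \<open>Volume forms\<close>

definition indicatrix ::
  "('c, 'm, 'n::finite) atlas \<Rightarrow> ('m \<times> ('c \<Rightarrow> real^'n)) set \<Rightarrow> ('c, 'm, 'n) tangent_fun \<Rightarrow>
   'c \<Rightarrow> real^'n \<Rightarrow> (real^'n) set" where
  "indicatrix A D F c x = {y. (x, y) \<in> local_set A D c \<and> local_rep A F c x y = 1}"

datatype volume_form = Holmes_Thompson | Maximum | Minimum

text \<open>
  The fibres of \<open>D\<close> have full measure in the tangent spaces, so that the domain of integration
  in the first equation is the unit ball of \<open>F\<close> up to a null set.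
\<close>

fun volume_density ::
  "volume_form \<Rightarrow> ('c, 'm, 'n::finite) atlas \<Rightarrow> ('m \<times> ('c \<Rightarrow> real^'n)) set \<Rightarrow>
   ('c, 'm, 'n) tangent_fun \<Rightarrow> 'c \<Rightarrow> real^'n \<Rightarrow> real" where
  "volume_density Holmes_Thompson A D F c x =
     (1 / measure lborel (ball (0::real^'n) 1)) *
     (LBINT y:{y. (x, y) \<in> local_set A D c \<and> local_rep A F c x y < 1}.
        det (fundamental_tensor A F c x y))"
| "volume_density Maximum A D F c x =
     (GREATEST s. s \<in> (\<lambda>y. sqrt (det (fundamental_tensor A F c x y))) ` indicatrix A D F c x)"
| "volume_density Minimum A D F c x =
     (LEAST s. s \<in> (\<lambda>y. sqrt (det (fundamental_tensor A F c x y))) ` indicatrix A D F c x)"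

text \<open>
  The volume measure is the (unique) Borel measure on the manifold that is \<open>\<sigma>(x) dx\<close> in each chart.
\<close>

definition volume_measure ::
  "('c, 'm::topological_space, 'n::finite) atlas \<Rightarrow> ('c \<Rightarrow> real^'n \<Rightarrow> real) \<Rightarrow> 'm measure \<Rightarrow> bool" where
  "volume_measure A \<sigma> \<mu> \<longleftrightarrow>
     sets \<mu> = sets borel \<and>
     (\<forall>c. \<forall>S\<in>sets borel. S \<subseteq> cdom A c \<longrightarrow>
        emeasure \<mu> S = (\<integral>\<^sup>+x\<in>coord A c ` S. ennreal (\<sigma> c x) \<partial>lborel))"

definition finite_volume ::
  "volume_form \<Rightarrow> ('c, 'm::topological_space, 'n::finite) atlas \<Rightarrow>
   ('m \<times> ('c \<Rightarrow> real^'n)) set \<Rightarrow> ('c, 'm, 'n) tangent_fun \<Rightarrow> bool" where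
  "finite_volume V A D F \<longleftrightarrow>
     (\<exists>\<mu>. volume_measure A (volume_density V A D F) \<mu> \<and> emeasure \<mu> UNIV < \<infinity>)"


section \<open>Warped products\<close>

definition warped_metric ::
  "('c1, 'm1, 'n1::finite) atlas \<Rightarrow> ('c1, 'm1, 'n1) tangent_fun \<Rightarrow>
   ('c2, 'm2, 'n2::finite) atlas \<Rightarrow> ('c2, 'm2, 'n2) tangent_fun \<Rightarrow> ('m1 \<Rightarrow> real) \<Rightarrow>
   ('c1 \<times> 'c2, 'm1 \<times> 'm2, 'n1 + 'n2) tangent_fun" where
  "warped_metric A1 F1 A2 F2 f = (\<lambda>p v.
     sqrt ((F1 (fst p) (tangent_map (product_atlas A1 A2) A1 fst p v))\<^sup>2 +
           (f (fst p))\<^sup>2 * (F2 (snd p) (tangent_map (product_atlas A1 A2) A2 snd p v))\<^sup>2))"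

definition product_slit_bundle ::
  "('c1, 'm1, 'n1::finite) atlas \<Rightarrow> ('c2, 'm2, 'n2::finite) atlas \<Rightarrow>
   (('m1 \<times> 'm2) \<times> ('c1 \<times> 'c2 \<Rightarrow> real^('n1 + 'n2))) set" where
  "product_slit_bundle A1 A2 =
     {(p, v). v \<in> tangent_space (product_atlas A1 A2) p \<and>
        (fst p, tangent_map (product_atlas A1 A2) A1 fst p v) \<in> slit_tangent_bundle A1 \<and>
        (snd p, tangent_map (product_atlas A1 A2) A2 snd p v) \<in> slit_tangent_bundle A2}"

end

theory Submission
  imports Defs
begin

text \<open>
  With \<open>f = k\<close> constant, \<open>F\<^sup>2 = F1\<^sup>2 + k\<^sup>2 F2\<^sup>2\<close> has in product coordinates the block diagonal
  fundamental tensor with blocks \<open>g1\<close> and \<open>k\<^sup>2 g2\<close>. The factor \<open>k\<^sup>2\<close> cancels in the spray coefficients,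
  which are therefore those of the two factors, each depending only on the coordinates of its own
  factor; hence the (mean) Berwald curvature splits as well.

  Since \<open>det g1\<close> and \<open>det g2\<close> are homogeneous of degree \<open>0\<close>, they may be evaluated independently of
  each other on the indicatrix of \<open>F\<close>, so that the maximum and the minimum of the determinant factorise.
  For the Holmes-Thompson density, homogeneity shows that the integral over the unit ball of \<open>F\<close> is
  a universal constant times the product of the integrals over the unit balls of \<open>F1\<close> and \<open>F2\<close>.
  In all three cases the density of \<open>F\<close> is a constant multiple of the product of the densities of
  \<open>F1\<close> and \<open>F2\<close>, and the volume measure is that multiple of the product measure.
\<close>

section \<open>Calculus of smooth functions\<close>

text \<open>The derivatives in the definitions are total operators, and the spray coefficients are
  never shown to be differentiable. The curvature computations therefore exchange functions that
  agree on an open set and use identities of \<open>deriv\<close> that hold even where no derivative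
  exists. The open set is \<open>product_slit\<close>, because the two metrics are controlled only
  away from zero vectors. Pulling \<open>\<kappa>\<close> out of a derivative does use
  differentiability, that of the squared metrics.

  Constancy of \<open>f\<close> enters in two ways. A derivative of \<open>f\<close> would add terms
  to the spray that mix the two factors, and the factor between the density of the product and the
  product of the densities would vary with the point.

  Identifying the product measure in a chart needs the densities to be measurable in the position.
  For the maximum and the minimum this is not visible in the definition; it is extracted from
  continuity of the metric tensor in position and velocity together.\<close>

lemma frechet_derivative_cong_open:
  assumes "open S" "x \<in> S" "\<And>z. z \<in> S \<Longrightarrow> h z = g z"
  shows "frechet_derivative h (at x) = frechet_derivative g (at x)"
proof -
  \<comment> \<open>Both functions have the same set of derivatives at \<open>x\<close>, so the
    choice hidden in \<open>frechet_derivative\<close> agrees even when that set is empty.\<close>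
  have "(h has_derivative D) (at x) \<longleftrightarrow> (g has_derivative D) (at x)" for D
    using assms has_derivative_transform_within_open[of h D x UNIV S g]
      has_derivative_transform_within_open[of g D x UNIV S h] by auto
  then show ?thesis by (simp add: frechet_derivative_def)
qed

lemma differentiable_cong_open:
  assumes "open S" "x \<in> S" "\<And>z. z \<in> S \<Longrightarrow> h z = g z"
  shows "h differentiable (at x) \<longleftrightarrow> g differentiable (at x)"
  using assms has_derivative_transform_within_open[of h _ x UNIV S g]
      has_derivative_transform_within_open[of g _ x UNIV S h]
  unfolding differentiable_def by auto

lemma frechet_derivative_eqI:
  "(h has_derivative D) (at x) \<Longrightarrow> frechet_derivative h (at x) = D"
  by (metis frechet_derivative_at)

lemma higher_differentiable_on_cong:
  assumes "open S" "\<And>x. x \<in> S \<Longrightarrow> h x = g x"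
  shows "higher_differentiable_on S h k \<longleftrightarrow> higher_differentiable_on S g k"
  using assms(2)
proof (induction k arbitrary: h g)
  case 0
  then show ?case by (auto intro: continuous_on_cong)
next
  case (Suc k)
  have "higher_differentiable_on S (\<lambda>x. frechet_derivative h (at x) v) k \<longleftrightarrow>
      higher_differentiable_on S (\<lambda>x. frechet_derivative g (at x) v) k" for v
    using frechet_derivative_cong_open[OF assms(1), of _ h g] Suc.prems by (intro Suc.IH) auto
  moreover have "(\<forall>x\<in>S. h differentiable (at x)) \<longleftrightarrow> (\<forall>x\<in>S. g differentiable (at x))"
    using differentiable_cong_open[OF assms(1), of _ h g] Suc.prems by blast
  ultimately show ?case by simp
qed

lemma higher_differentiable_on_Suc_imp:
  "higher_differentiable_on S h (Suc k) \<Longrightarrow> higher_differentiable_on S h k"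
proof (induction k arbitrary: h)
  case 0
  then show ?case
    by (auto intro!: continuous_at_imp_continuous_on differentiable_imp_continuous_within)
next
  case (Suc k)
  then show ?case by (metis higher_differentiable_on.simps(2))
qed

lemma higher_differentiable_on_const: "higher_differentiable_on S (\<lambda>x. c) k"
proof (induction k arbitrary: c)
  case (Suc k)
  then show ?case by (simp add: frechet_derivative_eqI[OF has_derivative_const])
qed simp

text \<open>The projections of a product are linear, and for linear substitutions the induction
  closes: the derivative of \<open>h \<circ> L\<close> in the direction \<open>v\<close> is the
  derivative of \<open>h\<close> in the fixed direction \<open>L v\<close>, again composed with
  \<open>L\<close>. A nonlinear substitution would make that direction depend on the point.\<close>

lemma higher_differentiable_on_linear_right:
  assumes L: "bounded_linear L" and "open T"
  shows "higher_differentiable_on S h k \<Longrightarrow> L ` T \<subseteq> S \<Longrightarrow> higher_differentiable_on T (\<lambda>x. h (L x)) k"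
proof (induction k arbitrary: h)
  case 0
  have "continuous_on T L"
    using L by (simp add: linear_continuous_on)
  then show ?case using 0 continuous_on_compose2[of S h T L] by auto
next
  case (Suc k)
  have der: "((\<lambda>x. h (L x)) has_derivative (\<lambda>v. frechet_derivative h (at (L x)) (L v))) (at x)"
    if "x \<in> T" for x
  proof (rule has_derivative_compose[of L])
    show "(L has_derivative L) (at x)" using L by (rule bounded_linear_imp_has_derivative)
    show "(h has_derivative frechet_derivative h (at (L x))) (at (L x))"
      using Suc.prems that by (auto simp: frechet_derivative_works[symmetric])
  qed
  have "higher_differentiable_on T (\<lambda>x. frechet_derivative (\<lambda>x. h (L x)) (at x) v) k" for v
  proof -
    have "higher_differentiable_on T (\<lambda>x. frechet_derivative h (at (L x)) (L v)) k"
      using Suc.IH[of "\<lambda>z. frechet_derivative h (at z) (L v)"] Suc.prems by auto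
    moreover have "frechet_derivative (\<lambda>x. h (L x)) (at x) v = frechet_derivative h (at (L x)) (L v)"
      if "x \<in> T" for x
      using frechet_derivative_eqI[OF der[OF that]] by simp
    ultimately show ?thesis
      using higher_differentiable_on_cong[OF \<open>open T\<close>] by (metis (no_types, lifting))
  qed
  then show ?case using der by (auto simp: differentiable_def)
qed

lemma higher_differentiable_on_linear_left:
  assumes L: "bounded_linear L" and "open S"
  shows "higher_differentiable_on S h k \<Longrightarrow> higher_differentiable_on S (\<lambda>x. L (h x)) k"
proof (induction k arbitrary: h)
  case 0
  then show ?case using bounded_linear.continuous_on[OF L] by auto
next
  case (Suc k)
  have der: "((\<lambda>x. L (h x)) has_derivative (\<lambda>v. L (frechet_derivative h (at x) v))) (at x)"
    if "x \<in> S" for x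
    using Suc.prems that bounded_linear.has_derivative[OF L] by (auto simp: frechet_derivative_works)
  have "higher_differentiable_on S (\<lambda>x. frechet_derivative (\<lambda>x. L (h x)) (at x) v) k" for v
  proof -
    have "higher_differentiable_on S (\<lambda>x. L (frechet_derivative h (at x) v)) k"
      using Suc.IH[of "\<lambda>z. frechet_derivative h (at z) v"] Suc.prems by auto
    then show ?thesis
      using higher_differentiable_on_cong[OF \<open>open S\<close>] frechet_derivative_eqI[OF der]
      by (metis (no_types, lifting))
  qed
  then show ?case using der by (auto simp: differentiable_def)
qed

lemma higher_differentiable_on_add:
  assumes "open S"
  shows "higher_differentiable_on S g k \<Longrightarrow> higher_differentiable_on S h k \<Longrightarrow>
    higher_differentiable_on S (\<lambda>x. g x + h x) k"
proof (induction k arbitrary: g h)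
  case 0
  then show ?case by (auto intro: continuous_on_add)
next
  case (Suc k)
  have der: "((\<lambda>x. g x + h x) has_derivative
      (\<lambda>v. frechet_derivative g (at x) v + frechet_derivative h (at x) v)) (at x)"
    if "x \<in> S" for x
    using Suc.prems that by (auto simp: frechet_derivative_works intro!: has_derivative_add)
  have "higher_differentiable_on S (\<lambda>x. frechet_derivative (\<lambda>x. g x + h x) (at x) v) k" for v
  proof -
    have "higher_differentiable_on S
        (\<lambda>x. frechet_derivative g (at x) v + frechet_derivative h (at x) v) k"
      using Suc.prems by (intro Suc.IH) auto
    then show ?thesis
      using higher_differentiable_on_cong[OF \<open>open S\<close>] frechet_derivative_eqI[OF der]
      by (metis (no_types, lifting))
  qed
  then show ?case using der by (auto simp: differentiable_def)
qed

lemma higher_differentiable_on_mult: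
  fixes g h :: "'a::real_normed_vector \<Rightarrow> real"
  assumes "open S"
  shows "higher_differentiable_on S g k \<Longrightarrow> higher_differentiable_on S h k \<Longrightarrow>
    higher_differentiable_on S (\<lambda>x. g x * h x) k"
proof (induction k arbitrary: g h)
  case 0
  then show ?case by (auto intro: continuous_on_mult)
next
  case (Suc k)
  have der: "((\<lambda>x. g x * h x) has_derivative
      (\<lambda>v. g x * frechet_derivative h (at x) v + frechet_derivative g (at x) v * h x)) (at x)"
    if "x \<in> S" for x
    using Suc.prems that by (auto simp: frechet_derivative_works intro!: has_derivative_mult)
  have "higher_differentiable_on S (\<lambda>x. frechet_derivative (\<lambda>x. g x * h x) (at x) v) k" for v
  proof -
    have "higher_differentiable_on S
        (\<lambda>x. g x * frechet_derivative h (at x) v + frechet_derivative g (at x) v * h x) k"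
      using Suc.prems higher_differentiable_on_Suc_imp[of S g k] higher_differentiable_on_Suc_imp[of S h k]
      by (intro higher_differentiable_on_add[OF \<open>open S\<close>] Suc.IH) auto
    then show ?thesis
      using higher_differentiable_on_cong[OF \<open>open S\<close>] frechet_derivative_eqI[OF der]
      by (metis (no_types, lifting))
  qed
  then show ?case using der by (auto simp: differentiable_def)
qed

text \<open>Differentiation lowers the exponent by one, so the induction runs over all real
  exponents at once; this is why the square root is treated as a power.\<close>

lemma higher_differentiable_on_powr:
  fixes h :: "'a::real_normed_vector \<Rightarrow> real"
  assumes "open S" and pos: "\<And>x. x \<in> S \<Longrightarrow> h x > 0"
  shows "higher_differentiable_on S h k \<Longrightarrow> higher_differentiable_on S (\<lambda>x. h x powr a) k"
proof (induction k arbitrary: a)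
  case 0
  then show ?case using pos by (auto intro!: continuous_on_powr simp: less_imp_neq[symmetric])
next
  case (Suc k)
  have der: "((\<lambda>x. h x powr a) has_derivative
      (\<lambda>v. a * (h x powr (a - 1) * frechet_derivative h (at x) v))) (at x)"
    if "x \<in> S" for x
  proof -
    have "(h has_derivative frechet_derivative h (at x)) (at x)"
      using Suc.prems that by (auto simp: frechet_derivative_works)
    moreover have "((\<lambda>z. z powr a) has_derivative (\<lambda>v. (a * h x powr (a - 1)) * v)) (at (h x))"
      using has_real_derivative_powr[OF pos[OF that], of a] by (simp add: has_field_derivative_def)
    ultimately show ?thesis
      using has_derivative_compose[of h "frechet_derivative h (at x)" x UNIV "\<lambda>z. z powr a"]
      by (simp add: mult.assoc)
  qed
  have "higher_differentiable_on S (\<lambda>x. frechet_derivative (\<lambda>x. h x powr a) (at x) v) k" for v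
  proof -
    have "higher_differentiable_on S (\<lambda>x. a * (h x powr (a - 1) * frechet_derivative h (at x) v)) k"
      using Suc.prems higher_differentiable_on_Suc_imp[of S h k]
      by (intro higher_differentiable_on_mult[OF \<open>open S\<close>] higher_differentiable_on_const Suc.IH) auto
    then show ?thesis
      using higher_differentiable_on_cong[OF \<open>open S\<close>] frechet_derivative_eqI[OF der]
      by (metis (no_types, lifting))
  qed
  then show ?case using der by (auto simp: differentiable_def)
qed

section \<open>Closure properties of smooth functions\<close>

lemma smooth_on_differentiable: "smooth_on S h \<Longrightarrow> x \<in> S \<Longrightarrow> h differentiable (at x)"
  unfolding smooth_on_def by (metis higher_differentiable_on.simps(2))

lemma smooth_on_frechet:
  "smooth_on S h \<Longrightarrow> smooth_on S (\<lambda>x. frechet_derivative h (at x) v)"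
  unfolding smooth_on_def by (metis higher_differentiable_on.simps(2))

lemma smooth_on_continuous: "smooth_on S h \<Longrightarrow> continuous_on S h"
  unfolding smooth_on_def by (metis higher_differentiable_on.simps(1))

lemma smooth_on_cong:
  "open S \<Longrightarrow> (\<And>x. x \<in> S \<Longrightarrow> h x = g x) \<Longrightarrow> smooth_on S h \<longleftrightarrow> smooth_on S g"
  using higher_differentiable_on_cong[of S h g] unfolding smooth_on_def by blast

lemma smooth_on_linear_right:
  "bounded_linear L \<Longrightarrow> open T \<Longrightarrow> L ` T \<subseteq> S \<Longrightarrow> smooth_on S h \<Longrightarrow> smooth_on T (\<lambda>x. h (L x))"
  unfolding smooth_on_def using higher_differentiable_on_linear_right by blast

lemma smooth_on_linear_left:
  "bounded_linear L \<Longrightarrow> open S \<Longrightarrow> smooth_on S h \<Longrightarrow> smooth_on S (\<lambda>x. L (h x))"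
  unfolding smooth_on_def using higher_differentiable_on_linear_left by blast

lemma smooth_on_add:
  "open S \<Longrightarrow> smooth_on S g \<Longrightarrow> smooth_on S h \<Longrightarrow> smooth_on S (\<lambda>x. g x + h x)"
  unfolding smooth_on_def using higher_differentiable_on_add by blast

lemma smooth_on_const: "smooth_on S (\<lambda>x. c)"
  unfolding smooth_on_def using higher_differentiable_on_const by blast

lemma smooth_on_mult:
  fixes g h :: "'a::real_normed_vector \<Rightarrow> real"
  shows "open S \<Longrightarrow> smooth_on S g \<Longrightarrow> smooth_on S h \<Longrightarrow> smooth_on S (\<lambda>x. g x * h x)"
  unfolding smooth_on_def using higher_differentiable_on_mult by blast

lemma smooth_on_sqrt:
  fixes h :: "'a::real_normed_vector \<Rightarrow> real"
  assumes "open S" "smooth_on S h" "\<And>x. x \<in> S \<Longrightarrow> h x > 0"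
  shows "smooth_on S (\<lambda>x. sqrt (h x))"
proof -
  have "smooth_on S (\<lambda>x. h x powr (1/2))"
    using assms higher_differentiable_on_powr[of S h] unfolding smooth_on_def by blast
  then show ?thesis
    using smooth_on_cong[OF assms(1), of "\<lambda>x. sqrt (h x)" "\<lambda>x. h x powr (1/2)"] assms(3)
    by (simp add: powr_half_sqrt less_imp_le)
qed

section \<open>Splitting of coordinates and block matrices\<close>

definition left_vec :: "real^('a::finite + 'b::finite) \<Rightarrow> real^'a" where
  "left_vec z = (\<chi> i. z $ Inl i)"

definition right_vec :: "real^('a::finite + 'b::finite) \<Rightarrow> real^'b" where
  "right_vec z = (\<chi> i. z $ Inr i)"

lemma sum_type_all: "(\<forall>x::'a+'b. P x) \<longleftrightarrow> (\<forall>a. P (Inl a)) \<and> (\<forall>b. P (Inr b))"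
  by (metis sum.exhaust)

lemma sum_UNIV_sum:
  "(\<Sum>i\<in>(UNIV :: ('a::finite + 'b::finite) set). g i) = (\<Sum>a\<in>UNIV. g (Inl a)) + (\<Sum>b\<in>UNIV. g (Inr b))"
  using sum.Plus[of "UNIV::'a set" "UNIV::'b set" g] by simp

lemma prod_UNIV_sum:
  "(\<Prod>i\<in>(UNIV :: ('a::finite + 'b::finite) set). g i) = (\<Prod>a\<in>UNIV. g (Inl a)) * (\<Prod>b\<in>UNIV. g (Inr b))"
  using prod.Plus[of "UNIV::'a set" "UNIV::'b set" g] by simp

lemma join_vec_nth [simp]: "join_vec x y $ Inl a = x $ a" "join_vec x y $ Inr b = y $ b"
  by (simp_all add: join_vec_def)

lemma left_vec_nth [simp]: "left_vec z $ a = z $ Inl a" by (simp add: left_vec_def)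
lemma right_vec_nth [simp]: "right_vec z $ b = z $ Inr b" by (simp add: right_vec_def)

lemma left_vec_join [simp]: "left_vec (join_vec x y) = x" by (simp add: vec_eq_iff)
lemma right_vec_join [simp]: "right_vec (join_vec x y) = y" by (simp add: vec_eq_iff)
lemma join_vec_left_right [simp]: "join_vec (left_vec z) (right_vec z) = z"
  by (simp add: vec_eq_iff sum_type_all)

lemma join_vec_eq_iff [simp]: "join_vec x y = join_vec x' y' \<longleftrightarrow> x = x' \<and> y = y'"
  by (metis left_vec_join right_vec_join)

lemma linear_left_vec: "linear left_vec" by (auto intro!: linearI simp: vec_eq_iff)
lemma linear_right_vec: "linear right_vec" by (auto intro!: linearI simp: vec_eq_iff)
lemma linear_join_vec: "linear (\<lambda>p. join_vec (fst p) (snd p))"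
  by (auto intro!: linearI simp: vec_eq_iff sum_type_all)
lemma linear_join_left: "linear (\<lambda>x. join_vec x 0)"
  by (auto intro!: linearI simp: vec_eq_iff sum_type_all)
lemma linear_join_right: "linear (\<lambda>y. join_vec 0 y)"
  by (auto intro!: linearI simp: vec_eq_iff sum_type_all)

lemma join_vec_split: "join_vec x y = join_vec x 0 + join_vec 0 y"
  by (simp add: vec_eq_iff sum_type_all)

lemmas bounded_linear_left_vec = linear_left_vec[unfolded linear_conv_bounded_linear]
lemmas bounded_linear_right_vec = linear_right_vec[unfolded linear_conv_bounded_linear]
lemmas bounded_linear_join_left = linear_join_left[unfolded linear_conv_bounded_linear]
lemmas bounded_linear_join_right = linear_join_right[unfolded linear_conv_bounded_linear]

lemma left_right_add [simp]:
  "left_vec (x + y) = left_vec x + left_vec y" "right_vec (x + y) = right_vec x + right_vec y"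
  "left_vec (r *\<^sub>R x) = r *\<^sub>R left_vec x" "right_vec (r *\<^sub>R x) = r *\<^sub>R right_vec x"
  by (simp_all add: vec_eq_iff)

lemma left_right_axis [simp]:
  "left_vec (axis (Inl a) c) = axis a c" "left_vec (axis (Inr b) c) = 0"
  "right_vec (axis (Inl a) c) = 0" "right_vec (axis (Inr b) c) = axis b c"
  by (simp_all add: vec_eq_iff axis_def)

lemma vec_eq_0_iff_left_right: "z = 0 \<longleftrightarrow> left_vec z = 0 \<and> right_vec z = 0"
  by (simp add: vec_eq_iff sum_type_all)

lemma continuous_on_join_vec [continuous_intros]:
  "continuous_on S f \<Longrightarrow> continuous_on S g \<Longrightarrow> continuous_on S (\<lambda>x. join_vec (f x) (g x))"
  using linear_continuous_on[OF linear_join_vec[unfolded linear_conv_bounded_linear], of UNIV]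
  by (auto intro: continuous_on_compose2[where g="\<lambda>p. join_vec (fst p) (snd p)" and f="\<lambda>x. (f x, g x)" and t=UNIV, simplified] continuous_on_Pair)

lemma continuous_on_left_vec [continuous_intros]:
  "continuous_on S f \<Longrightarrow> continuous_on S (\<lambda>x. left_vec (f x))"
  by (rule bounded_linear.continuous_on[OF bounded_linear_left_vec])

lemma continuous_on_right_vec [continuous_intros]:
  "continuous_on S f \<Longrightarrow> continuous_on S (\<lambda>x. right_vec (f x))"
  by (rule bounded_linear.continuous_on[OF bounded_linear_right_vec])

lemma open_left_right:
  fixes S :: "(real^'a::finite) set" and T :: "(real^'b::finite) set"
  assumes "open S" "open T"
  shows "open {z. left_vec z \<in> S \<and> right_vec z \<in> T}"
proof -
  have "{z. left_vec z \<in> S \<and> right_vec z \<in> T} = (left_vec -` S :: (real^('a + 'b)) set) \<inter> right_vec -` T"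
    by auto
  moreover have "open (left_vec -` S :: (real^('a + 'b)) set)" "open (right_vec -` T :: (real^('a + 'b)) set)"
    using assms by (auto intro!: open_vimage continuous_intros)
  ultimately show ?thesis by (simp add: open_Int)
qed

section \<open>Lebesgue measure in split coordinates\<close>

lemma borel_measurable_left_vec [measurable]: "left_vec \<in> borel_measurable borel"
  by (intro borel_measurable_continuous_onI continuous_intros)
lemma borel_measurable_right_vec [measurable]: "right_vec \<in> borel_measurable borel"
  by (intro borel_measurable_continuous_onI continuous_intros)

lemma measurable_join_vec [measurable]:
  "(\<lambda>(x, y). join_vec x y) \<in> borel \<Otimes>\<^sub>M borel \<rightarrow>\<^sub>M borel"
  unfolding borel_prod split_beta by (intro borel_measurable_continuous_onI continuous_intros)

text \<open>\<open>lborel\<close> is characterised by its values on boxes. A box for the sum index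
  type is a product of one box for each summand, and its volume is the product of their volumes.
  Integrals in coordinates of a product manifold become iterated integrals through this.\<close>

lemma lborel_join_vec:
  "distr (lborel \<Otimes>\<^sub>M lborel) borel (\<lambda>(x, y). join_vec x y) =
    (lborel :: (real^('a::finite + 'b::finite)) measure)"
proof (rule lborel_eqI[symmetric])
  fix l u :: "real^('a + 'b)"
  assume "\<And>b. b \<in> Basis \<Longrightarrow> l \<bullet> b \<le> u \<bullet> b"
  then have le: "l $ i \<le> u $ i" for i
    by (metis axis_in_Basis_iff Basis_real_def cart_eq_inner_axis insertI1)
  \<comment> \<open>Passes from the standard basis to indices, where the product splits along
    \<open>Inl\<close> and \<open>Inr\<close>.\<close>
  have prod: "(\<Prod>b\<in>(Basis :: (real^'k::finite) set). (v - w) \<bullet> b) = (\<Prod>i\<in>UNIV. v $ i - w $ i)"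
    for v w :: "real^'k"
    unfolding Basis_vec_def
    by (subst prod.UNION_disjoint)
       (auto simp: axis_eq_axis cart_eq_inner_axis[symmetric])
  have box_eq: "(\<lambda>(x, y). join_vec x y) -` box l u =
      box (left_vec l) (left_vec u) \<times> box (right_vec l) (right_vec u)"
    by (auto simp: mem_box_cart sum_type_all)
  have 1: "emeasure lborel (box (left_vec l) (left_vec u)) = (\<Prod>i\<in>UNIV. u $ Inl i - l $ Inl i)"
    using le by (subst emeasure_lborel_box)
      (simp_all only: prod, auto simp: cart_eq_inner_axis[symmetric] Basis_vec_def)
  have 2: "emeasure lborel (box (right_vec l) (right_vec u)) = (\<Prod>i\<in>UNIV. u $ Inr i - l $ Inr i)"
    using le by (subst emeasure_lborel_box)
      (simp_all only: prod, auto simp: cart_eq_inner_axis[symmetric] Basis_vec_def)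
  have "emeasure (distr (lborel \<Otimes>\<^sub>M lborel) borel (\<lambda>(x, y). join_vec x y)) (box l u)
      = emeasure (lborel \<Otimes>\<^sub>M lborel) (box (left_vec l) (left_vec u) \<times> box (right_vec l) (right_vec u))"
    by (subst emeasure_distr) (auto simp: space_pair_measure box_eq[symmetric])
  also have "\<dots> = ennreal (\<Prod>i\<in>UNIV. u $ Inl i - l $ Inl i) * ennreal (\<Prod>i\<in>UNIV. u $ Inr i - l $ Inr i)"
    by (subst lborel.emeasure_pair_measure_Times) (auto simp: 1 2)
  also have "\<dots> = ennreal (\<Prod>b\<in>Basis. (u - l) \<bullet> b)"
    unfolding prod prod_UNIV_sum using le by (simp add: ennreal_mult prod_nonneg)
  finally show "emeasure (distr (lborel \<Otimes>\<^sub>M lborel) borel (\<lambda>(x, y). join_vec x y)) (box l u)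
      = ennreal (\<Prod>b\<in>Basis. (u - l) \<bullet> b)" .
qed simp

lemma nn_integral_lborel_join:
  fixes g :: "real^('a::finite + 'b::finite) \<Rightarrow> ennreal"
  assumes [measurable]: "g \<in> borel_measurable borel"
  shows "(\<integral>\<^sup>+z. g z \<partial>lborel) = (\<integral>\<^sup>+x. \<integral>\<^sup>+y. g (join_vec x y) \<partial>lborel \<partial>lborel)"
proof -
  have [measurable]: "(\<lambda>p. g (case p of (x, y) \<Rightarrow> join_vec x y)) \<in> borel_measurable (lborel \<Otimes>\<^sub>M lborel)"
    by measurable
  have "(\<integral>\<^sup>+z. g z \<partial>lborel) = (\<integral>\<^sup>+p. g (case p of (x, y) \<Rightarrow> join_vec x y) \<partial>(lborel \<Otimes>\<^sub>M lborel))"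
    by (subst lborel_join_vec[symmetric], subst nn_integral_distr) simp_all
  also have "\<dots> = (\<integral>\<^sup>+x. \<integral>\<^sup>+y. g (join_vec x y) \<partial>lborel \<partial>lborel)"
    by (subst lborel.nn_integral_fst[symmetric]) auto
  finally show ?thesis .
qed

section \<open>Block diagonal matrices\<close>

definition block_matrix :: "real^'a^'a \<Rightarrow> real^'b^'b \<Rightarrow> real^('a::finite + 'b::finite)^('a + 'b)" where
  "block_matrix A B = (\<chi> i. case i of Inl a \<Rightarrow> join_vec (A $ a) 0 | Inr b \<Rightarrow> join_vec 0 (B $ b))"

lemma block_matrix_nth [simp]:
  "block_matrix A B $ Inl a = join_vec (A $ a) 0" "block_matrix A B $ Inr b = join_vec 0 (B $ b)"
  by (simp_all add: block_matrix_def)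

lemma block_matrix_mult:
  "block_matrix A B ** block_matrix A' B' = block_matrix (A ** A') (B ** B')"
  by (simp add: vec_eq_iff sum_type_all matrix_matrix_mult_def sum_UNIV_sum)

lemma block_matrix_id [simp]: "block_matrix (mat 1) (mat 1) = mat 1"
  by (simp add: vec_eq_iff sum_type_all mat_def)

lemma block_matrix_vec:
  "block_matrix A B *v z = join_vec (A *v left_vec z) (B *v right_vec z)"
  by (simp add: vec_eq_iff sum_type_all matrix_vector_mult_def sum_UNIV_sum)

lemma inner_join: "u \<bullet> join_vec x y = left_vec u \<bullet> x + right_vec u \<bullet> y"
  by (simp add: inner_vec_def sum_UNIV_sum)

text \<open>The matrix is the identity with \<open>c\<close> times row \<open>l\<close> added to row
  \<open>k\<close>, an operation that preserves the determinant.\<close>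

lemma det_elementary_add:
  assumes "k \<noteq> l"
  shows "det (\<chi> i j. if i = k \<and> j = l then c else of_bool (i = j) :: real^'n^'n) = 1"
proof -
  have "(\<chi> i j. if i = k \<and> j = l then c else of_bool (i = j)) =
      (\<chi> i. if i = k then row k (mat 1) + c *s row l (mat 1) else row i (mat 1))"
    using assms by (auto simp: vec_eq_iff row_def mat_def)
  then show ?thesis using det_row_operation[OF assms, of "mat 1" c] by simp
qed

text \<open>Square matrices are generated under multiplication by matrices with a zero row, diagonal
  matrices, column swaps and shears. Appending an identity block respects products and keeps a
  matrix of each of these types in its type, with the same determinant.\<close>

lemma det_block_matrix_id_right: "det (block_matrix A (mat 1 :: real^'b::finite^'b)) = det A"
proof (induction A rule: induct_matrix_elementary)
  case (1 A B)
  have "block_matrix (A ** B) (mat 1 :: real^'b^'b) = block_matrix A (mat 1) ** block_matrix B (mat 1)"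
    by (simp add: block_matrix_mult)
  with 1 show ?case by (simp add: det_mul)
next
  case (2 A i)
  then have "row (Inl i) (block_matrix A (mat 1 :: real^'b^'b)) = 0"
    by (simp add: row_def vec_eq_iff sum_type_all)
  with 2 show ?case by (metis det_zero_row(1))
next
  case (3 A)
  then have "det (block_matrix A (mat 1 :: real^'b^'b)) = (\<Prod>i\<in>UNIV. block_matrix A (mat 1 :: real^'b^'b) $ i $ i)"
    by (intro det_diagonal) (simp add: block_matrix_def mat_def join_vec_def split: sum.split, auto)
  with 3 show ?case by (simp add: prod_UNIV_sum mat_def det_diagonal)
next
  case (4 m n)
  let ?T = "Transposition.transpose m n" and ?T' = "Transposition.transpose (Inl m) (Inl n :: 'a + 'b)"
  have "block_matrix (\<chi> i j. mat 1 $ i $ ?T j) (mat 1 :: real^'b^'b) = (\<chi> i j. mat 1 $ i $ ?T' j)"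
    by (auto simp: vec_eq_iff sum_type_all mat_def Transposition.transpose_def)
  with 4 show ?case
    by (simp add: det_permute_columns permutes_swap_id sign_swap_id)
next
  case (5 m n c)
  have "block_matrix (\<chi> i j. if i = m \<and> j = n then c else of_bool (i = j)) (mat 1 :: real^'b^'b) =
      (\<chi> i j. if i = Inl m \<and> j = Inl n then c else of_bool (i = j))"
    by (auto simp: vec_eq_iff sum_type_all mat_def)
  with 5 show ?case by (simp add: det_elementary_add)
qed

lemma det_block_matrix_id_left: "det (block_matrix (mat 1 :: real^'a::finite^'a) B) = det B"
proof (induction B rule: induct_matrix_elementary)
  case (1 A B)
  have "block_matrix (mat 1 :: real^'a^'a) (A ** B) = block_matrix (mat 1) A ** block_matrix (mat 1) B"
    by (simp add: block_matrix_mult)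
  with 1 show ?case by (simp add: det_mul)
next
  case (2 A i)
  then have "row (Inr i) (block_matrix (mat 1 :: real^'a^'a) A) = 0"
    by (simp add: row_def vec_eq_iff sum_type_all)
  with 2 show ?case by (metis det_zero_row(1))
next
  case (3 A)
  then have "det (block_matrix (mat 1 :: real^'a^'a) A) = (\<Prod>i\<in>UNIV. block_matrix (mat 1 :: real^'a^'a) A $ i $ i)"
    by (intro det_diagonal) (simp add: block_matrix_def mat_def join_vec_def split: sum.split, auto)
  with 3 show ?case by (simp add: prod_UNIV_sum mat_def det_diagonal)
next
  case (4 m n)
  let ?T = "Transposition.transpose m n" and ?T' = "Transposition.transpose (Inr m) (Inr n :: 'a + 'b)"
  have "block_matrix (mat 1 :: real^'a^'a) (\<chi> i j. mat 1 $ i $ ?T j) = (\<chi> i j. mat 1 $ i $ ?T' j)"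
    by (auto simp: vec_eq_iff sum_type_all mat_def Transposition.transpose_def)
  with 4 show ?case
    by (simp add: det_permute_columns permutes_swap_id sign_swap_id)
next
  case (5 m n c)
  have "block_matrix (mat 1 :: real^'a^'a) (\<chi> i j. if i = m \<and> j = n then c else of_bool (i = j)) =
      (\<chi> i j. if i = Inr m \<and> j = Inr n then c else of_bool (i = j))"
    by (auto simp: vec_eq_iff sum_type_all mat_def)
  with 5 show ?case by (simp add: det_elementary_add)
qed

lemma det_block_matrix: "det (block_matrix A B) = det A * det B"
proof -
  have "block_matrix A B = block_matrix A (mat 1) ** block_matrix (mat 1) B"
    by (simp add: block_matrix_mult)
  then show ?thesis by (simp add: det_mul det_block_matrix_id_left det_block_matrix_id_right)
qed

text \<open>\<open>matrix_inv\<close> is a choice among two-sided inverses. For a square matrix a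
  right inverse is two-sided, and two-sided inverses are unique.\<close>

lemma matrix_inv_eqI:
  fixes A :: "real^'n^'n"
  assumes "A ** B = mat 1"
  shows "matrix_inv A = B"
proof -
  have inv: "A ** matrix_inv A = mat 1 \<and> matrix_inv A ** A = mat 1"
    unfolding matrix_inv_def using assms matrix_left_right_inverse[of A B] by (intro someI) auto
  have "matrix_inv A = matrix_inv A ** (A ** B)" by (simp add: assms)
  also have "\<dots> = B" using inv by (simp add: matrix_mul_assoc)
  finally show ?thesis .
qed

lemma invertible_matrix_inv:
  fixes A :: "real^'n^'n"
  assumes "invertible A"
  shows "A ** matrix_inv A = mat 1"
  using assms unfolding invertible_def using matrix_inv_eqI by blast

lemma matrix_inv_block:
  assumes "invertible A" "invertible B"
  shows "matrix_inv (block_matrix A B) = block_matrix (matrix_inv A) (matrix_inv B)"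
  by (rule matrix_inv_eqI) (simp add: block_matrix_mult invertible_matrix_inv assms)

text \<open>A nonzero vector in the kernel of \<open>A\<close> would give the quadratic form the
  value 0.\<close>

lemma pos_def_invertible:
  fixes A :: "real^'n^'n"
  assumes "\<And>u. u \<noteq> 0 \<Longrightarrow> u \<bullet> (A *v u) > 0"
  shows "invertible A"
  unfolding invertible_left_inverse matrix_left_invertible_ker
  using assms by (metis inner_zero_right less_irrefl)

text \<open>Along the segment from the identity to \<open>A\<close> all matrices are positive definite, so the
  determinant cannot change sign.\<close>

lemma pos_def_det_pos:
  fixes A :: "real^'n^'n"
  assumes pos: "\<And>u. u \<noteq> 0 \<Longrightarrow> u \<bullet> (A *v u) > 0"
  shows "det A > 0"
proof (rule ccontr)
  assume "\<not> det A > 0"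
  define d where "d t = det (t *\<^sub>R A + (1 - t) *\<^sub>R mat 1)" for t :: real
  have nz: "d t \<noteq> 0" if "0 \<le> t" "t \<le> 1" for t
  proof -
    have "u \<bullet> ((t *\<^sub>R A + (1 - t) *\<^sub>R mat 1) *v u) > 0" if "u \<noteq> 0" for u
    proof -
      have "u \<bullet> ((t *\<^sub>R A + (1 - t) *\<^sub>R mat 1) *v u) = t * (u \<bullet> (A *v u)) + (1 - t) * (u \<bullet> u)"
        by (simp add: matrix_vector_mult_add_rdistrib scaleR_matrix_vector_assoc[symmetric] inner_add_right)
      moreover have "t * (u \<bullet> (A *v u)) > 0 \<or> (1 - t) * (u \<bullet> u) > 0"
        using pos[OF that] \<open>0 \<le> t\<close> \<open>t \<le> 1\<close> that by (cases "t = 0") auto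
      moreover have "t * (u \<bullet> (A *v u)) \<ge> 0" "(1 - t) * (u \<bullet> u) \<ge> 0"
        using pos[OF that] \<open>0 \<le> t\<close> \<open>t \<le> 1\<close> by simp_all
      ultimately show ?thesis by linarith
    qed
    then show ?thesis
      unfolding d_def using pos_def_invertible invertible_det_nz by blast
  qed
  have "continuous_on {0..1} d"
    unfolding d_def det_def by (intro continuous_intros continuous_on_sum continuous_on_prod)
  moreover have "d 1 \<le> 0" "0 \<le> d 0" using \<open>\<not> det A > 0\<close> by (simp_all add: d_def)
  ultimately obtain t where "0 \<le> t" "t \<le> 1" "d t = 0"
    using IVT2'[of d 1 0 0] by auto
  with nz show False by blast
qed

section \<open>Product manifolds\<close>

abbreviation overlap :: "('c, 'm, 'n::finite) atlas \<Rightarrow> 'c \<Rightarrow> 'c \<Rightarrow> (real^'n) set" where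
  "overlap A c d \<equiv> coord A c ` (cdom A c \<inter> cdom A d)"

abbreviation transition :: "('c, 'm, 'n::finite) atlas \<Rightarrow> 'c \<Rightarrow> 'c \<Rightarrow> real^'n \<Rightarrow> real^'n" where
  "transition A c d \<equiv> coord A d \<circ> cinv A c"

locale manifold =
  fixes A :: "('c, 'm::{second_countable_topology, t2_space}, 'n::finite) atlas"
  assumes manifold: "smooth_manifold A"
begin

lemma open_cdom: "open (cdom A c)" and open_cimage: "open (cimage A c)"
  and homeomorphism_chart: "homeomorphism (cdom A c) (cimage A c) (coord A c) (cinv A c)"
  using manifold unfolding smooth_manifold_def by blast+

lemma cinv_coord: "p \<in> cdom A c \<Longrightarrow> cinv A c (coord A c p) = p"
  using homeomorphism_apply1[OF homeomorphism_chart] .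

lemma coord_cinv: "x \<in> cimage A c \<Longrightarrow> coord A c (cinv A c x) = x"
  using homeomorphism_apply2[OF homeomorphism_chart] .

lemma cinv_in_cdom: "x \<in> cimage A c \<Longrightarrow> cinv A c x \<in> cdom A c"
  using homeomorphism_image2[OF homeomorphism_chart] by blast

lemma coord_in_cimage: "p \<in> cdom A c \<Longrightarrow> coord A c p \<in> cimage A c"
  by (simp add: cimage_def)

lemma inj_on_coord: "inj_on (coord A c) (cdom A c)"
  by (metis cinv_coord inj_onI)

lemma chart_exists: obtains c where "p \<in> cdom A c"
  using manifold unfolding smooth_manifold_def by blast

text \<open>Openness of the overlap is read off from this form, a preimage under the continuous map
  \<open>cinv A c\<close>.\<close>

lemma overlap_eq: "overlap A c d = cimage A c \<inter> cinv A c -` cdom A d"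
proof (intro equalityI subsetI)
  fix x assume "x \<in> cimage A c \<inter> cinv A c -` cdom A d"
  then show "x \<in> overlap A c d"
    by (intro image_eqI[of _ _ "cinv A c x"]) (auto simp: coord_cinv cinv_in_cdom)
qed (auto simp: coord_in_cimage cinv_coord)

lemma open_overlap: "open (overlap A c d)"
proof -
  have "continuous_on (cimage A c) (cinv A c)"
    using homeomorphism_chart homeomorphism_cont2 by blast
  then show ?thesis
    unfolding overlap_eq
    by (rule continuous_open_preimage[OF _ open_cimage open_cdom])
qed

lemma transition_smooth: "smooth_on (overlap A c d) (transition A c d)"
  using manifold unfolding smooth_manifold_def by blast

lemma transition_has_derivative:
  assumes "p \<in> cdom A c" "p \<in> cdom A d"
  shows "(transition A c d has_derivative frechet_derivative (transition A c d) (at (coord A c p)))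
    (at (coord A c p))"
  using smooth_on_differentiable[OF transition_smooth] assms
  by (auto simp: frechet_derivative_works[symmetric])

text \<open>Chain rule. The composite of the two transition maps agrees with the third on the
  overlap of the charts \<open>c\<close> and \<open>d\<close>, an open neighbourhood of the point,
  and the derivative sees only such a neighbourhood.\<close>

lemma frechet_transition_cocycle:
  assumes p: "p \<in> cdom A c" "p \<in> cdom A d" "p \<in> cdom A e"
  shows "frechet_derivative (transition A d e) (at (coord A d p))
      (frechet_derivative (transition A c d) (at (coord A c p)) y) =
    frechet_derivative (transition A c e) (at (coord A c p)) y"
proof -
  have "((\<lambda>x. transition A d e (transition A c d x)) has_derivative
     (\<lambda>y. frechet_derivative (transition A d e) (at (coord A d p))
        (frechet_derivative (transition A c d) (at (coord A c p)) y))) (at (coord A c p))"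
    using p by (intro has_derivative_compose[OF transition_has_derivative])
      (auto simp: cinv_coord transition_has_derivative[unfolded comp_def] comp_def)
  then have "(transition A c e has_derivative
     (\<lambda>y. frechet_derivative (transition A d e) (at (coord A d p))
        (frechet_derivative (transition A c d) (at (coord A c p)) y))) (at (coord A c p))"
    by (rule has_derivative_transform_within_open[OF _ open_overlap[of c d]])
       (use p in \<open>auto simp: cinv_coord\<close>)
  then show ?thesis by (simp add: frechet_derivative_eqI)
qed

lemma frechet_transition_self:
  assumes p: "p \<in> cdom A c"
  shows "frechet_derivative (transition A c c) (at (coord A c p)) y = y"
proof -
  have "(transition A c c has_derivative (\<lambda>y. y)) (at (coord A c p))"
    by (rule has_derivative_transform_within_open[OF has_derivative_ident open_overlap[of c c]])
       (use p in \<open>auto simp: cinv_coord\<close>)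
  then show ?thesis by (simp add: frechet_derivative_eqI)
qed

text \<open>The transformation law demanded of a tangent vector is the cocycle identity for the
  derivatives of the transition maps.\<close>

lemma tangent_vector_in_tangent_space:
  "p \<in> cdom A c \<Longrightarrow> tangent_vector A c p y \<in> tangent_space A p"
  by (auto simp: tangent_space_def tangent_vector_def frechet_transition_cocycle)

lemma tangent_vector_self: "p \<in> cdom A c \<Longrightarrow> tangent_vector A c p y c = y"
  by (simp add: tangent_vector_def frechet_transition_self)

text \<open>Any chart around \<open>p\<close> thus identifies the tangent space with the coordinate
  space, so that a property of all tangent vectors can be checked on vectors of the form
  \<open>tangent_vector A c p y\<close>.\<close>

lemma tangent_space_eq_tangent_vector:
  assumes "v \<in> tangent_space A p" "p \<in> cdom A c"
  shows "v = tangent_vector A c p (v c)"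
proof
  fix d
  have "v d = frechet_derivative (transition A c d) (at (coord A c p)) (v c)" if "p \<in> cdom A d"
    using assms that unfolding tangent_space_def by blast
  moreover have "v d = 0" if "p \<notin> cdom A d"
    using assms that unfolding tangent_space_def by blast
  ultimately show "v d = tangent_vector A c p (v c) d"
    unfolding tangent_vector_def by presburger
qed

lemma tangent_vector_scaleR:
  assumes "p \<in> cdom A c"
  shows "tangent_vector A c p (r *\<^sub>R y) = (\<lambda>d. r *\<^sub>R tangent_vector A c p y d)"
  using linear_cmul[OF has_derivative_linear[OF transition_has_derivative[OF assms]]]
  by (intro ext) (simp add: tangent_vector_def)

lemma tangent_vector_eq_0_iff:
  assumes "p \<in> cdom A c"
  shows "tangent_vector A c p y = (\<lambda>_. 0) \<longleftrightarrow> y = 0"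
proof
  assume "y = 0"
  then show "tangent_vector A c p y = (\<lambda>_. 0)"
    using tangent_vector_scaleR[OF assms, of 0 y] by simp
qed (metis assms tangent_vector_self)

lemma local_set_slit: "local_set A (slit_tangent_bundle A) c = cimage A c \<times> (- {0})"
  by (auto simp: local_set_def slit_tangent_bundle_def tangent_vector_in_tangent_space
      tangent_vector_eq_0_iff cinv_in_cdom)

end

section \<open>Charts and tangent vectors of the product\<close>

lemma cdom_product [simp]: "cdom (product_atlas A1 A2) (c1, c2) = cdom A1 c1 \<times> cdom A2 c2"
  by (simp add: cdom_def product_atlas_def)

lemma coord_product [simp]:
  "coord (product_atlas A1 A2) (c1, c2) (p1, p2) = join_vec (coord A1 c1 p1) (coord A2 c2 p2)"
  by (simp add: coord_def product_atlas_def)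

locale manifold_pair = M1: manifold A1 + M2: manifold A2
  for A1 :: "('c1, 'm1::{second_countable_topology, t2_space}, 'n1::finite) atlas"
  and A2 :: "('c2, 'm2::{second_countable_topology, t2_space}, 'n2::finite) atlas"
begin

abbreviation "P \<equiv> product_atlas A1 A2"

lemma cimage_product:
  "z \<in> cimage P (c1, c2) \<longleftrightarrow> left_vec z \<in> cimage A1 c1 \<and> right_vec z \<in> cimage A2 c2"
proof
  assume "left_vec z \<in> cimage A1 c1 \<and> right_vec z \<in> cimage A2 c2"
  then show "z \<in> cimage P (c1, c2)"
    unfolding cimage_def
    by (intro image_eqI[of _ _ "(cinv A1 c1 (left_vec z), cinv A2 c2 (right_vec z))"])
       (auto simp: M1.coord_cinv M2.coord_cinv M1.cinv_in_cdom M2.cinv_in_cdom cimage_def[symmetric])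
qed (auto simp: cimage_def)

lemma cinv_product:
  assumes "z \<in> cimage P (c1, c2)"
  shows "cinv P (c1, c2) z = (cinv A1 c1 (left_vec z), cinv A2 c2 (right_vec z))"
proof -
  have "inj_on (coord P (c1, c2)) (cdom P (c1, c2))"
    using M1.inj_on_coord[of c1] M2.inj_on_coord[of c2] by (auto simp: inj_on_def)
  moreover have "coord P (c1, c2) (cinv A1 c1 (left_vec z), cinv A2 c2 (right_vec z)) = z"
    using assms by (simp add: cimage_product M1.coord_cinv M2.coord_cinv)
  moreover have "(cinv A1 c1 (left_vec z), cinv A2 c2 (right_vec z)) \<in> cdom P (c1, c2)"
    using assms by (simp add: cimage_product M1.cinv_in_cdom M2.cinv_in_cdom)
  ultimately show ?thesis unfolding cinv_def by (metis inv_into_f_f)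
qed

lemma overlap_product:
  "z \<in> overlap P (c1, c2) (d1, d2) \<longleftrightarrow> left_vec z \<in> overlap A1 c1 d1 \<and> right_vec z \<in> overlap A2 c2 d2"
proof
  assume "left_vec z \<in> overlap A1 c1 d1 \<and> right_vec z \<in> overlap A2 c2 d2"
  then obtain p1 p2 where "p1 \<in> cdom A1 c1 \<inter> cdom A1 d1" "left_vec z = coord A1 c1 p1"
    "p2 \<in> cdom A2 c2 \<inter> cdom A2 d2" "right_vec z = coord A2 c2 p2" by blast
  then show "z \<in> overlap P (c1, c2) (d1, d2)"
    by (intro image_eqI[of _ _ "(p1, p2)"]) (auto, metis join_vec_left_right)
qed auto

lemma transition_product:
  assumes "z \<in> cimage P (c1, c2)"
  shows "transition P (c1, c2) (d1, d2) z =
    join_vec (transition A1 c1 d1 (left_vec z)) (transition A2 c2 d2 (right_vec z))"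
  using assms by (simp add: cinv_product)

lemma overlap_subset_cimage: "overlap P c d \<subseteq> cimage P c"
  by (auto simp: cimage_def)

lemma open_cimage_product: "open (cimage P c)"
proof (cases c)
  case (Pair c1 c2)
  then have "cimage P c = {z. left_vec z \<in> cimage A1 c1 \<and> right_vec z \<in> cimage A2 c2}"
    using cimage_product by auto
  then show ?thesis using open_left_right[OF M1.open_cimage M2.open_cimage] by simp
qed

lemma open_overlap_product: "open (overlap P c d)"
proof (cases c; cases d)
  fix c1 c2 d1 d2 assume "c = (c1, c2)" "d = (d1, d2)"
  then have "overlap P c d = {z. left_vec z \<in> overlap A1 c1 d1 \<and> right_vec z \<in> overlap A2 c2 d2}"
    using overlap_product by auto
  then show ?thesis using open_left_right[OF M1.open_overlap M2.open_overlap] by simp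
qed

lemma homeomorphism_product:
  "homeomorphism (cdom P c) (cimage P c) (coord P c) (cinv P c)"
proof (cases c)
  case (Pair c1 c2)
  have c1: "continuous_on (cdom A1 c1) (coord A1 c1)" "continuous_on (cimage A1 c1) (cinv A1 c1)"
    using M1.homeomorphism_chart by (auto simp: homeomorphism_def)
  have c2: "continuous_on (cdom A2 c2) (coord A2 c2)" "continuous_on (cimage A2 c2) (cinv A2 c2)"
    using M2.homeomorphism_chart by (auto simp: homeomorphism_def)
  show ?thesis
  proof (rule homeomorphismI)
    have "continuous_on (cdom A1 c1 \<times> cdom A2 c2) (\<lambda>p. join_vec (coord A1 c1 (fst p)) (coord A2 c2 (snd p)))"
      by (intro continuous_intros continuous_on_compose2[OF c1(1)] continuous_on_compose2[OF c2(1)]) auto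
    then show "continuous_on (cdom P c) (coord P c)"
      by (rule continuous_on_cong[THEN iffD1, rotated 2]) (auto simp: Pair)
    have "continuous_on (cimage P c) (\<lambda>z. (cinv A1 c1 (left_vec z), cinv A2 c2 (right_vec z)))"
      unfolding Pair by (intro continuous_intros continuous_on_compose2[OF c1(2)] continuous_on_compose2[OF c2(2)])
        (auto simp: cimage_product)
    then show "continuous_on (cimage P c) (cinv P c)"
      by (rule continuous_on_eq) (simp add: Pair cinv_product)
    show "coord P c ` cdom P c \<subseteq> cimage P c" by (simp add: cimage_def)
    show "cinv P c ` cimage P c \<subseteq> cdom P c"
      by (auto simp: Pair cinv_product) (auto simp: cimage_product M1.cinv_in_cdom M2.cinv_in_cdom)
    show "cinv P c (coord P c p) = p" if "p \<in> cdom P c" for p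
      using that unfolding Pair by (subst cinv_product)
        (auto simp: cimage_product M1.coord_in_cimage M2.coord_in_cimage M1.cinv_coord M2.cinv_coord)
    show "coord P c (cinv P c z) = z" if "z \<in> cimage P c" for z
      using that unfolding Pair by (subst cinv_product)
        (auto simp: cimage_product M1.coord_cinv M2.coord_cinv)
  qed
qed

lemma transition_product_smooth: "smooth_on (overlap P c d) (transition P c d)"
proof (cases c; cases d)
  fix c1 c2 d1 d2 assume cd: "c = (c1, c2)" "d = (d1, d2)"
  let ?T = "overlap P (c1, c2) (d1, d2)"
  have op: "open ?T" by (rule open_overlap_product)
  have 1: "smooth_on ?T (\<lambda>z. transition A1 c1 d1 (left_vec z))"
    by (rule smooth_on_linear_right[OF bounded_linear_left_vec op _ M1.transition_smooth[of c1 d1]])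
      (use overlap_product in blast)
  have 2: "smooth_on ?T (\<lambda>z. transition A2 c2 d2 (right_vec z))"
    by (rule smooth_on_linear_right[OF bounded_linear_right_vec op _ M2.transition_smooth[of c2 d2]])
      (use overlap_product in blast)
  \<comment> \<open>\<open>join_vec\<close> is a sum of two linear embeddings, so smoothness of sums
    and of linear images settles the claim.\<close>
  have "smooth_on ?T (\<lambda>z. join_vec (transition A1 c1 d1 (left_vec z)) 0 + join_vec 0 (transition A2 c2 d2 (right_vec z)))"
    by (intro smooth_on_add[OF op] smooth_on_linear_left[OF bounded_linear_join_left op 1]
        smooth_on_linear_left[OF bounded_linear_join_right op 2])
  then have "smooth_on ?T (transition P (c1, c2) (d1, d2))"
  proof (rule smooth_on_cong[OF op, THEN iffD1, rotated])
    fix z assume "z \<in> ?T"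
    then have "z \<in> cimage P (c1, c2)" using overlap_subset_cimage by blast
    then show "join_vec (transition A1 c1 d1 (left_vec z)) 0 + join_vec 0 (transition A2 c2 d2 (right_vec z)) =
        transition P (c1, c2) (d1, d2) z"
      by (simp only: transition_product join_vec_split[symmetric])
  qed
  then show ?thesis using cd by simp
qed

sublocale MP: manifold P
proof
  have "open (cdom P c)" for c
    using M1.open_cdom M2.open_cdom by (cases c) (auto intro: open_Times)
  moreover have "p \<in> (\<Union>c. cdom P c)" for p
    using M1.chart_exists[of "fst p"] M2.chart_exists[of "snd p"]
    by (metis UNIV_I UN_I cdom_product mem_Times_iff)
  ultimately show "smooth_manifold P"
    unfolding smooth_manifold_def
    using open_cimage_product homeomorphism_product transition_product_smooth by blast
qed

lemma frechet_transition_product: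
  assumes "p1 \<in> cdom A1 c1" "p2 \<in> cdom A2 c2" "p1 \<in> cdom A1 d1" "p2 \<in> cdom A2 d2"
  shows "frechet_derivative (transition P (c1, c2) (d1, d2)) (at (coord P (c1, c2) (p1, p2))) y =
    join_vec (frechet_derivative (transition A1 c1 d1) (at (coord A1 c1 p1)) (left_vec y))
             (frechet_derivative (transition A2 c2 d2) (at (coord A2 c2 p2)) (right_vec y))"
proof -
  let ?x = "coord P (c1, c2) (p1, p2)"
  have 1: "((\<lambda>z. transition A1 c1 d1 (left_vec z)) has_derivative
      (\<lambda>y. frechet_derivative (transition A1 c1 d1) (at (coord A1 c1 p1)) (left_vec y))) (at ?x)"
    using M1.transition_has_derivative[of p1 c1 d1] assms
    by (intro has_derivative_compose[OF bounded_linear_imp_has_derivative[OF bounded_linear_left_vec]]) (auto simp: comp_def)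
  have 2: "((\<lambda>z. transition A2 c2 d2 (right_vec z)) has_derivative
      (\<lambda>y. frechet_derivative (transition A2 c2 d2) (at (coord A2 c2 p2)) (right_vec y))) (at ?x)"
    using M2.transition_has_derivative[of p2 c2 d2] assms
    by (intro has_derivative_compose[OF bounded_linear_imp_has_derivative[OF bounded_linear_right_vec]]) (auto simp: comp_def)
  have "((\<lambda>z. join_vec (transition A1 c1 d1 (left_vec z)) 0 + join_vec 0 (transition A2 c2 d2 (right_vec z))) has_derivative
     (\<lambda>y. join_vec (frechet_derivative (transition A1 c1 d1) (at (coord A1 c1 p1)) (left_vec y)) 0 +
          join_vec 0 (frechet_derivative (transition A2 c2 d2) (at (coord A2 c2 p2)) (right_vec y)))) (at ?x)"
    by (intro has_derivative_add bounded_linear.has_derivative[OF bounded_linear_join_left 1]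
        bounded_linear.has_derivative[OF bounded_linear_join_right 2])
  then have "(transition P (c1, c2) (d1, d2) has_derivative
     (\<lambda>y. join_vec (frechet_derivative (transition A1 c1 d1) (at (coord A1 c1 p1)) (left_vec y))
             (frechet_derivative (transition A2 c2 d2) (at (coord A2 c2 p2)) (right_vec y)))) (at ?x)"
    unfolding join_vec_split[symmetric]
  proof (rule has_derivative_transform_within_open[OF _ MP.open_cimage[of "(c1, c2)"]])
    show "?x \<in> cimage P (c1, c2)" using assms by (simp add: cimage_product M1.coord_in_cimage M2.coord_in_cimage)
  qed (simp only: transition_product)
  then show ?thesis by (simp add: frechet_derivative_eqI)
qed

text \<open>\<open>tangent_map\<close> computes the differential in some chosen product chart, here
  \<open>(a1, a2)\<close>, whereas the vector is given in \<open>(c1, c2)\<close>. The cocycle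
  identity makes the result independent of the choice.\<close>

lemma tangent_map_fst:
  assumes p: "p1 \<in> cdom A1 c1" "p2 \<in> cdom A2 c2"
  shows "tangent_map P A1 fst (p1, p2) (tangent_vector P (c1, c2) (p1, p2) y) =
    tangent_vector A1 c1 p1 (left_vec y)"
proof
  fix d
  obtain a1 a2 where a: "(SOME c. (p1, p2) \<in> cdom P c) = (a1, a2)" by fastforce
  have ap: "(p1, p2) \<in> cdom P (a1, a2)"
    using someI_ex[of "\<lambda>c. (p1, p2) \<in> cdom P c"] p a by (metis cdom_product mem_Sigma_iff)
  then have ap1: "p1 \<in> cdom A1 a1" and ap2: "p2 \<in> cdom A2 a2" by simp_all
  show "tangent_map P A1 fst (p1, p2) (tangent_vector P (c1, c2) (p1, p2) y) d =
    tangent_vector A1 c1 p1 (left_vec y) d"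
  proof (cases "p1 \<in> cdom A1 d")
    case True
    let ?x = "coord P (a1, a2) (p1, p2)"
    have "((\<lambda>z. transition A1 a1 d (left_vec z)) has_derivative
      (\<lambda>y. frechet_derivative (transition A1 a1 d) (at (coord A1 a1 p1)) (left_vec y))) (at ?x)"
      using M1.transition_has_derivative[of p1 a1 d] ap True
      by (intro has_derivative_compose[OF bounded_linear_imp_has_derivative[OF bounded_linear_left_vec]]) (auto simp: comp_def)
    then have "((coord A1 d \<circ> fst \<circ> cinv P (a1, a2)) has_derivative
      (\<lambda>y. frechet_derivative (transition A1 a1 d) (at (coord A1 a1 p1)) (left_vec y))) (at ?x)"
      by (rule has_derivative_transform_within_open[OF _ MP.open_cimage[of "(a1, a2)"]])
        (use ap in \<open>auto simp: cinv_product cimage_product M1.coord_in_cimage M2.coord_in_cimage\<close>)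
    then show ?thesis
      using p ap1 ap2 True M1.frechet_transition_cocycle[of p1 c1 a1 d]
      by (simp add: tangent_map_def tangent_vector_def Let_def a frechet_derivative_eqI
          frechet_transition_product[unfolded coord_product])
  qed (simp add: tangent_map_def tangent_vector_def Let_def)
qed

lemma tangent_map_snd:
  assumes p: "p1 \<in> cdom A1 c1" "p2 \<in> cdom A2 c2"
  shows "tangent_map P A2 snd (p1, p2) (tangent_vector P (c1, c2) (p1, p2) y) =
    tangent_vector A2 c2 p2 (right_vec y)"
proof
  fix d
  obtain a1 a2 where a: "(SOME c. (p1, p2) \<in> cdom P c) = (a1, a2)" by fastforce
  have ap: "(p1, p2) \<in> cdom P (a1, a2)"
    using someI_ex[of "\<lambda>c. (p1, p2) \<in> cdom P c"] p a by (metis cdom_product mem_Sigma_iff)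
  then have ap1: "p1 \<in> cdom A1 a1" and ap2: "p2 \<in> cdom A2 a2" by simp_all
  show "tangent_map P A2 snd (p1, p2) (tangent_vector P (c1, c2) (p1, p2) y) d =
    tangent_vector A2 c2 p2 (right_vec y) d"
  proof (cases "p2 \<in> cdom A2 d")
    case True
    let ?x = "coord P (a1, a2) (p1, p2)"
    have "((\<lambda>z. transition A2 a2 d (right_vec z)) has_derivative
      (\<lambda>y. frechet_derivative (transition A2 a2 d) (at (coord A2 a2 p2)) (right_vec y))) (at ?x)"
      using M2.transition_has_derivative[of p2 a2 d] ap True
      by (intro has_derivative_compose[OF bounded_linear_imp_has_derivative[OF bounded_linear_right_vec]]) (auto simp: comp_def)
    then have "((coord A2 d \<circ> snd \<circ> cinv P (a1, a2)) has_derivative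
      (\<lambda>y. frechet_derivative (transition A2 a2 d) (at (coord A2 a2 p2)) (right_vec y))) (at ?x)"
      by (rule has_derivative_transform_within_open[OF _ MP.open_cimage[of "(a1, a2)"]])
        (use ap in \<open>auto simp: cinv_product cimage_product M1.coord_in_cimage M2.coord_in_cimage\<close>)
    then show ?thesis
      using p ap1 ap2 True M2.frechet_transition_cocycle[of p2 c2 a2 d]
      by (simp add: tangent_map_def tangent_vector_def Let_def a frechet_derivative_eqI
          frechet_transition_product[unfolded coord_product])
  qed (simp add: tangent_map_def tangent_vector_def Let_def)
qed

text \<open>Conditions imposed over the product slit bundle are tested on this explicit subset of
  the coordinate space.\<close>

lemma local_set_product_slit:
  "local_set P (product_slit_bundle A1 A2) (c1, c2) =
    {(x, y). x \<in> cimage P (c1, c2) \<and> left_vec y \<noteq> 0 \<and> right_vec y \<noteq> 0}"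
proof -
  have "(cinv P (c1, c2) x, tangent_vector P (c1, c2) (cinv P (c1, c2) x) y) \<in> product_slit_bundle A1 A2
      \<longleftrightarrow> left_vec y \<noteq> 0 \<and> right_vec y \<noteq> 0" if x: "x \<in> cimage P (c1, c2)" for x y
  proof -
    have "cinv A1 c1 (left_vec x) \<in> cdom A1 c1" "cinv A2 c2 (right_vec x) \<in> cdom A2 c2"
      using x by (simp_all add: cimage_product M1.cinv_in_cdom M2.cinv_in_cdom)
    then show ?thesis
      using MP.tangent_vector_in_tangent_space[of "cinv P (c1, c2) x" "(c1, c2)" y] x
      by (simp add: product_slit_bundle_def slit_tangent_bundle_def cinv_product tangent_map_fst
        tangent_map_snd M1.tangent_vector_in_tangent_space M2.tangent_vector_in_tangent_space
        M1.tangent_vector_eq_0_iff M2.tangent_vector_eq_0_iff)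
  qed
  then show ?thesis by (auto simp: local_set_def)
qed

section \<open>The warped metric in product coordinates\<close>

lemma local_rep_warped:
  assumes "x \<in> cimage P (c1, c2)"
  shows "local_rep P (warped_metric A1 F1 A2 F2 f) (c1, c2) x y =
    sqrt ((local_rep A1 F1 c1 (left_vec x) (left_vec y))\<^sup>2 +
      (f (cinv A1 c1 (left_vec x)))\<^sup>2 * (local_rep A2 F2 c2 (right_vec x) (right_vec y))\<^sup>2)"
  using assms
  by (simp add: local_rep_def warped_metric_def cinv_product cimage_product tangent_map_fst
      tangent_map_snd M1.cinv_in_cdom M2.cinv_in_cdom)

text \<open>The components in one product chart reduce the claim to homogeneity of the two factors;
  \<open>r\<close> leaves the square root because it is positive.\<close>

lemma warped_homogeneous:
  assumes h1: "\<And>p v r. v \<in> tangent_space A1 p \<Longrightarrow> r > 0 \<Longrightarrow> F1 p (\<lambda>c. r *\<^sub>R v c) = r * F1 p v"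
    and h2: "\<And>p v r. v \<in> tangent_space A2 p \<Longrightarrow> r > 0 \<Longrightarrow> F2 p (\<lambda>c. r *\<^sub>R v c) = r * F2 p v"
    and v: "v \<in> tangent_space P p" and r: "r > 0"
  shows "warped_metric A1 F1 A2 F2 f p (\<lambda>c. r *\<^sub>R v c) = r * warped_metric A1 F1 A2 F2 f p v"
proof -
  obtain p1 p2 where p: "p = (p1, p2)" by fastforce
  obtain c1 c2 where c: "p1 \<in> cdom A1 c1" "p2 \<in> cdom A2 c2"
    by (metis M1.chart_exists M2.chart_exists)
  let ?y = "v (c1, c2)"
  have pc: "p \<in> cdom P (c1, c2)" using c p by simp
  have veq: "v = tangent_vector P (c1, c2) p ?y"
    by (rule MP.tangent_space_eq_tangent_vector[OF v pc])
  have rv: "(\<lambda>c. r *\<^sub>R v c) = tangent_vector P (c1, c2) p (r *\<^sub>R ?y)"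
    using veq MP.tangent_vector_scaleR[OF pc, of r ?y] by metis
  have 1: "F1 p1 (tangent_vector A1 c1 p1 (r *\<^sub>R left_vec ?y)) = r * F1 p1 (tangent_vector A1 c1 p1 (left_vec ?y))"
    using h1[OF M1.tangent_vector_in_tangent_space[OF c(1)] r]
    by (simp add: M1.tangent_vector_scaleR[OF c(1)])
  have 2: "F2 p2 (tangent_vector A2 c2 p2 (r *\<^sub>R right_vec ?y)) = r * F2 p2 (tangent_vector A2 c2 p2 (right_vec ?y))"
    using h2[OF M2.tangent_vector_in_tangent_space[OF c(2)] r]
    by (simp add: M2.tangent_vector_scaleR[OF c(2)])
  have "warped_metric A1 F1 A2 F2 f p (\<lambda>c. r *\<^sub>R v c) =
      sqrt (r\<^sup>2 * ((F1 p1 (tangent_vector A1 c1 p1 (left_vec ?y)))\<^sup>2 +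
        (f p1)\<^sup>2 * (F2 p2 (tangent_vector A2 c2 p2 (right_vec ?y)))\<^sup>2))"
    unfolding rv
    by (simp add: warped_metric_def p tangent_map_fst[OF c] tangent_map_snd[OF c] 1 2 power_mult_distrib algebra_simps)
  also have "\<dots> = r * warped_metric A1 F1 A2 F2 f p (tangent_vector P (c1, c2) p ?y)"
    using r by (simp add: warped_metric_def p tangent_map_fst[OF c] tangent_map_snd[OF c] real_sqrt_mult)
  finally show ?thesis using veq by simp
qed

end

section \<open>Finsler metrics in a coordinate patch\<close>

text \<open>Only the values on a short segment through \<open>z\<close> enter \<open>deriv\<close>.
  This allows functions that agree on an open set to be exchanged inside nested partial
  derivatives.\<close>

lemma partial_cong_open:
  assumes "open S" "z \<in> S" "\<And>w. w \<in> S \<Longrightarrow> h w = g w"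
  shows "partial i h z = partial i g z"
proof -
  have "open ((\<lambda>t. z + t *\<^sub>R axis i 1) -` S)"
    by (intro open_vimage \<open>open S\<close> continuous_intros)
  then have "\<forall>\<^sub>F t in nhds 0. h (z + t *\<^sub>R axis i 1) = g (z + t *\<^sub>R axis i 1)"
    unfolding eventually_nhds using assms by (intro exI[of _ "(\<lambda>t. z + t *\<^sub>R axis i 1) -` S"]) auto
  then show ?thesis unfolding partial_def by (intro deriv_cong_ev) auto
qed

lemma has_derivative_line:
  assumes "(h has_derivative D) (at (z + s *\<^sub>R v))"
  shows "((\<lambda>t. h (z + t *\<^sub>R v)) has_real_derivative D v) (at s)"
proof -
  have "((\<lambda>t. z + t *\<^sub>R v) has_derivative (\<lambda>t. t *\<^sub>R v)) (at s)"
    by (auto intro!: derivative_eq_intros)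
  from has_derivative_compose[OF this assms]
  show ?thesis
    by (simp add: has_field_derivative_def linear_cmul[OF has_derivative_linear[OF assms]] mult_commute_abs)
qed

lemma partial_eqI: "(h has_derivative D) (at z) \<Longrightarrow> partial i h z = D (axis i 1)"
  using has_derivative_line[of h D z 0 "axis i 1"] by (simp add: partial_def DERIV_imp_deriv)

lemma partial_const [simp]: "partial i (\<lambda>_. c) z = 0"
  by (simp add: partial_def)

lemma partial_cmult: "h differentiable (at z) \<Longrightarrow> partial i (\<lambda>w. c * h w) z = c * partial i h z"
  unfolding differentiable_def by (metis partial_eqI has_derivative_mult_right)

lemma deriv_add_const: "deriv (\<lambda>t. a t + c) s = deriv a s"
proof -
  have "DERIV (\<lambda>t. a t + c) s :> D \<longleftrightarrow> DERIV a s :> D" for D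
    using DERIV_add[of "\<lambda>t. a t + c" D s UNIV "\<lambda>_. - c" 0] DERIV_add[of a D s UNIV "\<lambda>_. c" 0] by auto
  then show ?thesis by (simp add: deriv_def)
qed

text \<open>Adding a constant preserves the set of derivatives at a point, even if this set is empty.\<close>

lemma partial_split:
  "partial (Inl i) (\<lambda>w. a (left_vec w) + b (right_vec w)) z = partial i a (left_vec z)"
  "partial (Inr j) (\<lambda>w. a (left_vec w) + b (right_vec w)) z = partial j b (right_vec z)"
  using deriv_add_const[of "\<lambda>t. a (left_vec z + t *\<^sub>R axis i 1)" "b (right_vec z)" 0]
    deriv_add_const[of "\<lambda>t. b (right_vec z + t *\<^sub>R axis j 1)" "a (left_vec z)" 0]
  by (simp_all add: partial_def add.commute)

lemma partial_left [simp]: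
  "partial (Inl i) (\<lambda>w. a (left_vec w)) z = partial i a (left_vec z)"
  "partial (Inr j) (\<lambda>w. a (left_vec w)) z = 0"
  by (simp_all add: partial_def)

lemma partial_right [simp]:
  "partial (Inl i) (\<lambda>w. b (right_vec w)) z = 0"
  "partial (Inr j) (\<lambda>w. b (right_vec w)) z = partial j b (right_vec z)"
  by (simp_all add: partial_def)

lemma has_derivative_Pair_right:
  assumes "(h has_derivative D) (at (x, y))"
  shows "((\<lambda>w. h (x, w)) has_derivative (\<lambda>v. D (0, v))) (at y)"
  using assms by (intro has_derivative_compose[of "\<lambda>w. (x, w)" "\<lambda>v. (0, v)" y UNIV h D])
     (auto intro!: derivative_eq_intros)

lemma has_derivative_Pair_left:
  assumes "(h has_derivative D) (at (x, y))"
  shows "((\<lambda>z. h (z, y)) has_derivative (\<lambda>v. D (v, 0))) (at x)"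
  using assms by (intro has_derivative_compose[of "\<lambda>z. (z, y)" "\<lambda>v. (v, 0)" x UNIV h D])
     (auto intro!: derivative_eq_intros)

text \<open>Near \<open>r *\<^sub>R y\<close> the function \<open>h\<close> equals
  \<open>\<lambda>z. a * h (inverse r *\<^sub>R z)\<close>, and the chain rule contributes the
  factor \<open>1 / r\<close>: the degree of homogeneity drops by one. The factor \<open>a\<close>
  is left free so that it can be \<open>r\<^sup>2\<close> for the squared metric and
  \<open>r\<close> for its first derivatives.\<close>

lemma partial_homogeneous:
  assumes "r > 0" "y \<noteq> 0" and hom: "\<And>z. z \<noteq> 0 \<Longrightarrow> h (r *\<^sub>R z) = a * h z"
    and "h differentiable (at y)"
  shows "partial i h (r *\<^sub>R y) = a / r * partial i h y"
proof -
  obtain D where D: "(h has_derivative D) (at y)" using assms(4) by (auto simp: differentiable_def)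
  have "((\<lambda>z. inverse r *\<^sub>R z) has_derivative (\<lambda>v. inverse r *\<^sub>R v)) (at (r *\<^sub>R y))"
    by (rule bounded_linear_imp_has_derivative[OF bounded_linear_scaleR_right])
  moreover have "(h has_derivative D) (at (inverse r *\<^sub>R (r *\<^sub>R y)))" using D \<open>r > 0\<close> by simp
  ultimately have "((\<lambda>z. a * h (inverse r *\<^sub>R z)) has_derivative (\<lambda>v. a * D (inverse r *\<^sub>R v))) (at (r *\<^sub>R y))"
    by (intro has_derivative_mult_right) (rule has_derivative_compose)
  then have "(h has_derivative (\<lambda>v. a * D (inverse r *\<^sub>R v))) (at (r *\<^sub>R y))"
  proof (rule has_derivative_transform_within_open[of _ _ _ _ "- {0}"])
    show "a * h (inverse r *\<^sub>R z) = h z" if "z \<in> - {0}" for z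
      using hom[of "inverse r *\<^sub>R z"] that \<open>r > 0\<close> by simp
  qed (use assms in auto)
  then show ?thesis
    using linear_cmul[OF has_derivative_linear[OF D], of "inverse r"]
    by (simp add: partial_eqI[OF D] partial_eqI divide_inverse)
qed

text \<open>The fundamental tensor detached from atlases, so that the local theory can be developed
  on an open subset of the coordinate space.\<close>

definition metric_tensor :: "(real^'n \<Rightarrow> real^'n \<Rightarrow> real) \<Rightarrow> real^'n \<Rightarrow> real^'n \<Rightarrow> real^'n^'n::finite" where
  "metric_tensor L x y = (\<chi> i j. (1/2) * partial i (\<lambda>z. partial j (\<lambda>w. (L x w)\<^sup>2) z) y)"

lemma fundamental_tensor_eq: "fundamental_tensor A F c = metric_tensor (local_rep A F c)"
  by (intro ext) (simp add: fundamental_tensor_def metric_tensor_def)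

text \<open>A Finsler metric as seen in one chart. Strict positivity off the zero section is derived
  below from \<open>posdef\<close> and \<open>nonneg\<close>.\<close>

locale finsler_patch =
  fixes U :: "(real^'n::finite) set" and L :: "real^'n \<Rightarrow> real^'n \<Rightarrow> real"
  assumes open_U: "open U"
    and continuous: "continuous_on (U \<times> UNIV) (\<lambda>(x, y). L x y)"
    and smooth: "smooth_on (U \<times> - {0}) (\<lambda>(x, y). L x y)"
    and homogeneous: "\<And>x y r. x \<in> U \<Longrightarrow> r > 0 \<Longrightarrow> L x (r *\<^sub>R y) = r * L x y"
    and nonneg: "\<And>x y. x \<in> U \<Longrightarrow> 0 \<le> L x y"
    and posdef: "\<And>x y u. x \<in> U \<Longrightarrow> y \<noteq> 0 \<Longrightarrow> u \<noteq> 0 \<Longrightarrow> 0 < u \<bullet> (metric_tensor L x y *v u)"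
begin

abbreviation "\<Omega> \<equiv> U \<times> (- {0} :: (real^'n) set)"

abbreviation sq :: "(real^'n) \<times> (real^'n) \<Rightarrow> real" where "sq \<equiv> \<lambda>(x, y). (L x y)\<^sup>2"

text \<open>Derivatives in the position and in the velocity are both instances, for directions of
  the form \<open>(u, 0)\<close> and \<open>(0, u)\<close>. With the direction fixed, the result is
  smooth in position and velocity together and can be differentiated again.\<close>

abbreviation dsq :: "(real^'n) \<times> (real^'n) \<Rightarrow> (real^'n) \<times> (real^'n) \<Rightarrow> real" where
  "dsq v p \<equiv> frechet_derivative sq (at p) v"

lemma open_slit: "open \<Omega>" by (intro open_Times open_U) auto

lemma smooth_sq: "smooth_on \<Omega> sq"
proof -
  have "sq = (\<lambda>p. (case p of (x, y) \<Rightarrow> L x y) * (case p of (x, y) \<Rightarrow> L x y))"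
    by (auto simp: power2_eq_square)
  then show ?thesis using smooth_on_mult[OF open_slit smooth smooth] by presburger
qed

lemma smooth_dsq: "smooth_on \<Omega> (dsq v)"
  by (rule smooth_on_frechet[OF smooth_sq])

lemma sq_has_derivative:
  "p \<in> \<Omega> \<Longrightarrow> (sq has_derivative (\<lambda>v. dsq v p)) (at p)"
  using smooth_on_differentiable[OF smooth_sq] by (simp add: frechet_derivative_works)

lemma dsq_has_derivative:
  "p \<in> \<Omega> \<Longrightarrow> (dsq v has_derivative frechet_derivative (dsq v) (at p)) (at p)"
  using smooth_on_differentiable[OF smooth_dsq] by (simp add: frechet_derivative_works)

lemma sq_has_derivative_right:
  "x \<in> U \<Longrightarrow> y \<noteq> 0 \<Longrightarrow> ((\<lambda>w. (L x w)\<^sup>2) has_derivative (\<lambda>v. dsq (0, v) (x, y))) (at y)"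
  using has_derivative_Pair_right[OF sq_has_derivative[of "(x, y)"]] by simp

lemma sq_has_derivative_left:
  "x \<in> U \<Longrightarrow> y \<noteq> 0 \<Longrightarrow> ((\<lambda>z. (L z y)\<^sup>2) has_derivative (\<lambda>v. dsq (v, 0) (x, y))) (at x)"
  using has_derivative_Pair_left[OF sq_has_derivative[of "(x, y)"]] by simp

lemma partial_sq_right: "x \<in> U \<Longrightarrow> y \<noteq> 0 \<Longrightarrow> partial j (\<lambda>w. (L x w)\<^sup>2) y = dsq (0, axis j 1) (x, y)"
  by (rule partial_eqI[OF sq_has_derivative_right])

lemma partial_sq_left: "x \<in> U \<Longrightarrow> y \<noteq> 0 \<Longrightarrow> partial k (\<lambda>z. (L z y)\<^sup>2) x = dsq (axis k 1, 0) (x, y)"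
  by (rule partial_eqI[OF sq_has_derivative_left])

lemma dsq_differentiable_right:
  assumes "x \<in> U" "y \<noteq> 0"
  shows "((\<lambda>w. dsq v (x, w)) has_derivative (\<lambda>u. frechet_derivative (dsq v) (at (x, y)) (0, u))) (at y)"
  using assms by (intro has_derivative_Pair_right dsq_has_derivative) auto

lemma partial_sq_right_differentiable:
  assumes "x \<in> U" "y \<noteq> 0"
  shows "(\<lambda>z. partial j (\<lambda>w. (L x w)\<^sup>2) z) differentiable (at y)"
  using dsq_differentiable_right[OF assms, of "(0, axis j 1)"]
    differentiable_cong_open[of "- {0}" y "\<lambda>z. partial j (\<lambda>w. (L x w)\<^sup>2) z" "\<lambda>w. dsq (0, axis j 1) (x, w)"]
    assms partial_sq_right[OF assms(1)] by (auto simp: differentiable_def open_Compl)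

lemma partial_sq_left_differentiable:
  assumes "x \<in> U" "y \<noteq> 0"
  shows "(\<lambda>w. partial k (\<lambda>z. (L z w)\<^sup>2) x) differentiable (at y)"
  using dsq_differentiable_right[OF assms, of "(axis k 1, 0)"]
    differentiable_cong_open[of "- {0}" y "\<lambda>w. partial k (\<lambda>z. (L z w)\<^sup>2) x" "\<lambda>w. dsq (axis k 1, 0) (x, w)"]
    assms partial_sq_left[OF assms(1)] by (auto simp: differentiable_def open_Compl)

text \<open>Replaces nested partial derivatives in the velocity by a second directional derivative
  on the whole patch, which is known to be continuous in both variables.\<close>

lemma metric_tensor_eq:
  assumes "x \<in> U" "y \<noteq> 0"
  shows "metric_tensor L x y $ i $ j =
    1/2 * frechet_derivative (dsq (0, axis j 1)) (at (x, y)) (0, axis i 1)"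
proof -
  have "partial i (\<lambda>z. partial j (\<lambda>w. (L x w)\<^sup>2) z) y = partial i (\<lambda>z. dsq (0, axis j 1) (x, z)) y"
    by (rule partial_cong_open[of "- {0}"]) (use assms in \<open>auto simp: partial_sq_right\<close>)
  then show ?thesis
    using partial_eqI[OF dsq_differentiable_right[OF assms]] by (simp add: metric_tensor_def)
qed

lemma metric_tensor_continuous: "continuous_on \<Omega> (\<lambda>p. metric_tensor L (fst p) (snd p) $ i $ j)"
proof -
  have "continuous_on \<Omega> (\<lambda>p. 1/2 * frechet_derivative (dsq (0, axis j 1)) (at p) (0, axis i 1))"
    by (intro continuous_intros smooth_on_continuous[OF smooth_on_frechet[OF smooth_dsq]])
  then show ?thesis
  proof (rule continuous_on_eq)
    fix p assume "p \<in> \<Omega>"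
    then show "1/2 * frechet_derivative (dsq (0, axis j 1)) (at p) (0, axis i 1) =
        metric_tensor L (fst p) (snd p) $ i $ j"
      using metric_tensor_eq[of "fst p" "snd p" i j] by (simp add: mem_Times_iff)
  qed
qed

lemma det_continuous: "continuous_on \<Omega> (\<lambda>p. det (metric_tensor L (fst p) (snd p)))"
  unfolding det_def
  by (intro continuous_on_sum continuous_on_mult continuous_on_const continuous_on_prod metric_tensor_continuous)

text \<open>The second derivative is linear in each of its two directions, so expanding
  \<open>u\<close> in the standard basis in both places produces the matrix entries. It will be
  applied with \<open>u\<close> equal to the velocity itself.\<close>

lemma metric_tensor_quadratic:
  assumes "x \<in> U" "y \<noteq> 0"
  shows "u \<bullet> (metric_tensor L x y *v u) = 1/2 * frechet_derivative (dsq (0, u)) (at (x, y)) (0, u)"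
proof -
  have lin: "D (0, u) = (\<Sum>j\<in>UNIV. u $ j * D (0, axis j 1))" if "linear D"
    for D :: "(real^'n) \<times> (real^'n) \<Rightarrow> real"
  proof -
    have "(\<Sum>j\<in>UNIV. u $ j *\<^sub>R axis j 1) = u"
      using basis_expansion[of u] by (simp add: scalar_mult_eq_scaleR)
    then have "(0, u) = (\<Sum>j\<in>UNIV. u $ j *\<^sub>R (0 :: real^'n, axis j 1))"
      by (simp add: prod_eq_iff fst_sum snd_sum)
    then have "D (0, u) = (\<Sum>j\<in>UNIV. D (u $ j *\<^sub>R (0, axis j 1)))"
      by (simp only: linear_sum[OF that])
    then show ?thesis by (simp only: linear_cmul[OF that] real_scaleR_def)
  qed
  have "((\<lambda>p. \<Sum>j\<in>UNIV. u $ j * dsq (0, axis j 1) p) has_derivative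
    (\<lambda>v. \<Sum>j\<in>UNIV. u $ j * frechet_derivative (dsq (0, axis j 1)) (at (x, y)) v)) (at (x, y))"
    using assms by (intro has_derivative_sum has_derivative_mult_right dsq_has_derivative) auto
  then have "(dsq (0, u) has_derivative
    (\<lambda>v. \<Sum>j\<in>UNIV. u $ j * frechet_derivative (dsq (0, axis j 1)) (at (x, y)) v)) (at (x, y))"
  proof (rule has_derivative_transform_within_open[OF _ open_slit])
    show "(\<Sum>j\<in>UNIV. u $ j * dsq (0, axis j 1) p) = dsq (0, u) p" if "p \<in> \<Omega>" for p
      using lin[OF has_derivative_linear[OF sq_has_derivative[OF that]]] by simp
  qed (use assms in auto)
  then have "frechet_derivative (dsq (0, u)) (at (x, y)) (0, u) =
      (\<Sum>j\<in>UNIV. u $ j * frechet_derivative (dsq (0, axis j 1)) (at (x, y)) (0, u))"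
    by (simp add: frechet_derivative_eqI)
  also have "\<dots> = (\<Sum>j\<in>UNIV. u $ j * (\<Sum>i\<in>UNIV. u $ i *
      frechet_derivative (dsq (0, axis j 1)) (at (x, y)) (0, axis i 1)))"
    using assms by (intro sum.cong refl arg_cong2[where f="(*)"] lin has_derivative_linear[OF dsq_has_derivative]) auto
  also have "\<dots> = (\<Sum>i\<in>UNIV. \<Sum>j\<in>UNIV. u $ j * (u $ i * (2 * metric_tensor L x y $ i $ j)))"
    by (simp add: metric_tensor_eq[OF assms] sum_distrib_left) (rule sum.swap)
  also have "\<dots> = 2 * (u \<bullet> (metric_tensor L x y *v u))"
    by (simp add: inner_vec_def matrix_vector_mult_def sum_distrib_left mult_ac)
  finally show ?thesis by simp
qed

text \<open>If \<open>L x y\<close> vanished then \<open>L\<^sup>2\<close> would vanish along the whole ray through \<open>y\<close>, and so would its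
  second derivative in the direction \<open>y\<close>.\<close>

lemma pos:
  assumes "x \<in> U" "y \<noteq> 0"
  shows "L x y > 0"
proof (rule ccontr)
  assume "\<not> L x y > 0"
  then have L0: "L x y = 0" using nonneg[OF assms(1), of y] by simp
  have nz: "y + t *\<^sub>R y \<noteq> 0" if "\<bar>t\<bar> < 1" for t
  proof -
    have "y + t *\<^sub>R y = (1 + t) *\<^sub>R y" by (simp add: scaleR_add_left)
    then show ?thesis using that assms(2) by auto
  qed
  have L1: "(L x (y + t *\<^sub>R y))\<^sup>2 = 0" if "\<bar>t\<bar> < 1" for t
    using homogeneous[of x "1 + t" y] that L0 assms by (simp add: scaleR_add_left)
  have zero_deriv: "d = 0"
    if "DERIV h s :> d" "\<bar>s\<bar> < 1" "\<And>t. \<bar>t\<bar> < 1 \<Longrightarrow> h t = 0" for h :: "real \<Rightarrow> real" and d s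
  proof -
    have "DERIV (\<lambda>_. 0) s :> d"
      by (rule has_field_derivative_transform_within_open[OF that(1), of "{-1<..<1}"])
         (use that in \<open>auto simp: abs_less_iff\<close>)
    then show "d = 0" using DERIV_unique[OF _ DERIV_const] by blast
  qed
  have q0: "dsq (0, y) (x, y + t *\<^sub>R y) = 0" if "\<bar>t\<bar> < 1" for t
    by (rule zero_deriv[OF has_derivative_line[OF sq_has_derivative_right[OF assms(1) nz[OF that]]] that L1])
  have "frechet_derivative (dsq (0, y)) (at (x, y)) (0, y) = 0"
  proof (rule zero_deriv)
    have "((\<lambda>w. dsq (0, y) (x, w)) has_derivative
       (\<lambda>u. frechet_derivative (dsq (0, y)) (at (x, y)) (0, u))) (at (y + 0 *\<^sub>R y))"
      using dsq_differentiable_right[OF assms, of "(0, y)"] by simp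
    from has_derivative_line[OF this]
    show "((\<lambda>t. dsq (0, y) (x, y + t *\<^sub>R y)) has_real_derivative
        frechet_derivative (dsq (0, y)) (at (x, y)) (0, y)) (at 0)" .
  qed (simp_all add: q0)
  then show False
    using posdef[OF assms assms(2)] by (simp add: metric_tensor_quadratic[OF assms])
qed

text \<open>In the velocity the squared metric has degree 2, its first derivatives degree 1 and its
  second derivatives degree 0.\<close>

lemma metric_tensor_homogeneous:
  assumes "x \<in> U" "y \<noteq> 0" "r > 0"
  shows "metric_tensor L x (r *\<^sub>R y) = metric_tensor L x y"
proof -
  have "partial j (\<lambda>w. (L x w)\<^sup>2) (r *\<^sub>R z) = r * partial j (\<lambda>w. (L x w)\<^sup>2) z" if "z \<noteq> 0" for j z
    using partial_homogeneous[of r z "\<lambda>w. (L x w)\<^sup>2" "r\<^sup>2" j] that assms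
      sq_has_derivative_right[of x z]
    by (auto simp: homogeneous power_mult_distrib differentiable_def power2_eq_square)
  then have "partial i (\<lambda>z. partial j (\<lambda>w. (L x w)\<^sup>2) z) (r *\<^sub>R y) =
      r / r * partial i (\<lambda>z. partial j (\<lambda>w. (L x w)\<^sup>2) z) y" for i j
    using assms partial_sq_right_differentiable by (intro partial_homogeneous) auto
  then show ?thesis using assms by (simp add: metric_tensor_def)
qed

lemma metric_tensor_invertible: "x \<in> U \<Longrightarrow> y \<noteq> 0 \<Longrightarrow> invertible (metric_tensor L x y)"
  by (rule pos_def_invertible[OF posdef])

lemma det_pos: "x \<in> U \<Longrightarrow> y \<noteq> 0 \<Longrightarrow> det (metric_tensor L x y) > 0"
  by (rule pos_def_det_pos[OF posdef])

end

text \<open>Every coordinate velocity is the component of a tangent vector, so conditions on the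
  tangent spaces turn into conditions for all \<open>y\<close>.\<close>

lemma (in manifold) finsler_manifold_patch:
  assumes "finsler_manifold A (slit_tangent_bundle A) F"
  shows "finsler_patch (cimage A c) (local_rep A F c)"
proof
  note F = assms[unfolded finsler_manifold_def local_set_slit]
  show "open (cimage A c)" by (rule open_cimage)
  show "continuous_on (cimage A c \<times> UNIV) (\<lambda>(x, y). local_rep A F c x y)"
    "smooth_on (cimage A c \<times> - {0}) (\<lambda>(x, y). local_rep A F c x y)" using F by blast+
  fix x y assume x: "x \<in> cimage A c"
  note tv = tangent_vector_in_tangent_space[OF cinv_in_cdom[OF x]]
  show "0 \<le> local_rep A F c x y"
    unfolding local_rep_def using F tv by blast
  show "local_rep A F c x (r *\<^sub>R y) = r * local_rep A F c x y" if "r > 0" for r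
  proof -
    have "F (cinv A c x) (\<lambda>d. r *\<^sub>R tangent_vector A c (cinv A c x) y d) =
        r * F (cinv A c x) (tangent_vector A c (cinv A c x) y)" using F tv that by blast
    then show ?thesis by (simp add: local_rep_def tangent_vector_scaleR[OF cinv_in_cdom[OF x]])
  qed
  show "0 < u \<bullet> (metric_tensor (local_rep A F c) x y *v u)" if "y \<noteq> 0" "u \<noteq> 0" for u
    using F x that unfolding fundamental_tensor_eq by blast
qed

section \<open>Products with constant warping\<close>

definition spray :: "(real^'n \<Rightarrow> real^'n \<Rightarrow> real) \<Rightarrow> 'n::finite \<Rightarrow> real^'n \<Rightarrow> real^'n \<Rightarrow> real" where
  "spray L i x y =
     (1/4) * (\<Sum>l\<in>UNIV. matrix_inv (metric_tensor L x y) $ i $ l *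
       ((\<Sum>k\<in>UNIV. partial l (\<lambda>w. partial k (\<lambda>z. (L z w)\<^sup>2) x) y * y $ k)
        - partial l (\<lambda>z. (L z y)\<^sup>2) x))"

lemma spray_coeff_eq: "spray_coeff A F c i x y = spray (local_rep A F c) i x y"
  by (simp add: spray_coeff_def spray_def fundamental_tensor_eq)

abbreviation product_slit :: "(real^('a::finite + 'b::finite)) set" where
  "product_slit \<equiv> {y. left_vec y \<noteq> 0 \<and> right_vec y \<noteq> 0}"

lemma open_product_slit: "open product_slit"
  using open_left_right[of "- {0}" "- {0}"] by (simp add: open_Compl)

lemma matrix_inv_scaleR:
  fixes A :: "real^'n^'n"
  assumes "invertible A" "k \<noteq> 0"
  shows "matrix_inv (k *\<^sub>R A) = inverse k *\<^sub>R matrix_inv A"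
proof (rule matrix_inv_eqI)
  show "(k *\<^sub>R A) ** (inverse k *\<^sub>R matrix_inv A) = mat 1"
    using assms invertible_matrix_inv[OF assms(1)]
    by (simp add: scalar_matrix_assoc matrix_scalar_ac scaleR_right_imp_eq)
qed

lemma det_scaleR:
  fixes A :: "real^'n^'n"
  shows "det (k *\<^sub>R A) = k ^ CARD('n) * det A"
proof -
  have "k *\<^sub>R A = (\<chi> i. k *s A $ i)" by (simp add: vec_eq_iff)
  then show ?thesis using det_rows_mul[of "\<lambda>_. k" "\<lambda>i. A $ i"] by simp
qed

text \<open>Local model of the product in a pair of charts, with \<open>\<kappa>\<close> standing
  for the square of the constant warping function. The formula for \<open>L\<close> is available
  only over the coordinate images; as these are open, it can also be used under derivatives in the
  position.\<close>

locale finsler_patch_pair = P1: finsler_patch U1 L1 + P2: finsler_patch U2 L2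
  for U1 :: "(real^'n1::finite) set" and L1 and U2 :: "(real^'n2::finite) set" and L2 +
  fixes \<kappa> :: real and L :: "real^('n1 + 'n2) \<Rightarrow> real^('n1 + 'n2) \<Rightarrow> real"
  assumes \<kappa>_pos: "\<kappa> > 0"
    and L_eq: "\<And>x y. left_vec x \<in> U1 \<Longrightarrow> right_vec x \<in> U2 \<Longrightarrow>
      L x y = sqrt ((L1 (left_vec x) (left_vec y))\<^sup>2 + \<kappa> * (L2 (right_vec x) (right_vec y))\<^sup>2)"
begin

abbreviation "U \<equiv> {x. left_vec x \<in> U1 \<and> right_vec x \<in> U2}"

lemma open_U: "open U" by (rule open_left_right[OF P1.open_U P2.open_U])

lemma sq_eq:
  "x \<in> U \<Longrightarrow> (L x y)\<^sup>2 = (L1 (left_vec x) (left_vec y))\<^sup>2 + \<kappa> * (L2 (right_vec x) (right_vec y))\<^sup>2"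
  using \<kappa>_pos by (simp add: L_eq)

lemma partial_sq_right_Inl:
  assumes "x \<in> U"
  shows "partial (Inl j) (\<lambda>w. (L x w)\<^sup>2) z = partial j (\<lambda>w. (L1 (left_vec x) w)\<^sup>2) (left_vec z)"
  using partial_split(1)[of j "\<lambda>w. (L1 (left_vec x) w)\<^sup>2" "\<lambda>w. \<kappa> * (L2 (right_vec x) w)\<^sup>2" z]
  by (simp only: sq_eq[OF assms])

lemma partial_sq_right_Inr:
  assumes "x \<in> U" "right_vec z \<noteq> 0"
  shows "partial (Inr j) (\<lambda>w. (L x w)\<^sup>2) z = \<kappa> * partial j (\<lambda>w. (L2 (right_vec x) w)\<^sup>2) (right_vec z)"
proof -
  \<comment> \<open>Differentiability is what lets \<open>\<kappa>\<close> be pulled out of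
    \<open>partial\<close>; hence the restriction to nonzero second components.\<close>
  have "(\<lambda>w. (L2 (right_vec x) w)\<^sup>2) differentiable (at (right_vec z))"
    using P2.sq_has_derivative_right assms by (auto simp: differentiable_def)
  then show ?thesis
    using partial_split(2)[of j "\<lambda>w. (L1 (left_vec x) w)\<^sup>2" "\<lambda>w. \<kappa> * (L2 (right_vec x) w)\<^sup>2" z]
    by (simp only: sq_eq[OF assms(1)] partial_cmult)
qed

lemma partial_sq_left_Inl:
  assumes "x \<in> U"
  shows "partial (Inl k) (\<lambda>z. (L z w)\<^sup>2) x = partial k (\<lambda>z. (L1 z (left_vec w))\<^sup>2) (left_vec x)"
proof -
  have "partial (Inl k) (\<lambda>z. (L z w)\<^sup>2) x = partial (Inl k)
      (\<lambda>x. (L1 (left_vec x) (left_vec w))\<^sup>2 + \<kappa> * (L2 (right_vec x) (right_vec w))\<^sup>2) x"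
    by (rule partial_cong_open[OF open_U assms sq_eq])
  also have "\<dots> = partial k (\<lambda>z. (L1 z (left_vec w))\<^sup>2) (left_vec x)"
    by (rule partial_split(1)[of k "\<lambda>z. (L1 z (left_vec w))\<^sup>2" "\<lambda>z. \<kappa> * (L2 z (right_vec w))\<^sup>2"])
  finally show ?thesis .
qed

lemma partial_sq_left_Inr:
  assumes "x \<in> U" "right_vec w \<noteq> 0"
  shows "partial (Inr k) (\<lambda>z. (L z w)\<^sup>2) x = \<kappa> * partial k (\<lambda>z. (L2 z (right_vec w))\<^sup>2) (right_vec x)"
proof -
  have "partial (Inr k) (\<lambda>z. (L z w)\<^sup>2) x = partial (Inr k)
      (\<lambda>x. (L1 (left_vec x) (left_vec w))\<^sup>2 + \<kappa> * (L2 (right_vec x) (right_vec w))\<^sup>2) x"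
    by (rule partial_cong_open[OF open_U assms(1) sq_eq])
  also have "\<dots> = partial k (\<lambda>z. \<kappa> * (L2 z (right_vec w))\<^sup>2) (right_vec x)"
    by (rule partial_split(2)[of k "\<lambda>z. (L1 z (left_vec w))\<^sup>2" "\<lambda>z. \<kappa> * (L2 z (right_vec w))\<^sup>2"])
  also have "\<dots> = \<kappa> * partial k (\<lambda>z. (L2 z (right_vec w))\<^sup>2) (right_vec x)"
    using P2.sq_has_derivative_left assms by (intro partial_cmult) (auto simp: differentiable_def)
  finally show ?thesis .
qed

text \<open>Each first derivative depends on one half of the velocity, which kills the mixed second
  derivatives. The formula in the \<open>Inr\<close> directions is restricted to nonzero second
  components, so the outer derivative is compared on the open set
  \<open>product_slit\<close>.\<close>

lemma partial_partial_right:
  assumes "x \<in> U" "y \<in> product_slit"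
  shows "partial (Inl i) (\<lambda>z. partial (Inl j) (\<lambda>w. (L x w)\<^sup>2) z) y =
      partial i (\<lambda>z. partial j (\<lambda>w. (L1 (left_vec x) w)\<^sup>2) z) (left_vec y)"
    and "partial (Inr i') (\<lambda>z. partial (Inl j) (\<lambda>w. (L x w)\<^sup>2) z) y = 0"
    and "partial (Inl i) (\<lambda>z. partial (Inr j') (\<lambda>w. (L x w)\<^sup>2) z) y = 0"
    and "partial (Inr i') (\<lambda>z. partial (Inr j') (\<lambda>w. (L x w)\<^sup>2) z) y =
      \<kappa> * partial i' (\<lambda>z. partial j' (\<lambda>w. (L2 (right_vec x) w)\<^sup>2) z) (right_vec y)"
proof -
  show "partial (Inl i) (\<lambda>z. partial (Inl j) (\<lambda>w. (L x w)\<^sup>2) z) y =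
      partial i (\<lambda>z. partial j (\<lambda>w. (L1 (left_vec x) w)\<^sup>2) z) (left_vec y)"
    unfolding partial_sq_right_Inl[OF assms(1)] by (rule partial_left)
  show "partial (Inr i') (\<lambda>z. partial (Inl j) (\<lambda>w. (L x w)\<^sup>2) z) y = 0"
    unfolding partial_sq_right_Inl[OF assms(1)] by (rule partial_left)
  have *: "partial k (\<lambda>z. partial (Inr j') (\<lambda>w. (L x w)\<^sup>2) z) y =
    partial k (\<lambda>z. \<kappa> * partial j' (\<lambda>w. (L2 (right_vec x) w)\<^sup>2) (right_vec z)) y" for k
    using assms by (intro partial_cong_open[OF open_product_slit]) (simp_all add: partial_sq_right_Inr)
  show "partial (Inl i) (\<lambda>z. partial (Inr j') (\<lambda>w. (L x w)\<^sup>2) z) y = 0"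
    unfolding * by (rule partial_right)
  show "partial (Inr i') (\<lambda>z. partial (Inr j') (\<lambda>w. (L x w)\<^sup>2) z) y =
      \<kappa> * partial i' (\<lambda>z. partial j' (\<lambda>w. (L2 (right_vec x) w)\<^sup>2) z) (right_vec y)"
    unfolding * using assms P2.partial_sq_right_differentiable
    by (subst partial_right) (auto intro: partial_cmult)
qed

lemma metric_tensor_product:
  assumes "x \<in> U" "y \<in> product_slit"
  shows "metric_tensor L x y = block_matrix (metric_tensor L1 (left_vec x) (left_vec y))
    (\<kappa> *\<^sub>R metric_tensor L2 (right_vec x) (right_vec y))"
  by (simp add: vec_eq_iff sum_type_all metric_tensor_def partial_partial_right[OF assms])

lemma det_metric_tensor_product:
  assumes "x \<in> U" "y \<in> product_slit"
  shows "det (metric_tensor L x y) = \<kappa> ^ CARD('n2) *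
    (det (metric_tensor L1 (left_vec x) (left_vec y)) * det (metric_tensor L2 (right_vec x) (right_vec y)))"
  by (simp add: metric_tensor_product[OF assms] det_block_matrix det_scaleR)

lemma matrix_inv_metric_tensor_product:
  assumes "x \<in> U" "y \<in> product_slit"
  shows "matrix_inv (metric_tensor L x y) =
    block_matrix (matrix_inv (metric_tensor L1 (left_vec x) (left_vec y)))
      (inverse \<kappa> *\<^sub>R matrix_inv (metric_tensor L2 (right_vec x) (right_vec y)))"
proof -
  have "invertible (metric_tensor L1 (left_vec x) (left_vec y))"
    and i2: "invertible (metric_tensor L2 (right_vec x) (right_vec y))"
    using assms P1.metric_tensor_invertible P2.metric_tensor_invertible by auto
  moreover have "invertible (\<kappa> *\<^sub>R metric_tensor L2 (right_vec x) (right_vec y))"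
    using i2 \<kappa>_pos by (simp add: invertible_det_nz det_scaleR)
  ultimately show ?thesis
    using \<kappa>_pos by (simp add: metric_tensor_product[OF assms] matrix_inv_block matrix_inv_scaleR)
qed

text \<open>The pattern of the second velocity derivatives, now with one derivative in the position.
  Here constancy of the warping factor keeps the mixed terms at zero.\<close>

lemma partial_right_left:
  assumes "x \<in> U" "y \<in> product_slit"
  shows "partial (Inl l) (\<lambda>w. partial (Inl k) (\<lambda>z. (L z w)\<^sup>2) x) y =
      partial l (\<lambda>w. partial k (\<lambda>z. (L1 z w)\<^sup>2) (left_vec x)) (left_vec y)"
    and "partial (Inr l') (\<lambda>w. partial (Inl k) (\<lambda>z. (L z w)\<^sup>2) x) y = 0"
    and "partial (Inl l) (\<lambda>w. partial (Inr k') (\<lambda>z. (L z w)\<^sup>2) x) y = 0"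
    and "partial (Inr l') (\<lambda>w. partial (Inr k') (\<lambda>z. (L z w)\<^sup>2) x) y =
      \<kappa> * partial l' (\<lambda>w. partial k' (\<lambda>z. (L2 z w)\<^sup>2) (right_vec x)) (right_vec y)"
proof -
  show "partial (Inl l) (\<lambda>w. partial (Inl k) (\<lambda>z. (L z w)\<^sup>2) x) y =
      partial l (\<lambda>w. partial k (\<lambda>z. (L1 z w)\<^sup>2) (left_vec x)) (left_vec y)"
    unfolding partial_sq_left_Inl[OF assms(1)]
    by (rule partial_left(1)[of l "\<lambda>w. partial k (\<lambda>z. (L1 z w)\<^sup>2) (left_vec x)"])
  show "partial (Inr l') (\<lambda>w. partial (Inl k) (\<lambda>z. (L z w)\<^sup>2) x) y = 0"
    unfolding partial_sq_left_Inl[OF assms(1)]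
    by (rule partial_left(2)[of l' "\<lambda>w. partial k (\<lambda>z. (L1 z w)\<^sup>2) (left_vec x)"])
  have *: "partial i (\<lambda>w. partial (Inr k') (\<lambda>z. (L z w)\<^sup>2) x) y =
    partial i (\<lambda>w. \<kappa> * partial k' (\<lambda>z. (L2 z (right_vec w))\<^sup>2) (right_vec x)) y" for i
    using assms by (intro partial_cong_open[OF open_product_slit]) (simp_all add: partial_sq_left_Inr)
  show "partial (Inl l) (\<lambda>w. partial (Inr k') (\<lambda>z. (L z w)\<^sup>2) x) y = 0"
    unfolding * by (rule partial_right(1)[of l "\<lambda>w. \<kappa> * partial k' (\<lambda>z. (L2 z w)\<^sup>2) (right_vec x)"])
  show "partial (Inr l') (\<lambda>w. partial (Inr k') (\<lambda>z. (L z w)\<^sup>2) x) y =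
      \<kappa> * partial l' (\<lambda>w. partial k' (\<lambda>z. (L2 z w)\<^sup>2) (right_vec x)) (right_vec y)"
    unfolding * using assms P2.partial_sq_left_differentiable
    by (subst partial_right(2)[of l' "\<lambda>w. \<kappa> * partial k' (\<lambda>z. (L2 z w)\<^sup>2) (right_vec x)"])
      (auto intro: partial_cmult)
qed

text \<open>The inverse metric has no entries between the two blocks, and the mixed derivatives
  vanish, so each coefficient sums over its own block. In the second block the inverse metric
  carries \<open>inverse \<kappa>\<close> and every term of the bracket carries
  \<open>\<kappa>\<close>.\<close>

lemma spray_product:
  assumes "x \<in> U" "y \<in> product_slit"
  shows "spray L (Inl i) x y = spray L1 i (left_vec x) (left_vec y)"
    and "spray L (Inr j) x y = spray L2 j (right_vec x) (right_vec y)"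
proof -
  have "right_vec y \<noteq> 0" using assms by simp
  note simps = matrix_inv_metric_tensor_product[OF assms]
    partial_sq_left_Inl[OF assms(1)] partial_sq_left_Inr[OF assms(1) \<open>right_vec y \<noteq> 0\<close>]
  show "spray L (Inl i) x y = spray L1 i (left_vec x) (left_vec y)"
    unfolding spray_def sum_UNIV_sum partial_right_left[OF assms] by (simp add: simps)
  show "spray L (Inr j) x y = spray L2 j (right_vec x) (right_vec y)"
    unfolding spray_def sum_UNIV_sum partial_right_left[OF assms]
    by (simp add: simps mult.assoc mult.left_commute[of _ \<kappa>] sum_distrib_left[symmetric]
        right_diff_distrib[symmetric] less_imp_neq[OF \<kappa>_pos, symmetric])
qed

text \<open>The quadratic form is the sum of the forms of the two factors, the second weighted by
  \<open>\<kappa>\<close>, and at least one half of \<open>u\<close> is nonzero.\<close>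

lemma product_posdef:
  assumes "x \<in> U" "y \<in> product_slit" "u \<noteq> 0"
  shows "0 < u \<bullet> (metric_tensor L x y *v u)"
proof -
  have eq: "u \<bullet> (metric_tensor L x y *v u) =
    left_vec u \<bullet> (metric_tensor L1 (left_vec x) (left_vec y) *v left_vec u) +
    \<kappa> * (right_vec u \<bullet> (metric_tensor L2 (right_vec x) (right_vec y) *v right_vec u))"
    by (simp add: metric_tensor_product[OF assms(1,2)] block_matrix_vec inner_join
        scaleR_matrix_vector_assoc[symmetric])
  have 1: "0 \<le> left_vec u \<bullet> (metric_tensor L1 (left_vec x) (left_vec y) *v left_vec u)"
      "left_vec u \<noteq> 0 \<Longrightarrow> 0 < left_vec u \<bullet> (metric_tensor L1 (left_vec x) (left_vec y) *v left_vec u)"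
    using P1.posdef[of "left_vec x" "left_vec y" "left_vec u"] assms
    by (cases "left_vec u = 0"; simp)+
  have 2: "0 \<le> \<kappa> * (right_vec u \<bullet> (metric_tensor L2 (right_vec x) (right_vec y) *v right_vec u))"
      "right_vec u \<noteq> 0 \<Longrightarrow> 0 < \<kappa> * (right_vec u \<bullet> (metric_tensor L2 (right_vec x) (right_vec y) *v right_vec u))"
    using P2.posdef[of "right_vec x" "right_vec y" "right_vec u"] assms \<kappa>_pos
    by (cases "right_vec u = 0"; simp)+
  from assms(3) have "left_vec u \<noteq> 0 \<or> right_vec u \<noteq> 0" by (simp add: vec_eq_0_iff_left_right[of u])
  then show ?thesis unfolding eq using 1 2 by (meson add_nonneg_pos add_pos_nonneg)
qed

lemma product_continuous: "continuous_on (U \<times> UNIV) (\<lambda>(x, y). L x y)"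
proof -
  have 1: "continuous_on (U \<times> UNIV) (\<lambda>p. L1 (left_vec (fst p)) (left_vec (snd p)))"
    by (rule continuous_on_compose2[OF P1.continuous, of _ "\<lambda>p. (left_vec (fst p), left_vec (snd p))", simplified])
       (auto intro!: continuous_intros)
  have 2: "continuous_on (U \<times> UNIV) (\<lambda>p. L2 (right_vec (fst p)) (right_vec (snd p)))"
    by (rule continuous_on_compose2[OF P2.continuous, of _ "\<lambda>p. (right_vec (fst p), right_vec (snd p))", simplified])
       (auto intro!: continuous_intros)
  have "continuous_on (U \<times> UNIV) (\<lambda>p. sqrt ((L1 (left_vec (fst p)) (left_vec (snd p)))\<^sup>2 +
      \<kappa> * (L2 (right_vec (fst p)) (right_vec (snd p)))\<^sup>2))"
    by (intro continuous_intros 1 2)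
  then show ?thesis by (rule continuous_on_eq) (auto simp: L_eq)
qed

text \<open>The two squares are smooth where the respective velocity component is nonzero. On
  \<open>product_slit\<close> the radicand is moreover positive, so the square root preserves
  smoothness.\<close>

lemma product_smooth: "smooth_on (U \<times> product_slit) (\<lambda>(x, y). L x y)"
proof -
  let ?\<Omega> = "U \<times> (product_slit :: (real^('n1 + 'n2)) set)"
  have op: "open ?\<Omega>" by (intro open_Times open_U open_product_slit)
  have bl1: "bounded_linear (\<lambda>p :: (real^('n1+'n2)) \<times> (real^('n1+'n2)). (left_vec (fst p), left_vec (snd p)))"
    by (intro bounded_linear_Pair bounded_linear_compose[OF bounded_linear_left_vec]
        bounded_linear_fst bounded_linear_snd)
  have bl2: "bounded_linear (\<lambda>p :: (real^('n1+'n2)) \<times> (real^('n1+'n2)). (right_vec (fst p), right_vec (snd p)))"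
    by (intro bounded_linear_Pair bounded_linear_compose[OF bounded_linear_right_vec]
        bounded_linear_fst bounded_linear_snd)
  have 1: "smooth_on ?\<Omega> (\<lambda>p. (L1 (left_vec (fst p)) (left_vec (snd p)))\<^sup>2)"
    using smooth_on_linear_right[OF bl1 op _ P1.smooth_sq] by (simp add: image_subset_iff)
  have 2: "smooth_on ?\<Omega> (\<lambda>p. (L2 (right_vec (fst p)) (right_vec (snd p)))\<^sup>2)"
    using smooth_on_linear_right[OF bl2 op _ P2.smooth_sq] by (simp add: image_subset_iff)
  have "smooth_on ?\<Omega> (\<lambda>p. sqrt ((L1 (left_vec (fst p)) (left_vec (snd p)))\<^sup>2 +
      \<kappa> * (L2 (right_vec (fst p)) (right_vec (snd p)))\<^sup>2))"
  proof (intro smooth_on_sqrt smooth_on_add smooth_on_mult smooth_on_const op 1 2)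
    fix p assume "p \<in> ?\<Omega>"
    then have "L1 (left_vec (fst p)) (left_vec (snd p)) > 0" using P1.pos by auto
    then show "0 < (L1 (left_vec (fst p)) (left_vec (snd p)))\<^sup>2 +
      \<kappa> * (L2 (right_vec (fst p)) (right_vec (snd p)))\<^sup>2"
      using \<kappa>_pos by (simp add: add_pos_nonneg)
  qed
  then show ?thesis
    by (rule smooth_on_cong[OF op, THEN iffD1, rotated]) (auto simp: L_eq)
qed

end

section \<open>Regularity and curvature of the product manifold\<close>

locale finsler_manifold_pair =
  fixes A1 :: "('c1, 'm1::{second_countable_topology, t2_space}, 'n1::finite) atlas"
    and F1 :: "('c1, 'm1, 'n1) tangent_fun"
    and A2 :: "('c2, 'm2::{second_countable_topology, t2_space}, 'n2::finite) atlas"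
    and F2 :: "('c2, 'm2, 'n2) tangent_fun"
    and f :: "'m1 \<Rightarrow> real" and k :: real
  assumes finsler1: "finsler_manifold A1 (slit_tangent_bundle A1) F1"
    and finsler2: "finsler_manifold A2 (slit_tangent_bundle A2) F2"
    and f_eq: "\<And>p. f p = k" and k_pos: "k > 0"
begin

sublocale manifold_pair A1 A2
  by unfold_locales (use finsler1 finsler2 in \<open>simp_all add: finsler_manifold_def\<close>)

abbreviation "W \<equiv> warped_metric A1 F1 A2 F2 f"
abbreviation "D \<equiv> product_slit_bundle A1 A2"

sublocale patch: finsler_patch_pair "cimage A1 (fst c)" "local_rep A1 F1 (fst c)"
  "cimage A2 (snd c)" "local_rep A2 F2 (snd c)" "k\<^sup>2" "local_rep P W c" for c
proof -
  interpret P1: finsler_patch "cimage A1 (fst c)" "local_rep A1 F1 (fst c)"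
    by (rule M1.finsler_manifold_patch[OF finsler1])
  interpret P2: finsler_patch "cimage A2 (snd c)" "local_rep A2 F2 (snd c)"
    by (rule M2.finsler_manifold_patch[OF finsler2])
  show "finsler_patch_pair (cimage A1 (fst c)) (local_rep A1 F1 (fst c))
    (cimage A2 (snd c)) (local_rep A2 F2 (snd c)) (k\<^sup>2) (local_rep P W c)"
  proof unfold_locales
    show "0 < k\<^sup>2" using k_pos by simp
    show "local_rep P W c x y = sqrt ((local_rep A1 F1 (fst c) (left_vec x) (left_vec y))\<^sup>2 +
         k\<^sup>2 * (local_rep A2 F2 (snd c) (right_vec x) (right_vec y))\<^sup>2)"
      if "left_vec x \<in> cimage A1 (fst c)" "right_vec x \<in> cimage A2 (snd c)" for x y
      using that local_rep_warped[of x "fst c" "snd c" F1 F2 f y] cimage_product[of x "fst c" "snd c"]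
      by (simp add: f_eq)
  qed
qed

lemma cimage_eq: "cimage P c = {x. left_vec x \<in> cimage A1 (fst c) \<and> right_vec x \<in> cimage A2 (snd c)}"
  using cimage_product[of _ "fst c" "snd c"] by auto

lemma local_set_eq: "local_set P D c = cimage P c \<times> product_slit"
  using local_set_product_slit[of "fst c" "snd c"] by auto

lemma finsler_product: "finsler_manifold P D W"
  unfolding finsler_manifold_def
proof (intro conjI allI ballI impI)
  show "smooth_manifold P" by (rule MP.manifold)
  show "0 \<le> W p v" for p v using f_eq by (simp add: warped_metric_def)
  show "continuous_on (cimage P c \<times> UNIV) (\<lambda>(x, y). local_rep P W c x y)" for c
    unfolding cimage_eq by (rule patch.product_continuous)
  show "smooth_on (local_set P D c) (\<lambda>(x, y). local_rep P W c x y)" for c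
    unfolding local_set_eq cimage_eq by (rule patch.product_smooth)
  show "W p (\<lambda>c. r *\<^sub>R v c) = r * W p v" if "v \<in> tangent_space P p" "r > 0" for p v r
    using finsler1 finsler2 that unfolding finsler_manifold_def by (intro warped_homogeneous) blast+
  show "case q of (x, y) \<Rightarrow> \<forall>u. u \<noteq> 0 \<longrightarrow> 0 < u \<bullet> (fundamental_tensor P W c x y *v u)"
    if "q \<in> local_set P D c" for c q
    using that patch.product_posdef[of _ c] unfolding local_set_eq cimage_eq fundamental_tensor_eq
    by auto
qed

lemma spray_product:
  assumes "x \<in> cimage P c" "y \<in> product_slit"
  shows "spray_coeff P W c (Inl i) x y = spray_coeff A1 F1 (fst c) i (left_vec x) (left_vec y)"
    and "spray_coeff P W c (Inr j) x y = spray_coeff A2 F2 (snd c) j (right_vec x) (right_vec y)"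
  using assms patch.spray_product[of x c y] unfolding cimage_eq spray_coeff_eq by auto

lemma berwald_product:
  assumes "berwald_manifold A1 (slit_tangent_bundle A1) F1"
    and "berwald_manifold A2 (slit_tangent_bundle A2) F2"
  shows "berwald_manifold P D W"
proof -
  have "berwald_curvature P W c i j l m x y = 0"
    if x: "x \<in> cimage P c" and y: "y \<in> product_slit" for c i j l m x y
  proof -
    \<comment> \<open>All three derivatives are taken on the open set \<open>product_slit\<close>,
      so only the values of the spray coefficient there matter.\<close>
    have cong: "berwald_curvature P W c i j l m x y =
        partial j (\<lambda>y. partial l (\<lambda>y. partial m g y) y) y"
      if "\<And>y. y \<in> product_slit \<Longrightarrow> spray_coeff P W c i x y = g y" for g
      unfolding berwald_curvature_def
      by (intro partial_cong_open[OF open_product_slit]) (use that y in auto)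
    have 1: "berwald_curvature A1 F1 (fst c) i' j' l' m' (left_vec x) (left_vec y) = 0" for i' j' l' m'
      using assms(1) x y unfolding berwald_manifold_def M1.local_set_slit cimage_eq by auto
    have 2: "berwald_curvature A2 F2 (snd c) i' j' l' m' (right_vec x) (right_vec y) = 0" for i' j' l' m'
      using assms(2) x y unfolding berwald_manifold_def M2.local_set_slit cimage_eq by auto
    show ?thesis
    proof (cases i)
      case (Inl i')
      then have "berwald_curvature P W c i j l m x y = partial j (\<lambda>y. partial l (\<lambda>y. partial m
          (\<lambda>y. spray_coeff A1 F1 (fst c) i' (left_vec x) (left_vec y)) y) y) y"
        using spray_product(1)[OF x] by (intro cong) simp
      \<comment> \<open>If one of the derivative indices belongs to the second factor, the function
        being differentiated is constant in that direction. Otherwise the expression is the Berwald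
        curvature of the first factor.\<close>
      then show ?thesis
        using 1 by (cases j; cases l; cases m) (simp_all add: berwald_curvature_def)
    next
      case (Inr i')
      then have "berwald_curvature P W c i j l m x y = partial j (\<lambda>y. partial l (\<lambda>y. partial m
          (\<lambda>y. spray_coeff A2 F2 (snd c) i' (right_vec x) (right_vec y)) y) y) y"
        using spray_product(2)[OF x] by (intro cong) simp
      then show ?thesis
        using 2 by (cases j; cases l; cases m) (simp_all add: berwald_curvature_def)
    qed
  qed
  then show ?thesis
    unfolding berwald_manifold_def local_set_eq using finsler_product by auto
qed

lemma weakly_berwald_product:
  assumes "weakly_berwald_manifold A1 (slit_tangent_bundle A1) F1"
    and "weakly_berwald_manifold A2 (slit_tangent_bundle A2) F2"
  shows "weakly_berwald_manifold P D W"
proof -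
  have "mean_berwald_curvature P W c i j x y = 0"
    if x: "x \<in> cimage P c" and y: "y \<in> product_slit" for c i j x y
  proof -
    let ?d1 = "\<lambda>y. \<Sum>s\<in>UNIV. partial s (\<lambda>y. spray_coeff A1 F1 (fst c) s (left_vec x) y) y"
    let ?d2 = "\<lambda>y. \<Sum>s\<in>UNIV. partial s (\<lambda>y. spray_coeff A2 F2 (snd c) s (right_vec x) y) y"
    \<comment> \<open>The divergence of the spray is a function of the first half of the velocity
      plus a function of the second, the shape to which \<open>partial_split\<close>
      applies.\<close>
    have div: "(\<Sum>s\<in>UNIV. partial s (\<lambda>y. spray_coeff P W c s x y) y) = ?d1 (left_vec y) + ?d2 (right_vec y)"
      if y: "y \<in> product_slit" for y
    proof -
      have 1: "partial (Inl s) (\<lambda>y. spray_coeff P W c (Inl s) x y) y =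
          partial (Inl s) (\<lambda>y. spray_coeff A1 F1 (fst c) s (left_vec x) (left_vec y)) y" for s
        using spray_product(1)[OF x] by (rule partial_cong_open[OF open_product_slit y])
      have 2: "partial (Inr s) (\<lambda>y. spray_coeff P W c (Inr s) x y) y =
          partial (Inr s) (\<lambda>y. spray_coeff A2 F2 (snd c) s (right_vec x) (right_vec y)) y" for s
        using spray_product(2)[OF x] by (rule partial_cong_open[OF open_product_slit y])
      show ?thesis by (simp add: sum_UNIV_sum 1 2)
    qed
    have eq: "mean_berwald_curvature P W c i j x y =
      1/2 * partial i (\<lambda>y. partial j (\<lambda>y. ?d1 (left_vec y) + ?d2 (right_vec y)) y) y"
      unfolding mean_berwald_curvature_def
      by (intro arg_cong2[where f="(*)"] refl partial_cong_open[OF open_product_slit]) (use div y in auto)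
    have 1: "mean_berwald_curvature A1 F1 (fst c) i' j' (left_vec x) (left_vec y) = 0" for i' j'
      using assms(1) x y unfolding weakly_berwald_manifold_def M1.local_set_slit cimage_eq by auto
    have 2: "mean_berwald_curvature A2 F2 (snd c) i' j' (right_vec x) (right_vec y) = 0" for i' j'
      using assms(2) x y unfolding weakly_berwald_manifold_def M2.local_set_slit cimage_eq by auto
    show ?thesis
    proof (cases j)
      case (Inl j')
      \<comment> \<open>A derivative in a direction of the first factor removes the divergence of
        the second one entirely; what remains depends on the first half of the velocity.\<close>
      have "mean_berwald_curvature P W c i j x y = 1/2 * partial i (\<lambda>y. partial j' ?d1 (left_vec y)) y"
        unfolding eq unfolding Inl partial_split(1)[of j' ?d1 ?d2] ..
      then show ?thesis
        using 1 by (cases i) (simp_all add: mean_berwald_curvature_def)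
    next
      case (Inr j')
      have "mean_berwald_curvature P W c i j x y = 1/2 * partial i (\<lambda>y. partial j' ?d2 (right_vec y)) y"
        unfolding eq unfolding Inr partial_split(2)[of j' ?d1 ?d2] ..
      then show ?thesis
        using 2 by (cases i) (simp_all add: mean_berwald_curvature_def)
    qed
  qed
  then show ?thesis
    unfolding weakly_berwald_manifold_def local_set_eq using finsler_product by auto
qed

end

section \<open>Homogeneous weights\<close>

text \<open>\<open>w\<close> stands for the determinant of the metric tensor and \<open>p\<close>
  for the metric on one tangent space. What is retained of their homogeneity is how the mass of the
  sublevel sets of \<open>p\<close> scales; the mass is allowed to be infinite.\<close>

definition homogeneous_weight :: "('a::euclidean_space \<Rightarrow> ennreal) \<Rightarrow> ('a \<Rightarrow> real) \<Rightarrow> bool" where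
  "homogeneous_weight w p \<longleftrightarrow> w \<in> borel_measurable borel \<and> p \<in> borel_measurable borel \<and> (\<forall>y. 0 \<le> p y) \<and>
    (\<forall>r>0. (\<integral>\<^sup>+y. w y * indicator {y. p y < r} y \<partial>lborel) =
      ennreal (r ^ DIM('a)) * (\<integral>\<^sup>+y. w y * indicator {y. p y < 1} y \<partial>lborel))"

text \<open>Substituting \<open>r *\<^sub>R y\<close> for \<open>y\<close> produces the power of
  \<open>r\<close> as Jacobian, while a weight of degree 0 stays unchanged.\<close>

lemma homogeneous_weightI:
  fixes w :: "'a::euclidean_space \<Rightarrow> ennreal"
  assumes [measurable]: "w \<in> borel_measurable borel" "p \<in> borel_measurable borel"
    and nonneg: "\<And>y. 0 \<le> p y"
    and w: "\<And>r y. r > 0 \<Longrightarrow> w (r *\<^sub>R y) = w y"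
    and p: "\<And>r y. r > 0 \<Longrightarrow> p (r *\<^sub>R y) = r * p y"
  shows "homogeneous_weight w p"
  unfolding homogeneous_weight_def
proof (intro conjI allI impI assms)
  fix r :: real assume r: "r > 0"
  have "(\<integral>\<^sup>+y. w y * indicator {y. p y < r} y \<partial>lborel) =
    (\<integral>\<^sup>+y. ennreal (\<bar>r\<bar> ^ DIM('a)) * (w (0 + r *\<^sub>R y) * indicator {y. p y < r} (0 + r *\<^sub>R y)) \<partial>lborel)"
    using r by (subst lborel_affine[of r 0]) (simp_all add: nn_integral_density nn_integral_distr)
  also have "\<dots> = (\<integral>\<^sup>+y. ennreal (r ^ DIM('a)) * (w y * indicator {y. p y < 1} y) \<partial>lborel)"
    using r by (intro nn_integral_cong) (simp add: w p indicator_def)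
  also have "\<dots> = ennreal (r ^ DIM('a)) * (\<integral>\<^sup>+y. w y * indicator {y. p y < 1} y \<partial>lborel)"
    by (rule nn_integral_cmult) measurable
  finally show "(\<integral>\<^sup>+y. w y * indicator {y. p y < r} y \<partial>lborel) = \<dots>" .
qed

text \<open>For fixed \<open>y1\<close> the slice of the product ball is empty or a ball of
  \<open>p2\<close> whose radius is the displayed square root. Scaling pulls the mass of the unit
  ball of \<open>p2\<close> out of the integral, and the factor left behind no longer involves
  \<open>w2\<close> or \<open>p2\<close>.\<close>

lemma homogeneous_weight_integrate_right:
  fixes w1 :: "'a::euclidean_space \<Rightarrow> ennreal" and w2 :: "'b::euclidean_space \<Rightarrow> ennreal"
  assumes "\<kappa> > 0" and w1: "homogeneous_weight w1 p1" and w2: "homogeneous_weight w2 p2"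
  shows "(\<integral>\<^sup>+y1. \<integral>\<^sup>+y2. w1 y1 * w2 y2 * indicator {(y1, y2). (p1 y1)\<^sup>2 + \<kappa> * (p2 y2)\<^sup>2 < 1} (y1, y2) \<partial>lborel \<partial>lborel) =
    (\<integral>\<^sup>+y1. w1 y1 * (if p1 y1 < 1 then ennreal (sqrt ((1 - (p1 y1)\<^sup>2) / \<kappa>) ^ DIM('b)) else 0) \<partial>lborel) *
    (\<integral>\<^sup>+y2. w2 y2 * indicator {y. p2 y < 1} y2 \<partial>lborel)"
proof -
  have [measurable]: "w1 \<in> borel_measurable borel" "p1 \<in> borel_measurable borel"
    "w2 \<in> borel_measurable borel" "p2 \<in> borel_measurable borel"
    and p1: "\<And>y. 0 \<le> p1 y" and p2: "\<And>y. 0 \<le> p2 y"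
    and scale: "\<And>r. r > 0 \<Longrightarrow> (\<integral>\<^sup>+y. w2 y * indicator {y. p2 y < r} y \<partial>lborel) =
      ennreal (r ^ DIM('b)) * (\<integral>\<^sup>+y. w2 y * indicator {y. p2 y < 1} y \<partial>lborel)"
    using w1 w2 unfolding homogeneous_weight_def by blast+
  have "(\<integral>\<^sup>+y2. w1 y1 * w2 y2 * indicator {(y1, y2). (p1 y1)\<^sup>2 + \<kappa> * (p2 y2)\<^sup>2 < 1} (y1, y2) \<partial>lborel) =
      w1 y1 * (if p1 y1 < 1 then ennreal (sqrt ((1 - (p1 y1)\<^sup>2) / \<kappa>) ^ DIM('b)) else 0) *
      (\<integral>\<^sup>+y2. w2 y2 * indicator {y. p2 y < 1} y2 \<partial>lborel)" for y1
  proof (cases "p1 y1 < 1")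
    case True
    let ?r = "sqrt ((1 - (p1 y1)\<^sup>2) / \<kappa>)"
    have "(p1 y1)\<^sup>2 < 1" using True p1[of y1] by (simp add: abs_square_less_1)
    then have r: "?r > 0" using \<open>\<kappa> > 0\<close> by simp
    have iff: "(p1 y1)\<^sup>2 + \<kappa> * (p2 y2)\<^sup>2 < 1 \<longleftrightarrow> p2 y2 < ?r" for y2
    proof -
      have "p2 y2 < ?r \<longleftrightarrow> (p2 y2)\<^sup>2 < (1 - (p1 y1)\<^sup>2) / \<kappa>"
        using real_sqrt_less_iff[of "(p2 y2)\<^sup>2" "(1 - (p1 y1)\<^sup>2) / \<kappa>"] p2[of y2]
        by (simp only: real_sqrt_abs abs_of_nonneg)
      also have "\<dots> \<longleftrightarrow> (p1 y1)\<^sup>2 + \<kappa> * (p2 y2)\<^sup>2 < 1"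
        using \<open>\<kappa> > 0\<close> by (simp add: field_simps)
      finally show ?thesis by simp
    qed
    have "(\<integral>\<^sup>+y2. w1 y1 * w2 y2 * indicator {(y1, y2). (p1 y1)\<^sup>2 + \<kappa> * (p2 y2)\<^sup>2 < 1} (y1, y2) \<partial>lborel) =
      (\<integral>\<^sup>+y2. w1 y1 * (w2 y2 * indicator {y. p2 y < ?r} y2) \<partial>lborel)"
      by (intro nn_integral_cong) (simp add: indicator_def iff)
    also have "\<dots> = w1 y1 * (\<integral>\<^sup>+y2. w2 y2 * indicator {y. p2 y < ?r} y2 \<partial>lborel)"
      by (rule nn_integral_cmult) measurable
    finally show ?thesis using True by (simp add: scale[OF r] mult.assoc)
  next
    case False
    then have "1 \<le> (p1 y1)\<^sup>2" by simp
    then have "\<not> (p1 y1)\<^sup>2 + \<kappa> * (p2 y2)\<^sup>2 < 1" for y2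
      using \<open>\<kappa> > 0\<close> by (simp add: not_less add_increasing2)
    then show ?thesis using False by simp
  qed
  then show ?thesis by (simp add: nn_integral_multc)
qed

text \<open>After exchanging the order of integration, slices for fixed \<open>y2\<close> are balls
  of \<open>p1\<close>. Now the mass of the first unit ball splits off and the other factor involves
  only the second weight.\<close>

lemma homogeneous_weight_integrate_left:
  fixes w1 :: "'a::euclidean_space \<Rightarrow> ennreal" and w2 :: "'b::euclidean_space \<Rightarrow> ennreal"
  assumes "\<kappa> > 0" and w1: "homogeneous_weight w1 p1" and w2: "homogeneous_weight w2 p2"
  shows "(\<integral>\<^sup>+y1. \<integral>\<^sup>+y2. w1 y1 * w2 y2 * indicator {(y1, y2). (p1 y1)\<^sup>2 + \<kappa> * (p2 y2)\<^sup>2 < 1} (y1, y2) \<partial>lborel \<partial>lborel) =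
    (\<integral>\<^sup>+y1. w1 y1 * indicator {y. p1 y < 1} y1 \<partial>lborel) *
    (\<integral>\<^sup>+y2. w2 y2 * (if sqrt \<kappa> * p2 y2 < 1 then ennreal (sqrt (1 - \<kappa> * (p2 y2)\<^sup>2) ^ DIM('a)) else 0) \<partial>lborel)"
proof -
  have [measurable]: "w1 \<in> borel_measurable borel" "p1 \<in> borel_measurable borel"
    "w2 \<in> borel_measurable borel" "p2 \<in> borel_measurable borel"
    and p1: "\<And>y. 0 \<le> p1 y" and p2: "\<And>y. 0 \<le> p2 y"
    and scale: "\<And>r. r > 0 \<Longrightarrow> (\<integral>\<^sup>+y. w1 y * indicator {y. p1 y < r} y \<partial>lborel) =
      ennreal (r ^ DIM('a)) * (\<integral>\<^sup>+y. w1 y * indicator {y. p1 y < 1} y \<partial>lborel)"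
    using w1 w2 unfolding homogeneous_weight_def by blast+
  have "(\<integral>\<^sup>+y1. w1 y1 * w2 y2 * indicator {(y1, y2). (p1 y1)\<^sup>2 + \<kappa> * (p2 y2)\<^sup>2 < 1} (y1, y2) \<partial>lborel) =
      (\<integral>\<^sup>+y1. w1 y1 * indicator {y. p1 y < 1} y1 \<partial>lborel) *
      (w2 y2 * (if sqrt \<kappa> * p2 y2 < 1 then ennreal (sqrt (1 - \<kappa> * (p2 y2)\<^sup>2) ^ DIM('a)) else 0))" for y2
  proof (cases "sqrt \<kappa> * p2 y2 < 1")
    case True
    let ?r = "sqrt (1 - \<kappa> * (p2 y2)\<^sup>2)"
    have "(sqrt \<kappa> * p2 y2)\<^sup>2 < 1" using True p2[of y2] \<open>\<kappa> > 0\<close> by (simp add: abs_square_less_1 abs_mult)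
    then have r: "?r > 0" using \<open>\<kappa> > 0\<close> by (simp add: power_mult_distrib)
    have iff: "(p1 y1)\<^sup>2 + \<kappa> * (p2 y2)\<^sup>2 < 1 \<longleftrightarrow> p1 y1 < ?r" for y1
    proof -
      have "p1 y1 < ?r \<longleftrightarrow> (p1 y1)\<^sup>2 < 1 - \<kappa> * (p2 y2)\<^sup>2"
        using real_sqrt_less_iff[of "(p1 y1)\<^sup>2" "1 - \<kappa> * (p2 y2)\<^sup>2"] p1[of y1]
        by (simp only: real_sqrt_abs abs_of_nonneg)
      then show ?thesis by auto
    qed
    have "(\<integral>\<^sup>+y1. w1 y1 * w2 y2 * indicator {(y1, y2). (p1 y1)\<^sup>2 + \<kappa> * (p2 y2)\<^sup>2 < 1} (y1, y2) \<partial>lborel) =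
      (\<integral>\<^sup>+y1. w2 y2 * (w1 y1 * indicator {y. p1 y < ?r} y1) \<partial>lborel)"
      by (intro nn_integral_cong) (simp add: indicator_def iff mult_ac)
    also have "\<dots> = w2 y2 * (\<integral>\<^sup>+y1. w1 y1 * indicator {y. p1 y < ?r} y1 \<partial>lborel)"
      by (rule nn_integral_cmult) measurable
    finally show ?thesis using True by (simp add: scale[OF r] mult_ac)
  next
    case False
    then have "1 \<le> (sqrt \<kappa> * p2 y2)\<^sup>2" by simp
    then have "1 \<le> \<kappa> * (p2 y2)\<^sup>2" using \<open>\<kappa> > 0\<close> by (simp add: power_mult_distrib)
    then have "\<not> (p1 y1)\<^sup>2 + \<kappa> * (p2 y2)\<^sup>2 < 1" for y1
      by (simp add: not_less add_increasing)
    then show ?thesis using False by simp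
  qed
  moreover have "(\<integral>\<^sup>+y1. \<integral>\<^sup>+y2. w1 y1 * w2 y2 * indicator {(y1, y2). (p1 y1)\<^sup>2 + \<kappa> * (p2 y2)\<^sup>2 < 1} (y1, y2) \<partial>lborel \<partial>lborel) =
    (\<integral>\<^sup>+y2. \<integral>\<^sup>+y1. w1 y1 * w2 y2 * indicator {(y1, y2). (p1 y1)\<^sup>2 + \<kappa> * (p2 y2)\<^sup>2 < 1} (y1, y2) \<partial>lborel \<partial>lborel)"
    by (rule lborel_pair.Fubini'[symmetric]) (simp add: split_beta')
  ultimately show ?thesis by (simp add: nn_integral_cmult)
qed

text \<open>The constant is found by comparing the two orders of integration with the second weight replaced
  by the Euclidean one.\<close>

lemma homogeneous_weight_product:
  assumes "\<kappa> > 0"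
  obtains C where "\<And>(w1 :: 'a::euclidean_space \<Rightarrow> ennreal) p1 (w2 :: 'b::euclidean_space \<Rightarrow> ennreal) p2.
    homogeneous_weight w1 p1 \<Longrightarrow> homogeneous_weight w2 p2 \<Longrightarrow>
    (\<integral>\<^sup>+y1. \<integral>\<^sup>+y2. w1 y1 * w2 y2 * indicator {(y1, y2). (p1 y1)\<^sup>2 + \<kappa> * (p2 y2)\<^sup>2 < 1} (y1, y2) \<partial>lborel \<partial>lborel) =
    C * ((\<integral>\<^sup>+y1. w1 y1 * indicator {y. p1 y < 1} y1 \<partial>lborel) *
         (\<integral>\<^sup>+y2. w2 y2 * indicator {y. p2 y < 1} y2 \<partial>lborel))"
proof -
  define J where "J = (\<integral>\<^sup>+y. (if sqrt \<kappa> * norm (y :: 'b) < 1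
    then ennreal (sqrt (1 - \<kappa> * (norm y)\<^sup>2) ^ DIM('a)) else 0) \<partial>lborel)"
  define B where "B = emeasure lborel (ball (0 :: 'b) 1)"
  have ref: "homogeneous_weight (\<lambda>_. 1) (norm :: 'b \<Rightarrow> real)"
    by (rule homogeneous_weightI) auto
  have "{y. norm y < 1} = ball (0 :: 'b) 1" by auto
  then have ref_mass: "(\<integral>\<^sup>+y. 1 * indicator {y. norm y < 1} (y :: 'b) \<partial>lborel) = B"
    by (simp add: B_def)
  \<comment> \<open>Positive and finite, so that division by \<open>B\<close> can be undone in
    \<open>ennreal\<close>.\<close>
  have B: "B \<noteq> 0" "B \<noteq> top"
    by (simp_all add: B_def emeasure_ball unit_ball_vol_pos ennreal_eq_0_iff not_le)
  show ?thesis
  proof (rule that[of "J / B"])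
    fix w1 :: "'a \<Rightarrow> ennreal" and p1 and w2 :: "'b \<Rightarrow> ennreal" and p2
    assume w: "homogeneous_weight w1 p1" "homogeneous_weight w2 p2"
    define I where "I = (\<integral>\<^sup>+y1. w1 y1 * (if p1 y1 < 1
      then ennreal (sqrt ((1 - (p1 y1)\<^sup>2) / \<kappa>) ^ DIM('b)) else 0) \<partial>lborel)"
    define W1 where "W1 = (\<integral>\<^sup>+y1. w1 y1 * indicator {y. p1 y < 1} y1 \<partial>lborel)"
    \<comment> \<open>Both sides are the integral for \<open>w1\<close> and the Euclidean weight,
      computed in the two orders. Hence \<open>I\<close> depends on the first weight only through
      \<open>W1\<close>, and \<open>J\<close> and \<open>B\<close> do not depend on the given
      weights at all.\<close>
    have "I * B = W1 * J"
      using homogeneous_weight_integrate_right[OF assms w(1) ref]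
        homogeneous_weight_integrate_left[OF assms w(1) ref]
      unfolding ref_mass I_def[symmetric] W1_def[symmetric] by (simp add: J_def)
    then have "I = J / B * W1"
      using B by (metis ennreal_mult_divide_eq ennreal_times_divide mult.commute)
    then show "(\<integral>\<^sup>+y1. \<integral>\<^sup>+y2. w1 y1 * w2 y2 * indicator {(y1, y2). (p1 y1)\<^sup>2 + \<kappa> * (p2 y2)\<^sup>2 < 1} (y1, y2) \<partial>lborel \<partial>lborel) =
      J / B * ((\<integral>\<^sup>+y1. w1 y1 * indicator {y. p1 y < 1} y1 \<partial>lborel) *
         (\<integral>\<^sup>+y2. w2 y2 * indicator {y. p2 y < 1} y2 \<partial>lborel))"
      using homogeneous_weight_integrate_right[OF assms w]
      unfolding I_def[symmetric] W1_def[symmetric] by (simp add: mult.assoc)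
  qed
qed

section \<open>Product volume measures\<close>

lemma emeasure_density_indicator:
  assumes "A \<in> sets M" "S \<in> sets M"
  shows "emeasure (density M (indicator A)) S = emeasure M (S \<inter> A)"
proof -
  have "emeasure (density M (indicator A)) S = (\<integral>\<^sup>+x. indicator A x * indicator S x \<partial>M)"
    using assms by (intro emeasure_density borel_measurable_indicator)
  also have "\<dots> = (\<integral>\<^sup>+x. indicator (S \<inter> A) x \<partial>M)"
    by (simp add: indicator_inter_arith mult.commute)
  finally show ?thesis using assms by (simp add: sets.Int)
qed

context manifold
begin

text \<open>\<^term>\<open>cinv A c\<close> is arbitrary, hence possibly not measurable, outside of the image of the chart.\<close>

definition cinv_total :: "'c \<Rightarrow> real^'n \<Rightarrow> 'm" where
  "cinv_total c x = (if x \<in> cimage A c then cinv A c x else undefined)"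

lemma cinv_total_measurable [measurable]: "cinv_total c \<in> borel_measurable borel"
proof -
  have "continuous_on (cimage A c) (cinv A c)"
    using homeomorphism_chart homeomorphism_cont2 by blast
  then have "cinv A c \<in> borel_measurable (restrict_space borel (cimage A c))"
    by (rule borel_measurable_continuous_on_restrict)
  then show ?thesis
    unfolding cinv_total_def
    by (subst measurable_If_restrict_space_iff) (auto intro: borel_open open_cimage)
qed

lemma coord_image_iff:
  assumes "S \<subseteq> cdom A c"
  shows "x \<in> coord A c ` S \<longleftrightarrow> x \<in> cimage A c \<and> cinv_total c x \<in> S"
proof
  assume "x \<in> coord A c ` S"
  then show "x \<in> cimage A c \<and> cinv_total c x \<in> S"
    using assms by (auto simp: cinv_total_def cinv_coord coord_in_cimage subset_iff)
next
  assume "x \<in> cimage A c \<and> cinv_total c x \<in> S"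
  then show "x \<in> coord A c ` S"
    by (intro image_eqI[of _ _ "cinv A c x"]) (auto simp: cinv_total_def coord_cinv)
qed

text \<open>Restriction to the chart domain is written as a density, and the coordinate density is
  transported by the inverse chart. In this form the rules for products of densities and of image
  measures apply. The indicator removes the values of \<open>\<sigma>\<close> outside the chart
  image.\<close>

lemma volume_measure_density_eq_distr:
  assumes vol: "volume_measure A \<sigma> \<mu>"
    and [measurable]: "(\<lambda>x. ennreal (\<sigma> c x) * indicator (cimage A c) x) \<in> borel_measurable borel"
  shows "density \<mu> (indicator (cdom A c)) =
    distr (density lborel (\<lambda>x. ennreal (\<sigma> c x) * indicator (cimage A c) x)) borel (cinv_total c)"
    (is "_ = distr ?D _ _")
proof (rule measure_eqI)
  have sets: "sets \<mu> = sets borel" using vol by (simp add: volume_measure_def)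
  then show "sets (density \<mu> (indicator (cdom A c))) = sets (distr ?D borel (cinv_total c))" by simp
  fix S assume "S \<in> sets (density \<mu> (indicator (cdom A c)))"
  then have S [measurable]: "S \<in> sets borel" and S\<mu>: "S \<in> sets \<mu>" using sets by simp_all
  have cdom [measurable]: "cdom A c \<in> sets borel" and cdom\<mu>: "cdom A c \<in> sets \<mu>"
    using open_cdom by (simp_all add: sets)
  have "emeasure (density \<mu> (indicator (cdom A c))) S = emeasure \<mu> (S \<inter> cdom A c)"
    using S\<mu> cdom\<mu> by (intro emeasure_density_indicator)
  also have "\<dots> = (\<integral>\<^sup>+x\<in>coord A c ` (S \<inter> cdom A c). ennreal (\<sigma> c x) \<partial>lborel)"
    using vol S cdom unfolding volume_measure_def by auto
  also have "\<dots> = (\<integral>\<^sup>+x. ennreal (\<sigma> c x) * indicator (cimage A c) x * indicator (cinv_total c -` S) x \<partial>lborel)"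
    by (intro nn_integral_cong)
      (auto simp: indicator_def coord_image_iff cinv_total_def cinv_in_cdom)
  also have "\<dots> = emeasure ?D (cinv_total c -` S)"
    using measurable_sets[OF cinv_total_measurable S] by (subst emeasure_density) simp_all
  also have "\<dots> = emeasure (distr ?D borel (cinv_total c)) S"
    by (subst emeasure_distr) simp_all
  finally show "emeasure (density \<mu> (indicator (cdom A c))) S = \<dots>" .
qed

end

lemma sigma_finite_measureI_finite: "emeasure M (space M) < \<infinity> \<Longrightarrow> sigma_finite_measure M"
  by (intro finite_measure.axioms(1) finite_measureI) auto

text \<open>Inside a product chart both restricted measures are images of densities, so their
  product is the image of the product density. Finite total mass provides sigma-finiteness.
  Nonnegativity of the densities and of \<open>C\<close> matters because \<open>ennreal\<close>
  sends negative numbers to 0, which would break multiplicativity.\<close>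

lemma (in manifold_pair) product_volume_measure:
  assumes vol1: "volume_measure A1 \<sigma>1 \<mu>1" and fin1: "emeasure \<mu>1 UNIV < \<infinity>"
    and vol2: "volume_measure A2 \<sigma>2 \<mu>2" and fin2: "emeasure \<mu>2 UNIV < \<infinity>"
    and m1: "\<And>c. (\<lambda>x. ennreal (\<sigma>1 c x) * indicator (cimage A1 c) x) \<in> borel_measurable borel"
    and m2: "\<And>c. (\<lambda>x. ennreal (\<sigma>2 c x) * indicator (cimage A2 c) x) \<in> borel_measurable borel"
    and nonneg1: "\<And>c x. x \<in> cimage A1 c \<Longrightarrow> 0 \<le> \<sigma>1 c x"
    and nonneg2: "\<And>c x. x \<in> cimage A2 c \<Longrightarrow> 0 \<le> \<sigma>2 c x"
    and C: "0 \<le> C"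
    and \<sigma>: "\<And>c x. x \<in> cimage P c \<Longrightarrow> \<sigma> c x = C * (\<sigma>1 (fst c) (left_vec x) * \<sigma>2 (snd c) (right_vec x))"
  shows "volume_measure P \<sigma> (scale_measure (ennreal C) (\<mu>1 \<Otimes>\<^sub>M \<mu>2))"
    and "emeasure (scale_measure (ennreal C) (\<mu>1 \<Otimes>\<^sub>M \<mu>2)) UNIV < \<infinity>"
proof -
  have sets1: "sets \<mu>1 = sets borel" and sets2: "sets \<mu>2 = sets borel"
    using vol1 vol2 by (simp_all add: volume_measure_def)
  have space: "space \<mu>1 = UNIV" "space \<mu>2 = UNIV"
    using sets_eq_imp_space_eq[OF sets1] sets_eq_imp_space_eq[OF sets2] by simp_all
  have sets: "sets (\<mu>1 \<Otimes>\<^sub>M \<mu>2) = sets borel"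
    using sets_pair_measure_cong[OF sets1 sets2] by (simp only: borel_prod)
  have sf1: "sigma_finite_measure \<mu>1" and sf2: "sigma_finite_measure \<mu>2"
    using fin1 fin2 space by (simp_all add: sigma_finite_measureI_finite)
  interpret M2: sigma_finite_measure \<mu>2 by (rule sf2)
  have "emeasure (\<mu>1 \<Otimes>\<^sub>M \<mu>2) (UNIV \<times> UNIV) = emeasure \<mu>1 UNIV * emeasure \<mu>2 UNIV"
    using sets1 sets2 by (intro M2.emeasure_pair_measure_Times) simp_all
  then show "emeasure (scale_measure (ennreal C) (\<mu>1 \<Otimes>\<^sub>M \<mu>2)) UNIV < \<infinity>"
    using fin1 fin2 by (simp add: ennreal_mult_less_top)
  show "volume_measure P \<sigma> (scale_measure (ennreal C) (\<mu>1 \<Otimes>\<^sub>M \<mu>2))"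
    unfolding volume_measure_def
  proof (intro conjI allI ballI impI)
    show "sets (scale_measure (ennreal C) (\<mu>1 \<Otimes>\<^sub>M \<mu>2)) = sets borel" using sets by simp
    fix c and S :: "('m1 \<times> 'm2) set"
    assume S: "S \<in> sets borel" and S_sub: "S \<subseteq> cdom P c"
    obtain c1 c2 where c: "c = (c1, c2)" by fastforce
    define \<rho>1 where "\<rho>1 = (\<lambda>x. ennreal (\<sigma>1 c1 x) * indicator (cimage A1 c1) x)"
    define \<rho>2 where "\<rho>2 = (\<lambda>x. ennreal (\<sigma>2 c2 x) * indicator (cimage A2 c2) x)"
    have [measurable]: "\<rho>1 \<in> borel_measurable borel" "\<rho>2 \<in> borel_measurable borel"
      unfolding \<rho>1_def \<rho>2_def by (rule m1 m2)+
    define R1 where "R1 = density lborel \<rho>1"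
    define R2 where "R2 = density lborel \<rho>2"
    define T where "T = (\<lambda>(x1, x2). (M1.cinv_total c1 x1, M2.cinv_total c2 x2))"
    have T: "T \<in> borel \<Otimes>\<^sub>M borel \<rightarrow>\<^sub>M borel \<Otimes>\<^sub>M borel" unfolding T_def by measurable
    have S' [measurable]: "S \<in> sets (borel \<Otimes>\<^sub>M borel)" using S by (simp only: borel_prod)
    have TS: "T -` S \<in> sets (borel \<Otimes>\<^sub>M borel)"
      using measurable_sets[OF T S'] by (simp add: space_pair_measure)
    have d1: "density \<mu>1 (indicator (cdom A1 c1)) = distr R1 borel (M1.cinv_total c1)"
      unfolding R1_def \<rho>1_def by (rule M1.volume_measure_density_eq_distr[OF vol1 m1])
    have d2: "density \<mu>2 (indicator (cdom A2 c2)) = distr R2 borel (M2.cinv_total c2)"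
      unfolding R2_def \<rho>2_def by (rule M2.volume_measure_density_eq_distr[OF vol2 m2])
    have dom: "cdom A1 c1 \<in> sets \<mu>1" "cdom A2 c2 \<in> sets \<mu>2"
      using M1.open_cdom M2.open_cdom by (simp_all add: sets1 sets2)
    \<comment> \<open>The restriction of a finite measure is finite; sigma-finiteness then holds for
      the image measure and is pulled back to \<open>R2\<close>.\<close>
    have "emeasure (density \<mu>2 (indicator (cdom A2 c2))) UNIV = emeasure \<mu>2 (cdom A2 c2)"
      using emeasure_density_indicator[OF dom(2), of UNIV] by (simp add: sets2)
    also have "\<dots> \<le> emeasure \<mu>2 UNIV" by (rule emeasure_mono) (simp_all add: sets2)
    finally have fin: "emeasure (density \<mu>2 (indicator (cdom A2 c2))) UNIV < \<infinity>"
      using fin2 by (rule le_less_trans)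
    then have sfd: "sigma_finite_measure (density \<mu>2 (indicator (cdom A2 c2)))"
      using space by (intro sigma_finite_measureI_finite) simp
    then have sfr: "sigma_finite_measure (distr R2 borel (M2.cinv_total c2))" by (simp add: d2)
    have sfR2: "sigma_finite_measure R2"
      by (rule sigma_finite_measure_distr[OF sfr]) (simp add: R2_def)
    \<comment> \<open>The coordinate density of the claimed measure on \<open>S\<close>. Outside the
      chart image it vanishes through \<open>\<rho>1\<close> or \<open>\<rho>2\<close>, where the
      values of \<open>T\<close> carry no meaning.\<close>
    define G where "G z = ennreal C * (\<rho>1 (left_vec z) * \<rho>2 (right_vec z) * indicator (T -` S) (left_vec z, right_vec z))"
      for z :: "real^('n1 + 'n2)"
    have ind [measurable]: "indicator (T -` S) \<in> borel_measurable (borel \<Otimes>\<^sub>M borel)"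
      using TS by (rule borel_measurable_indicator)
    have G [measurable]: "G \<in> borel_measurable borel"
    proof -
      have "(\<lambda>z. indicator (T -` S) (left_vec z, right_vec z) :: ennreal) \<in> borel_measurable borel"
        by (rule measurable_compose[OF _ ind]) measurable
      moreover have "(\<lambda>z. ennreal C * (\<rho>1 (left_vec z) * \<rho>2 (right_vec z))) \<in> borel_measurable borel"
        by measurable
      ultimately show ?thesis unfolding G_def mult.assoc[symmetric] by (rule borel_measurable_times_ennreal[rotated])
    qed
    \<comment> \<open>As \<open>S\<close> lies in the chart domain, restricting both measures to
      their chart domains does not change its mass.\<close>
    have "emeasure (\<mu>1 \<Otimes>\<^sub>M \<mu>2) S = emeasure (density (\<mu>1 \<Otimes>\<^sub>M \<mu>2)
        (\<lambda>(p1, p2). indicator (cdom A1 c1) p1 * indicator (cdom A2 c2) p2)) S"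
    proof -
      have "(\<lambda>(p1, p2). indicator (cdom A1 c1) p1 * indicator (cdom A2 c2) p2 :: ennreal) =
          indicator (cdom A1 c1 \<times> cdom A2 c2)" by (auto simp: indicator_def)
      moreover have "cdom A1 c1 \<times> cdom A2 c2 \<in> sets (\<mu>1 \<Otimes>\<^sub>M \<mu>2)" using dom by (rule pair_measureI)
      moreover have "S \<inter> (cdom A1 c1 \<times> cdom A2 c2) = S" using S_sub c by auto
      ultimately show ?thesis
        using emeasure_density_indicator[of "cdom A1 c1 \<times> cdom A2 c2" "\<mu>1 \<Otimes>\<^sub>M \<mu>2" S] S sets by presburger
    qed
    also have "\<dots> = emeasure (density \<mu>1 (indicator (cdom A1 c1)) \<Otimes>\<^sub>M density \<mu>2 (indicator (cdom A2 c2))) S"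
      using dom sf2 sfd by (subst pair_measure_density) auto
    also have "\<dots> = emeasure (distr (R1 \<Otimes>\<^sub>M R2) (borel \<Otimes>\<^sub>M borel) T) S"
      unfolding d1 d2 T_def by (subst pair_measure_distr[OF _ _ sfr]) (simp_all add: R1_def R2_def)
    also have "\<dots> = emeasure (R1 \<Otimes>\<^sub>M R2) (T -` S)"
    proof (subst emeasure_distr)
      have "sets (R1 \<Otimes>\<^sub>M R2) = sets (borel \<Otimes>\<^sub>M borel)"
        by (intro sets_pair_measure_cong) (simp_all add: R1_def R2_def)
      then show "T \<in> R1 \<Otimes>\<^sub>M R2 \<rightarrow>\<^sub>M borel \<Otimes>\<^sub>M borel"
        using T measurable_cong_sets by blast
      show "emeasure (R1 \<Otimes>\<^sub>M R2) (T -` S \<inter> space (R1 \<Otimes>\<^sub>M R2)) = emeasure (R1 \<Otimes>\<^sub>M R2) (T -` S)"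
        by (simp add: space_pair_measure R1_def R2_def)
    qed (rule S')
    also have "R1 \<Otimes>\<^sub>M R2 = density (lborel \<Otimes>\<^sub>M lborel) (\<lambda>(x1, x2). \<rho>1 x1 * \<rho>2 x2)"
      using sfR2 unfolding R1_def R2_def by (intro pair_measure_density sigma_finite_lborel) simp_all
    also have "emeasure \<dots> (T -` S) = (\<integral>\<^sup>+p. (case p of (x1, x2) \<Rightarrow> \<rho>1 x1 * \<rho>2 x2) * indicator (T -` S) p \<partial>(lborel \<Otimes>\<^sub>M lborel))"
    proof (rule emeasure_density)
      show "T -` S \<in> sets (lborel \<Otimes>\<^sub>M lborel)"
        using TS sets_pair_measure_cong[of lborel borel lborel borel] by simp
    qed measurable
    finally have prod: "emeasure (\<mu>1 \<Otimes>\<^sub>M \<mu>2) S = \<dots>" .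
    have ind' [measurable]: "indicator (T -` S) \<in> borel_measurable (lborel \<Otimes>\<^sub>M lborel)"
      using ind by (simp cong: measurable_cong_sets sets_pair_measure_cong)
    have "(\<integral>\<^sup>+x\<in>coord P c ` S. ennreal (\<sigma> c x) \<partial>lborel) = (\<integral>\<^sup>+z. G z \<partial>lborel)"
    proof (intro nn_integral_cong)
      fix x :: "real^('n1 + 'n2)"
      have iff: "x \<in> coord P c ` S \<longleftrightarrow> x \<in> cimage P c \<and> (left_vec x, right_vec x) \<in> T -` S"
        using MP.coord_image_iff[OF S_sub, of x]
        by (auto simp: T_def MP.cinv_total_def M1.cinv_total_def M2.cinv_total_def c cinv_product cimage_product)
      show "ennreal (\<sigma> c x) * indicator (coord P c ` S) x = G x"
      proof (cases "x \<in> cimage P c")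
        case True
        then have "left_vec x \<in> cimage A1 c1" "right_vec x \<in> cimage A2 c2"
          by (simp_all add: c cimage_product)
        then show ?thesis
          using True C nonneg1[of "left_vec x" c1] nonneg2[of "right_vec x" c2]
          by (simp add: G_def \<sigma> c \<rho>1_def \<rho>2_def ennreal_mult indicator_def iff[unfolded c])
      next
        case False
        then have "left_vec x \<notin> cimage A1 c1 \<or> right_vec x \<notin> cimage A2 c2"
          by (simp add: c cimage_product)
        then show ?thesis using False by (auto simp: G_def \<rho>1_def \<rho>2_def iff)
      qed
    qed
    also have "\<dots> = (\<integral>\<^sup>+p. G (case p of (x, y) \<Rightarrow> join_vec x y) \<partial>(lborel \<Otimes>\<^sub>M lborel))"
      by (subst lborel_join_vec[symmetric], subst nn_integral_distr) simp_all
    also have "\<dots> = (\<integral>\<^sup>+p. ennreal C * ((case p of (x1, x2) \<Rightarrow> \<rho>1 x1 * \<rho>2 x2) * indicator (T -` S) p) \<partial>(lborel \<Otimes>\<^sub>M lborel))"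
      by (intro nn_integral_cong) (simp add: G_def split_beta)
    also have "\<dots> = ennreal C * emeasure (\<mu>1 \<Otimes>\<^sub>M \<mu>2) S"
      unfolding prod by (rule nn_integral_cmult) measurable
    finally show "emeasure (scale_measure (ennreal C) (\<mu>1 \<Otimes>\<^sub>M \<mu>2)) S =
      (\<integral>\<^sup>+x\<in>coord P c ` S. ennreal (\<sigma> c x) \<partial>lborel)" by simp
  qed
qed

section \<open>Volume densities\<close>

text \<open>\<open>S\<close> is the set of admissible velocities, all nonzero vectors for a factor
  and \<open>product_slit\<close> for the product, so that one definition covers both.\<close>

fun patch_density :: "volume_form \<Rightarrow> (real^'n) set \<Rightarrow> (real^'n \<Rightarrow> real^'n \<Rightarrow> real) \<Rightarrow> real^'n::finite \<Rightarrow> real" where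
  "patch_density Holmes_Thompson S L x =
     1 / measure lborel (ball (0::real^'n) 1) * (LBINT y:{y \<in> S. L x y < 1}. det (metric_tensor L x y))"
| "patch_density Maximum S L x =
     (GREATEST s. s \<in> (\<lambda>y. sqrt (det (metric_tensor L x y))) ` {y \<in> S. L x y = 1})"
| "patch_density Minimum S L x =
     (LEAST s. s \<in> (\<lambda>y. sqrt (det (metric_tensor L x y))) ` {y \<in> S. L x y = 1})"

lemma volume_density_eq_patch_density:
  assumes "local_set A D c = cimage A c \<times> S" "x \<in> cimage A c"
  shows "volume_density V A D F c x = patch_density V S (local_rep A F c) x"
  using assms by (cases V) (simp_all add: indicatrix_def fundamental_tensor_eq)

section \<open>Densities of a single metric\<close>

context finsler_patch
begin

text \<open>By homogeneity of degree 0 these values are also those over the indicatrix and over the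
  Euclidean unit sphere. Admitting all nonzero velocities removes the constraint
  \<open>L x y = 1\<close>.\<close>

definition root_dets :: "real^'n \<Rightarrow> real set" where
  "root_dets x = (\<lambda>y. sqrt (det (metric_tensor L x y))) ` (- {0})"

lemma scaled_eq_1: "x \<in> U \<Longrightarrow> y \<noteq> 0 \<Longrightarrow> L x (inverse (L x y) *\<^sub>R y) = 1"
  using pos[of x y] homogeneous[of x "inverse (L x y)" y] by simp

lemma indicatrix_root_dets:
  assumes "x \<in> U"
  shows "(\<lambda>y. sqrt (det (metric_tensor L x y))) ` {y \<in> - {0}. L x y = 1} = root_dets x"
proof (intro equalityI subsetI)
  fix s assume "s \<in> root_dets x"
  then obtain y where y: "y \<noteq> 0" "s = sqrt (det (metric_tensor L x y))" by (auto simp: root_dets_def)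
  then show "s \<in> (\<lambda>y. sqrt (det (metric_tensor L x y))) ` {y \<in> - {0}. L x y = 1}"
    using assms pos[OF assms y(1)] scaled_eq_1[OF assms y(1)]
      metric_tensor_homogeneous[OF assms y(1), of "inverse (L x y)"]
    by (intro image_eqI[of _ _ "inverse (L x y) *\<^sub>R y"]) auto
qed (auto simp: root_dets_def)

lemma continuous_det_right: "x \<in> U \<Longrightarrow> continuous_on (- {0}) (\<lambda>y. det (metric_tensor L x y))"
  by (rule continuous_on_compose2[OF det_continuous, of _ "\<lambda>y. (x, y)", simplified])
     (auto intro!: continuous_intros)

lemma continuous_det_left: "y \<noteq> 0 \<Longrightarrow> continuous_on U (\<lambda>x. det (metric_tensor L x y))"
  by (rule continuous_on_compose2[OF det_continuous, of _ "\<lambda>x. (x, y)", simplified])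
     (auto intro!: continuous_intros)

lemma continuous_right: "x \<in> U \<Longrightarrow> continuous_on UNIV (L x)"
  by (rule continuous_on_compose2[OF continuous, of _ "\<lambda>y. (x, y)", simplified])
     (auto intro!: continuous_intros)

text \<open>The Euclidean sphere is compact, so the extrema are attained and \<open>GREATEST\<close>
  and \<open>LEAST\<close> in the densities denote actual values.\<close>

lemma compact_root_dets:
  assumes "x \<in> U"
  shows "compact (root_dets x)" "root_dets x \<noteq> {}"
proof -
  have "root_dets x = (\<lambda>y. sqrt (det (metric_tensor L x y))) ` sphere 0 1"
  proof (intro equalityI subsetI)
    fix s assume "s \<in> root_dets x"
    then obtain y where y: "y \<noteq> 0" "s = sqrt (det (metric_tensor L x y))" by (auto simp: root_dets_def)
    then show "s \<in> (\<lambda>y. sqrt (det (metric_tensor L x y))) ` sphere 0 1"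
      using metric_tensor_homogeneous[OF assms y(1), of "inverse (norm y)"]
      by (intro image_eqI[of _ _ "inverse (norm y) *\<^sub>R y"]) auto
  qed (auto simp: root_dets_def)
  moreover have "continuous_on (sphere 0 1) (\<lambda>y. sqrt (det (metric_tensor L x y)))"
    by (intro continuous_intros continuous_on_subset[OF continuous_det_right[OF assms]]) auto
  ultimately show "compact (root_dets x)"
    by (metis compact_continuous_image compact_sphere)
  have "axis undefined 1 \<in> - {0 :: real^'n}" by (simp add: axis_eq_0_iff)
  then show "root_dets x \<noteq> {}" by (auto simp: root_dets_def)
qed

lemma root_dets_nonneg: "x \<in> U \<Longrightarrow> s \<in> root_dets x \<Longrightarrow> 0 \<le> s"
  using det_pos by (fastforce simp: root_dets_def)

lemma patch_density_Maximum:
  assumes "x \<in> U"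
  shows "patch_density Maximum (- {0}) L x \<in> root_dets x"
    and "s \<in> root_dets x \<Longrightarrow> s \<le> patch_density Maximum (- {0}) L x"
proof -
  obtain m where m: "m \<in> root_dets x" "\<And>s. s \<in> root_dets x \<Longrightarrow> s \<le> m"
    using compact_attains_sup[OF compact_root_dets[OF assms]] by blast
  have "patch_density Maximum (- {0}) L x = m"
    unfolding patch_density.simps indicatrix_root_dets[OF assms] using m by (intro Greatest_equality)
  with m show "patch_density Maximum (- {0}) L x \<in> root_dets x"
    and "s \<in> root_dets x \<Longrightarrow> s \<le> patch_density Maximum (- {0}) L x" by simp_all
qed

lemma patch_density_Minimum:
  assumes "x \<in> U"
  shows "patch_density Minimum (- {0}) L x \<in> root_dets x"
    and "s \<in> root_dets x \<Longrightarrow> patch_density Minimum (- {0}) L x \<le> s"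
proof -
  obtain m where m: "m \<in> root_dets x" "\<And>s. s \<in> root_dets x \<Longrightarrow> m \<le> s"
    using compact_attains_inf[OF compact_root_dets[OF assms]] by blast
  have "patch_density Minimum (- {0}) L x = m"
    unfolding patch_density.simps indicatrix_root_dets[OF assms] using m by (intro Least_equality)
  with m show "patch_density Minimum (- {0}) L x \<in> root_dets x"
    and "s \<in> root_dets x \<Longrightarrow> patch_density Minimum (- {0}) L x \<le> s" by simp_all
qed

text \<open>The determinant is controlled only off the zero vector. Setting the value there to 0
  makes the weight measurable and homogeneous on the whole space.\<close>

definition weight :: "real^'n \<Rightarrow> real^'n \<Rightarrow> ennreal" where
  "weight x y = ennreal (indicator (- {0}) y *\<^sub>R det (metric_tensor L x y))"

lemma weight_measurable: "x \<in> U \<Longrightarrow> weight x \<in> borel_measurable borel"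
  unfolding weight_def
  by (intro measurable_compose[OF _ measurable_ennreal] borel_measurable_continuous_on_indicator continuous_det_right) auto

lemma measurable_right: "x \<in> U \<Longrightarrow> L x \<in> borel_measurable borel"
  by (intro borel_measurable_continuous_onI continuous_right)

lemma weight_homogeneous: "x \<in> U \<Longrightarrow> homogeneous_weight (weight x) (L x)"
  using metric_tensor_homogeneous
  by (intro homogeneous_weightI weight_measurable measurable_right nonneg homogeneous)
     (auto simp: weight_def indicator_def)

abbreviation ball_mass :: "real^'n \<Rightarrow> ennreal" where
  "ball_mass x \<equiv> \<integral>\<^sup>+y. weight x y * indicator {y. L x y < 1} y \<partial>lborel"

text \<open>For a nonnegative measurable integrand the real integral is \<open>enn2real\<close> of
  the extended one, also in the infinite case, where both are 0.\<close>

lemma patch_density_Holmes_Thompson: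
  assumes "x \<in> U"
  shows "patch_density Holmes_Thompson (- {0}) L x =
    1 / measure lborel (ball (0::real^'n) 1) * enn2real (ball_mass x)"
proof -
  let ?B = "{y \<in> - {0}. L x y < 1}"
  have "open (- {0} \<inter> L x -` {..<1})"
    using continuous_open_preimage[OF continuous_right[OF assms], of "{..<1}"] by (intro open_Int) auto
  moreover have "- {0} \<inter> L x -` {..<1} = ?B" by auto
  ultimately have "open ?B" by simp
  then have meas: "(\<lambda>y. indicator ?B y *\<^sub>R det (metric_tensor L x y)) \<in> borel_measurable borel"
    by (intro borel_measurable_continuous_on_indicator continuous_on_subset[OF continuous_det_right[OF assms]]) auto
  have "(LBINT y:?B. det (metric_tensor L x y)) =
      enn2real (\<integral>\<^sup>+y. ennreal (indicator ?B y *\<^sub>R det (metric_tensor L x y)) \<partial>lborel)"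
    unfolding set_lebesgue_integral_def
    using meas det_pos[OF assms] by (intro integral_eq_nn_integral) (auto simp: indicator_def less_imp_le)
  also have "(\<integral>\<^sup>+y. ennreal (indicator ?B y *\<^sub>R det (metric_tensor L x y)) \<partial>lborel) = ball_mass x"
    by (intro nn_integral_cong) (auto simp: weight_def indicator_def)
  finally show ?thesis by simp
qed

text \<open>The integrand is continuous on an open set of pairs of position and velocity and 0
  elsewhere, hence jointly measurable; integrating out the velocity keeps measurability in the
  position.\<close>

lemma ball_mass_measurable: "(\<lambda>x. ball_mass x * indicator U x) \<in> borel_measurable borel"
proof -
  let ?Q = "{p \<in> \<Omega>. (case p of (x, y) \<Rightarrow> L x y) < 1}"
  have "continuous_on \<Omega> (\<lambda>(x, y). L x y)"
    by (rule continuous_on_subset[OF continuous]) auto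
  then have "open (\<Omega> \<inter> (\<lambda>(x, y). L x y) -` {..<1})"
    by (rule continuous_open_preimage[OF _ open_slit]) simp
  moreover have "\<Omega> \<inter> (\<lambda>(x, y). L x y) -` {..<1} = ?Q" by auto
  ultimately have "open ?Q" by simp
  then have "(\<lambda>p. indicator ?Q p *\<^sub>R det (metric_tensor L (fst p) (snd p))) \<in> borel_measurable borel"
    by (intro borel_measurable_continuous_on_indicator continuous_on_subset[OF det_continuous]) auto
  then have [measurable]: "(\<lambda>p. indicator ?Q p *\<^sub>R det (metric_tensor L (fst p) (snd p))) \<in> borel_measurable (lborel \<Otimes>\<^sub>M lborel)"
    by (simp add: lborel_prod)
  have "(\<lambda>x. \<integral>\<^sup>+y. ennreal (indicator ?Q (x, y) *\<^sub>R det (metric_tensor L (fst (x, y)) (snd (x, y)))) \<partial>lborel) \<in> borel_measurable lborel"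
    by measurable
  moreover have "(\<integral>\<^sup>+y. ennreal (indicator ?Q (x, y) *\<^sub>R det (metric_tensor L (fst (x, y)) (snd (x, y)))) \<partial>lborel) =
      ball_mass x * indicator U x" for x
  proof (cases "x \<in> U")
    case True
    then show ?thesis by (auto simp: weight_def indicator_def intro!: nn_integral_cong)
  qed simp
  ultimately show ?thesis by simp
qed

lemma patch_density_nonneg:
  assumes "x \<in> U"
  shows "0 \<le> patch_density V (- {0}) L x"
proof (cases V)
  case Holmes_Thompson
  then show ?thesis using patch_density_Holmes_Thompson[OF assms] by (simp add: zero_le_divide_iff)
next
  case Maximum
  then show ?thesis using patch_density_Maximum(1)[OF assms] root_dets_nonneg[OF assms] by blast
next
  case Minimum
  then show ?thesis using patch_density_Minimum(1)[OF assms] root_dets_nonneg[OF assms] by blast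
qed

lemma open_root_det:
  assumes "y \<noteq> 0" "open T"
  shows "open {x \<in> U. sqrt (det (metric_tensor L x y)) \<in> T}"
proof -
  have "continuous_on U (\<lambda>x. sqrt (det (metric_tensor L x y)))"
    by (intro continuous_intros continuous_det_left assms)
  from continuous_open_preimage[OF this open_U \<open>open T\<close>]
  show ?thesis by (simp add: vimage_def Collect_conj_eq)
qed

text \<open>The maximum is lower and the minimum is upper semicontinuous, being a supremum and an infimum
  of functions that are continuous in \<open>x\<close>.\<close>

lemma patch_density_measurable:
  "(\<lambda>x. ennreal (patch_density V (- {0}) L x) * indicator U x) \<in> borel_measurable borel"
proof -
  have "(\<lambda>x. if x \<in> U then patch_density V (- {0}) L x else 0) \<in> borel_measurable borel"
  proof (cases V)
    case Holmes_Thompson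
    have "(\<lambda>x. 1 / measure lborel (ball (0::real^'n) 1) * enn2real (ball_mass x * indicator U x)) \<in> borel_measurable borel"
      by (intro borel_measurable_times borel_measurable_const measurable_compose[OF ball_mass_measurable]) simp
    moreover have "1 / measure lborel (ball (0::real^'n) 1) * enn2real (ball_mass x * indicator U x) =
        (if x \<in> U then patch_density V (- {0}) L x else 0)" for x
      using patch_density_Holmes_Thompson[of x] Holmes_Thompson by simp
    ultimately show ?thesis by simp
  next
    case Maximum
    have "{x. a < (if x \<in> U then patch_density V (- {0}) L x else 0)} =
        (\<Union>y\<in>- {0}. {x \<in> U. sqrt (det (metric_tensor L x y)) \<in> {a<..}}) \<union> (if a < 0 then - U else {})" for a
    proof -
      have "a < patch_density V (- {0}) L x \<longleftrightarrow> (\<exists>y\<in>- {0}. sqrt (det (metric_tensor L x y)) \<in> {a<..})"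
        if "x \<in> U" for x
      proof -
        have "a < patch_density V (- {0}) L x \<longleftrightarrow> (\<exists>s\<in>root_dets x. a < s)"
          using patch_density_Maximum[OF that] unfolding Maximum by (meson less_le_trans)
        then show ?thesis by (simp add: root_dets_def)
      qed
      then show ?thesis by (auto split: if_splits)
    qed
    \<comment> \<open>The union runs over uncountably many \<open>y\<close>; it is measurable
      because each member is open.\<close>
    moreover have "open (\<Union>y\<in>- {0}. {x \<in> U. sqrt (det (metric_tensor L x y)) \<in> {a<..}})" for a
      by (intro open_UN ballI open_root_det) auto
    ultimately show ?thesis
      unfolding borel_measurable_iff_greater using open_U by auto
  next
    case Minimum
    have "{x. (if x \<in> U then patch_density V (- {0}) L x else 0) < a} =
        (\<Union>y\<in>- {0}. {x \<in> U. sqrt (det (metric_tensor L x y)) \<in> {..<a}}) \<union> (if 0 < a then - U else {})" for a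
    proof -
      have "patch_density V (- {0}) L x < a \<longleftrightarrow> (\<exists>y\<in>- {0}. sqrt (det (metric_tensor L x y)) \<in> {..<a})"
        if "x \<in> U" for x
      proof -
        have "patch_density V (- {0}) L x < a \<longleftrightarrow> (\<exists>s\<in>root_dets x. s < a)"
          using patch_density_Minimum[OF that] unfolding Minimum by (meson le_less_trans)
        then show ?thesis by (simp add: root_dets_def)
      qed
      then show ?thesis by (auto split: if_splits)
    qed
    moreover have "open (\<Union>y\<in>- {0}. {x \<in> U. sqrt (det (metric_tensor L x y)) \<in> {..<a}})" for a
      by (intro open_UN ballI open_root_det) auto
    ultimately show ?thesis
      unfolding borel_measurable_iff_less using open_U by auto
  qed
  then have "(\<lambda>x. ennreal (if x \<in> U then patch_density V (- {0}) L x else 0)) \<in> borel_measurable borel"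
    by measurable
  moreover have "ennreal (if x \<in> U then patch_density V (- {0}) L x else 0) =
      ennreal (patch_density V (- {0}) L x) * indicator U x" for x by simp
  ultimately show ?thesis by simp
qed

end

section \<open>Densities of the product metric\<close>

context finsler_patch_pair
begin

lemma L_homogeneous:
  assumes "x \<in> U" "r > 0"
  shows "L x (r *\<^sub>R y) = r * L x y"
proof -
  have "L x (r *\<^sub>R y) = sqrt (r\<^sup>2 * ((L1 (left_vec x) (left_vec y))\<^sup>2 + \<kappa> * (L2 (right_vec x) (right_vec y))\<^sup>2))"
    using assms by (simp add: L_eq P1.homogeneous P2.homogeneous power_mult_distrib algebra_simps)
  then show ?thesis using assms by (simp add: L_eq real_sqrt_mult)
qed

lemma L_pos: "x \<in> U \<Longrightarrow> y \<in> product_slit \<Longrightarrow> L x y > 0"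
  using P1.pos[of "left_vec x" "left_vec y"] \<kappa>_pos by (simp add: L_eq add_pos_nonneg)

lemma indicatrix_root_dets_product:
  assumes x: "x \<in> U"
  shows "(\<lambda>y. sqrt (det (metric_tensor L x y))) ` {y \<in> product_slit. L x y = 1} =
    {sqrt (\<kappa> ^ CARD('n2)) * (a * b) | a b. a \<in> P1.root_dets (left_vec x) \<and> b \<in> P2.root_dets (right_vec x)}"
    (is "?l = ?r")
proof (intro equalityI subsetI)
  fix s assume "s \<in> ?l"
  then obtain y where y: "y \<in> product_slit" "s = sqrt (det (metric_tensor L x y))" by blast
  then have "s = sqrt (\<kappa> ^ CARD('n2)) * (sqrt (det (metric_tensor L1 (left_vec x) (left_vec y))) *
      sqrt (det (metric_tensor L2 (right_vec x) (right_vec y))))"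
    by (simp add: det_metric_tensor_product[OF x y(1)] real_sqrt_mult)
  then show "s \<in> ?r" using y(1) unfolding P1.root_dets_def P2.root_dets_def by blast
next
  fix s assume "s \<in> ?r"
  then obtain y1 y2 where y: "y1 \<noteq> 0" "y2 \<noteq> 0" and
    s: "s = sqrt (\<kappa> ^ CARD('n2)) * (sqrt (det (metric_tensor L1 (left_vec x) y1)) *
      sqrt (det (metric_tensor L2 (right_vec x) y2)))"
    unfolding P1.root_dets_def P2.root_dets_def by blast
  let ?y = "join_vec y1 y2"
  have Ly: "L x ?y > 0" using L_pos[OF x, of ?y] y by simp
  \<comment> \<open>Rescaling onto the indicatrix multiplies both components by the same positive
    number, which changes neither determinant.\<close>
  let ?z = "inverse (L x ?y) *\<^sub>R ?y"
  have z: "?z \<in> product_slit" using y Ly by simp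
  have "L x ?z = 1" using L_homogeneous[OF x, of "inverse (L x ?y)" ?y] Ly by simp
  moreover have "s = sqrt (det (metric_tensor L x ?z))"
    using x y Ly P1.metric_tensor_homogeneous[of "left_vec x" y1 "inverse (L x ?y)"]
      P2.metric_tensor_homogeneous[of "right_vec x" y2 "inverse (L x ?y)"]
    by (simp add: s det_metric_tensor_product[OF x z] real_sqrt_mult)
  ultimately show "s \<in> ?l" using z by blast
qed

text \<open>The two factors range over their sets independently and are nonnegative, so the product
  is largest when both of them are.\<close>

lemma patch_density_product_Maximum:
  assumes x: "x \<in> U"
  shows "patch_density Maximum product_slit L x = sqrt (\<kappa> ^ CARD('n2)) *
    (patch_density Maximum (- {0}) L1 (left_vec x) * patch_density Maximum (- {0}) L2 (right_vec x))"
proof -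
  have x1: "left_vec x \<in> U1" and x2: "right_vec x \<in> U2" using x by simp_all
  show ?thesis
    unfolding patch_density.simps(2)[of product_slit] indicatrix_root_dets_product[OF x]
    using P1.patch_density_Maximum[OF x1] P2.patch_density_Maximum[OF x2] \<kappa>_pos
      P1.root_dets_nonneg[OF x1] P2.root_dets_nonneg[OF x2]
    by (intro Greatest_equality) (blast, auto intro!: mult_left_mono mult_mono)
qed

lemma patch_density_product_Minimum:
  assumes x: "x \<in> U"
  shows "patch_density Minimum product_slit L x = sqrt (\<kappa> ^ CARD('n2)) *
    (patch_density Minimum (- {0}) L1 (left_vec x) * patch_density Minimum (- {0}) L2 (right_vec x))"
proof -
  have x1: "left_vec x \<in> U1" and x2: "right_vec x \<in> U2" using x by simp_all
  show ?thesis
    unfolding patch_density.simps(3)[of product_slit] indicatrix_root_dets_product[OF x]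
    using P1.patch_density_Minimum[OF x1] P2.patch_density_Minimum[OF x2] \<kappa>_pos
      P1.root_dets_nonneg[OF x1] P2.root_dets_nonneg[OF x2]
    by (intro Least_equality) (blast, auto intro!: mult_left_mono mult_mono)
qed

text \<open>Prepares the density for \<open>homogeneous_weight_product\<close>; the power of
  \<open>\<kappa>\<close> is what the scaled second block contributes to the determinant.\<close>

lemma patch_density_product_Holmes_Thompson:
  assumes x: "x \<in> U"
  shows "patch_density Holmes_Thompson product_slit L x =
    1 / measure lborel (ball (0::real^('n1 + 'n2)) 1) * (\<kappa> ^ CARD('n2) * enn2real
      (\<integral>\<^sup>+y1. \<integral>\<^sup>+y2. P1.weight (left_vec x) y1 * P2.weight (right_vec x) y2 *
        indicator {(y1, y2). (L1 (left_vec x) y1)\<^sup>2 + \<kappa> * (L2 (right_vec x) y2)\<^sup>2 < 1} (y1, y2) \<partial>lborel \<partial>lborel))"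
proof -
  have x1: "left_vec x \<in> U1" and x2: "right_vec x \<in> U2" using x by simp_all
  let ?B = "{y \<in> product_slit. L x y < 1}"
  have [measurable]: "P1.weight (left_vec x) \<in> borel_measurable borel"
    "P2.weight (right_vec x) \<in> borel_measurable borel" "L1 (left_vec x) \<in> borel_measurable borel"
    "L2 (right_vec x) \<in> borel_measurable borel"
    by (rule P1.weight_measurable[OF x1] P2.weight_measurable[OF x2]
        P1.measurable_right[OF x1] P2.measurable_right[OF x2])+
  have Lx: "L x = (\<lambda>y. sqrt ((L1 (left_vec x) (left_vec y))\<^sup>2 + \<kappa> * (L2 (right_vec x) (right_vec y))\<^sup>2))"
    using x by (intro ext) (simp add: L_eq)
  have [measurable]: "L x \<in> borel_measurable borel" unfolding Lx by measurable
  \<comment> \<open>An integrand that is measurable on the whole space. Through the weights it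
    vanishes where one of the velocity components is zero, so it also accounts for the restriction
    to \<open>product_slit\<close>.\<close>
  define g where "g y = indicator {y. L x y < 1} y * \<kappa> ^ CARD('n2) *
    (enn2real (P1.weight (left_vec x) (left_vec y)) * enn2real (P2.weight (right_vec x) (right_vec y)))"
    for y :: "real^('n1 + 'n2)"
  have [measurable]: "g \<in> borel_measurable borel" unfolding g_def by measurable
  have g_eq: "indicator ?B y *\<^sub>R det (metric_tensor L x y) = g y" for y
    using det_metric_tensor_product[OF x, of y] P1.det_pos[OF x1, of "left_vec y"] P2.det_pos[OF x2, of "right_vec y"]
    by (auto simp: g_def P1.weight_def P2.weight_def indicator_def)
  have fin: "P1.weight (left_vec x) y < top" "P2.weight (right_vec x) z < top" for y z
    by (simp_all add: P1.weight_def P2.weight_def)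
  have ennreal_g: "ennreal (g (join_vec y1 y2)) = ennreal (\<kappa> ^ CARD('n2)) * (P1.weight (left_vec x) y1 * P2.weight (right_vec x) y2 *
        indicator {(y1, y2). (L1 (left_vec x) y1)\<^sup>2 + \<kappa> * (L2 (right_vec x) y2)\<^sup>2 < 1} (y1, y2))" for y1 y2
    using \<kappa>_pos fin by (auto simp: g_def Lx indicator_def ennreal_mult)
  have "(LBINT y:?B. det (metric_tensor L x y)) = enn2real (\<integral>\<^sup>+y. ennreal (g y) \<partial>lborel)"
    unfolding set_lebesgue_integral_def g_eq using \<kappa>_pos
    by (intro integral_eq_nn_integral) (auto simp: g_def)
  also have "(\<integral>\<^sup>+y. ennreal (g y) \<partial>lborel) = (\<integral>\<^sup>+y1. \<integral>\<^sup>+y2. ennreal (g (join_vec y1 y2)) \<partial>lborel \<partial>lborel)"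
    by (rule nn_integral_lborel_join) measurable
  also have "\<dots> = ennreal (\<kappa> ^ CARD('n2)) *
      (\<integral>\<^sup>+y1. \<integral>\<^sup>+y2. P1.weight (left_vec x) y1 * P2.weight (right_vec x) y2 *
        indicator {(y1, y2). (L1 (left_vec x) y1)\<^sup>2 + \<kappa> * (L2 (right_vec x) y2)\<^sup>2 < 1} (y1, y2) \<partial>lborel \<partial>lborel)"
    unfolding ennreal_g by (simp add: nn_integral_cmult split_beta')
  finally show ?thesis using \<kappa>_pos by (simp add: enn2real_mult)
qed

end

text \<open>The constant is quantified before the patches and the point: one number has to serve all
  charts, because a single product measure is scaled by it.\<close>

lemma patch_density_product:
  fixes \<kappa> :: real
  assumes "\<kappa> > 0"
  shows "\<exists>C\<ge>0. \<forall>(U1 :: (real^'n1::finite) set) L1 (U2 :: (real^'n2::finite) set) L2 L x.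
      finsler_patch_pair U1 L1 U2 L2 \<kappa> L \<longrightarrow> left_vec x \<in> U1 \<longrightarrow> right_vec x \<in> U2 \<longrightarrow>
      patch_density V product_slit L x =
        C * (patch_density V (- {0}) L1 (left_vec x) * patch_density V (- {0}) L2 (right_vec x))"
proof (cases V)
  case Holmes_Thompson
  let ?b = "measure lborel (ball (0::real^('n1 + 'n2)) 1)"
  let ?b1 = "measure lborel (ball (0::real^'n1) 1)" and ?b2 = "measure lborel (ball (0::real^'n2) 1)"
  have b: "?b1 > 0" "?b2 > 0" by (simp_all add: content_ball unit_ball_vol_pos)
  obtain C where C: "\<And>(w1 :: real^'n1 \<Rightarrow> ennreal) p1 (w2 :: real^'n2 \<Rightarrow> ennreal) p2.
    homogeneous_weight w1 p1 \<Longrightarrow> homogeneous_weight w2 p2 \<Longrightarrow>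
    (\<integral>\<^sup>+y1. \<integral>\<^sup>+y2. w1 y1 * w2 y2 * indicator {(y1, y2). (p1 y1)\<^sup>2 + \<kappa> * (p2 y2)\<^sup>2 < 1} (y1, y2) \<partial>lborel \<partial>lborel) =
    C * ((\<integral>\<^sup>+y1. w1 y1 * indicator {y. p1 y < 1} y1 \<partial>lborel) *
         (\<integral>\<^sup>+y2. w2 y2 * indicator {y. p2 y < 1} y2 \<partial>lborel))"
    using homogeneous_weight_product[OF assms] by blast
  show ?thesis
  \<comment> \<open>\<open>1 / ?b\<close> normalises the density of the product,
    \<open>?b1 * ?b2\<close> undoes the normalisation of the factors, the power of
    \<open>\<kappa>\<close> comes from the determinant and \<open>C\<close> from the integral over
    the product ball.\<close>
  proof (rule exI[of _ "1 / ?b * (\<kappa> ^ CARD('n2) * (enn2real C * (?b1 * ?b2)))"], intro conjI allI impI)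
    fix U1 :: "(real^'n1) set" and L1 and U2 :: "(real^'n2) set" and L2 L and x :: "real^('n1 + 'n2)"
    assume pair: "finsler_patch_pair U1 L1 U2 L2 \<kappa> L" and x: "left_vec x \<in> U1" "right_vec x \<in> U2"
    interpret finsler_patch_pair U1 L1 U2 L2 \<kappa> L by (rule pair)
    have U: "x \<in> U" using x by simp
    show "patch_density V product_slit L x = 1 / ?b * (\<kappa> ^ CARD('n2) * (enn2real C * (?b1 * ?b2))) *
      (patch_density V (- {0}) L1 (left_vec x) * patch_density V (- {0}) L2 (right_vec x))"
      unfolding Holmes_Thompson patch_density_product_Holmes_Thompson[OF U]
        P1.patch_density_Holmes_Thompson[OF x(1)] P2.patch_density_Holmes_Thompson[OF x(2)]
        C[OF P1.weight_homogeneous[OF x(1)] P2.weight_homogeneous[OF x(2)]] enn2real_mult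
      using b by (simp add: field_simps)
  qed (use assms in simp)
next
  case Maximum
  show ?thesis
  proof (rule exI[of _ "sqrt (\<kappa> ^ CARD('n2))"], intro conjI allI impI)
    fix U1 :: "(real^'n1) set" and L1 and U2 :: "(real^'n2) set" and L2 L and x :: "real^('n1 + 'n2)"
    assume "finsler_patch_pair U1 L1 U2 L2 \<kappa> L" and "left_vec x \<in> U1" "right_vec x \<in> U2"
    then show "patch_density V product_slit L x = sqrt (\<kappa> ^ CARD('n2)) *
      (patch_density V (- {0}) L1 (left_vec x) * patch_density V (- {0}) L2 (right_vec x))"
      unfolding Maximum by (intro finsler_patch_pair.patch_density_product_Maximum) auto
  qed (use assms in simp)
next
  case Minimum
  show ?thesis
  proof (rule exI[of _ "sqrt (\<kappa> ^ CARD('n2))"], intro conjI allI impI)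
    fix U1 :: "(real^'n1) set" and L1 and U2 :: "(real^'n2) set" and L2 L and x :: "real^('n1 + 'n2)"
    assume "finsler_patch_pair U1 L1 U2 L2 \<kappa> L" and "left_vec x \<in> U1" "right_vec x \<in> U2"
    then show "patch_density V product_slit L x = sqrt (\<kappa> ^ CARD('n2)) *
      (patch_density V (- {0}) L1 (left_vec x) * patch_density V (- {0}) L2 (right_vec x))"
      unfolding Minimum by (intro finsler_patch_pair.patch_density_product_Minimum) auto
  qed (use assms in simp)
qed

section \<open>Finite volume of the product, and the conclusion\<close>

lemma (in finsler_manifold_pair) finite_volume_product:
  assumes "finite_volume V A1 (slit_tangent_bundle A1) F1"
    and "finite_volume V A2 (slit_tangent_bundle A2) F2"
  shows "finite_volume V P D W"
proof -
  define \<sigma>1 where "\<sigma>1 = volume_density V A1 (slit_tangent_bundle A1) F1"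
  define \<sigma>2 where "\<sigma>2 = volume_density V A2 (slit_tangent_bundle A2) F2"
  obtain \<mu>1 where \<mu>1: "volume_measure A1 \<sigma>1 \<mu>1" "emeasure \<mu>1 UNIV < \<infinity>"
    using assms(1) unfolding finite_volume_def \<sigma>1_def by blast
  obtain \<mu>2 where \<mu>2: "volume_measure A2 \<sigma>2 \<mu>2" "emeasure \<mu>2 UNIV < \<infinity>"
    using assms(2) unfolding finite_volume_def \<sigma>2_def by blast
  have \<sigma>1: "\<sigma>1 c x = patch_density V (- {0}) (local_rep A1 F1 c) x" if "x \<in> cimage A1 c" for c x
    unfolding \<sigma>1_def by (rule volume_density_eq_patch_density[OF M1.local_set_slit that])
  have \<sigma>2: "\<sigma>2 c x = patch_density V (- {0}) (local_rep A2 F2 c) x" if "x \<in> cimage A2 c" for c x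
    unfolding \<sigma>2_def by (rule volume_density_eq_patch_density[OF M2.local_set_slit that])
  obtain C where C: "0 \<le> C"
    "\<forall>(U1 :: (real^'n1) set) L1 (U2 :: (real^'n2) set) L2 L x.
      finsler_patch_pair U1 L1 U2 L2 (k\<^sup>2) L \<longrightarrow> left_vec x \<in> U1 \<longrightarrow> right_vec x \<in> U2 \<longrightarrow>
      patch_density V product_slit L x =
        C * (patch_density V (- {0}) L1 (left_vec x) * patch_density V (- {0}) L2 (right_vec x))"
    using patch_density_product[of "k\<^sup>2" V, OF zero_less_power[OF k_pos]] by blast
  have \<sigma>: "volume_density V P D W c x = C * (\<sigma>1 (fst c) (left_vec x) * \<sigma>2 (snd c) (right_vec x))"
    if x: "x \<in> cimage P c" for c x
  proof -
    have "left_vec x \<in> cimage A1 (fst c)" "right_vec x \<in> cimage A2 (snd c)"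
      using x by (simp_all add: cimage_eq)
    then show ?thesis
      using C(2)[rule_format, OF patch.finsler_patch_pair_axioms[of c]]
      by (simp add: volume_density_eq_patch_density[OF local_set_eq x] \<sigma>1 \<sigma>2)
  qed
  \<comment> \<open>The global density is known to agree with the local one only on the chart image,
    where the indicator confines the comparison.\<close>
  have m1: "(\<lambda>x. ennreal (\<sigma>1 c x) * indicator (cimage A1 c) x) \<in> borel_measurable borel" for c
  proof -
    have "(\<lambda>x. ennreal (\<sigma>1 c x) * indicator (cimage A1 c) x) =
        (\<lambda>x. ennreal (patch_density V (- {0}) (local_rep A1 F1 c) x) * indicator (cimage A1 c) x)"
      by (auto simp: \<sigma>1 indicator_def)
    then show ?thesis
      using finsler_patch.patch_density_measurable[OF M1.finsler_manifold_patch[OF finsler1]] by simp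
  qed
  have m2: "(\<lambda>x. ennreal (\<sigma>2 c x) * indicator (cimage A2 c) x) \<in> borel_measurable borel" for c
  proof -
    have "(\<lambda>x. ennreal (\<sigma>2 c x) * indicator (cimage A2 c) x) =
        (\<lambda>x. ennreal (patch_density V (- {0}) (local_rep A2 F2 c) x) * indicator (cimage A2 c) x)"
      by (auto simp: \<sigma>2 indicator_def)
    then show ?thesis
      using finsler_patch.patch_density_measurable[OF M2.finsler_manifold_patch[OF finsler2]] by simp
  qed
  have n1: "0 \<le> \<sigma>1 c x" if "x \<in> cimage A1 c" for c x
    unfolding \<sigma>1[OF that]
    by (rule finsler_patch.patch_density_nonneg[OF M1.finsler_manifold_patch[OF finsler1] that])
  have n2: "0 \<le> \<sigma>2 c x" if "x \<in> cimage A2 c" for c x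
    unfolding \<sigma>2[OF that]
    by (rule finsler_patch.patch_density_nonneg[OF M2.finsler_manifold_patch[OF finsler2] that])
  show ?thesis
    unfolding finite_volume_def
    using product_volume_measure[OF \<mu>1 \<mu>2 m1 m2 n1 n2 C(1) \<sigma>] by blast
qed

theorem corollary4p2:
  fixes A1 :: "('c1, 'm1::{second_countable_topology, t2_space}, 'n1::finite) atlas"
    and A2 :: "('c2, 'm2::{second_countable_topology, t2_space}, 'n2::finite) atlas"
    and F1 :: "('c1, 'm1, 'n1) tangent_fun"
    and F2 :: "('c2, 'm2, 'n2) tangent_fun"
    and f :: "'m1 \<Rightarrow> real"
    and V :: volume_form
  assumes "finite_volume V A1 (slit_tangent_bundle A1) F1"
    and "finite_volume V A2 (slit_tangent_bundle A2) F2"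
    and "smooth_function A1 f" and "\<And>p. f p > 0"
    and "f constant_on UNIV"
  shows "(berwald_manifold A1 (slit_tangent_bundle A1) F1 \<and>
          berwald_manifold A2 (slit_tangent_bundle A2) F2 \<longrightarrow>
            berwald_manifold (product_atlas A1 A2) (product_slit_bundle A1 A2)
              (warped_metric A1 F1 A2 F2 f) \<and>
            finite_volume V (product_atlas A1 A2) (product_slit_bundle A1 A2)
              (warped_metric A1 F1 A2 F2 f)) \<and>
         (weakly_berwald_manifold A1 (slit_tangent_bundle A1) F1 \<and>
          weakly_berwald_manifold A2 (slit_tangent_bundle A2) F2 \<longrightarrow>
            weakly_berwald_manifold (product_atlas A1 A2) (product_slit_bundle A1 A2)
              (warped_metric A1 F1 A2 F2 f) \<and>
            finite_volume V (product_atlas A1 A2) (product_slit_bundle A1 A2)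
              (warped_metric A1 F1 A2 F2 f))"
proof -
  obtain k where k: "\<And>p. f p = k" using assms(5) unfolding constant_on_def by blast
  have pair: "finsler_manifold_pair A1 F1 A2 F2 f k"
    if "finsler_manifold A1 (slit_tangent_bundle A1) F1" "finsler_manifold A2 (slit_tangent_bundle A2) F2"
    using that k assms(4) by unfold_locales simp_all
  note facts = finsler_manifold_pair.berwald_product finsler_manifold_pair.weakly_berwald_product
    finsler_manifold_pair.finite_volume_product
  show ?thesis
  proof (intro conjI impI; elim conjE)
    assume b: "berwald_manifold A1 (slit_tangent_bundle A1) F1" "berwald_manifold A2 (slit_tangent_bundle A2) F2"
    then have "finsler_manifold_pair A1 F1 A2 F2 f k"
      by (intro pair) (simp_all add: berwald_manifold_def)
    then show "berwald_manifold (product_atlas A1 A2) (product_slit_bundle A1 A2) (warped_metric A1 F1 A2 F2 f)"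
      "finite_volume V (product_atlas A1 A2) (product_slit_bundle A1 A2) (warped_metric A1 F1 A2 F2 f)"
      using facts b assms(1,2) by blast+
  next
    assume b: "weakly_berwald_manifold A1 (slit_tangent_bundle A1) F1"
      "weakly_berwald_manifold A2 (slit_tangent_bundle A2) F2"
    then have "finsler_manifold_pair A1 F1 A2 F2 f k"
      by (intro pair) (simp_all add: weakly_berwald_manifold_def)
    then show "weakly_berwald_manifold (product_atlas A1 A2) (product_slit_bundle A1 A2) (warped_metric A1 F1 A2 F2 f)"
      "finite_volume V (product_atlas A1 A2) (product_slit_bundle A1 A2) (warped_metric A1 F1 A2 F2 f)"
      using facts b assms(1,2) by blast+
  qed
qed

end
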